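(* Let $[\Gamma]$ be a smooth projective structure on a surface $U$. For local coordinates $(x,y)$ on $U$ let $\det\mathcal M([\Gamma])$ be the determinant of the $6\times6$ matrix with rows $\mathbf V,D_1\mathbf V,D_2\mathbf V,D_{(1}D_{1)}\mathbf V,D_{(1}D_{2)}\mathbf V,D_{(2}D_{2)}\mathbf V$ computed in these coordinates (see the context). Then the section $$\det\big(\mathcal M([\Gamma])\big)\,(dx\wedge dy)^{\otimes14}$$ of the 14th power of the canonical bundle of $U$ is a projective invariant; that is, it depends only on the projective structure $[\Gamma]$, and neither on the choice of the connection in $[\Gamma]$ nor on the choice of local coordinates.
   Context: A projective structure $[\Gamma]$ on $U$ is an equivalence class of torsion-free connections, where $\Gamma\sim\hat\Gamma$ iff they have the same unparametrised geodesics, i.e. $\hat\Gamma^c_{ab}=\Gamma^c_{ab}+\delta^c_a\omega_b+\delta^c_b\omega_a$ for some one-form $\omega$. In local coordinates $(x^1,x^2)=(x,y)$, with $\partial_1=\partial_x$, $\partial_2=\partial_y$, put $$A_3=\Gamma^1_{22},\quad A_2=2\Gamma^1_{12}-\Gamma^2_{22},\quad A_1=\Gamma^1_{11}-2\Gamma^2_{12},\quad A_0=-\Gamma^2_{11}.$$ Liouville expressions: $L_1=\frac23\partial_x\partial_yA_1-\frac13\partial_x^2A_2-\partial_y^2A_0+A_0\partial_yA_2+A_2\partial_yA_0-A_3\partial_xA_0-2A_0\partial_xA_3-\frac23A_1\partial_yA_1+\frac13A_1\partial_xA_2$, $L_2=\frac23\partial_x\partial_yA_2-\frac13\partial_y^2A_1-\partial_x^2A_3-A_3\partial_xA_1-A_1\partial_xA_3+A_0\partial_yA_3+2A_3\partial_yA_0+\frac23A_2\partial_xA_2-\frac13A_2\partial_yA_1$.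 The row vector $\mathbf V=(V_1,\dots,V_6)$: $V_1=2\partial_yL_2+4A_2L_2+8A_3L_1$, $V_2=-2\partial_yL_1-2\partial_xL_2-\frac43A_1L_2+\frac43A_2L_1$, $V_3=2\partial_xL_1-8A_0L_2-4A_1L_1$, $V_4=-5L_2$, $V_5=-5L_1$, $V_6=0$. The $6\times6$ matrices $\mathbf\Omega_1,\mathbf\Omega_2$: $$\mathbf\Omega_1=\begin{pmatrix} -\frac23A_1&2A_0&0&0&0&0 \\ 0&0&0&-\frac12&0&0 \\ -2A_3&-\frac23A_2&\frac43A_1&0&1&0 \\ {a_{41}}&a_{42}&a_{43}&-\frac13A_1&-3A_0&0 \\ 0&0&0&0&0&-1 \\ {a_{61}}&a_{62}&a_{63}&a_{64}&a_{65}&-\frac13A_1 \end{pmatrix},\quad \mathbf\Omega_2=\begin{pmatrix} -\frac43A_2&\frac23A_1&2A_0&1&0&0 \\ 0&0&0&0&-\frac12&0 \\ 0&-2A_3&\frac23A_2&0&0&0 \\ 0&0&0&0&0&-1 \\ {b_{51}}&b_{52}&b_{53}&3A_3&\frac13A_2&0 \\ {b_{61}}&b_{62}&b_{63}&b_{64}&b_{65}&\frac13A_2 \end{pmatrix}$$ with $a_{41}=-\frac43\partial_xA_2+4A_0A_3+\frac23\partial_yA_1$; $a_{42}=-2\partial_yA_0+\frac23\partial_xA_1+4A_2A_0-\frac49A_1^2$; $a_{43}=2\partial_xA_0-4A_0A_1$; $a_{61}=-\frac43\partial_x\partial_yA_2-\frac{20}3A_0A_2A_3+\frac23\partial_y^2A_1+4A_3\partial_yA_0-2A_0\partial_yA_3-\frac{16}9A_2\partial_xA_2+\frac89A_2\partial_yA_1$;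 $a_{62}=\frac23\partial_x\partial_yA_1-\frac43A_1\partial_yA_1+2A_0\partial_yA_2-2\partial_y^2A_0+4A_2\partial_yA_0+4A_3\partial_xA_0+6A_0\partial_xA_3+\frac89A_1\partial_xA_2+\frac43A_0A_1A_3-\frac43A_0A_2^2$; $a_{63}=2\partial_x\partial_yA_0+\frac23A_0\partial_xA_2-\frac43A_2\partial_xA_0-4A_1\partial_yA_0-\frac43A_0\partial_yA_1+\frac83A_0A_1A_2+4A_3A_0^2$; $a_{64}=\frac43\partial_xA_2-\partial_yA_1+5A_0A_3$; $a_{65}=\frac13\partial_xA_1-4\partial_yA_0+3A_2A_0-\frac29A_1^2$; $b_{51}=-2\partial_yA_3-4A_3A_2$; $b_{52}=2\partial_xA_3-\frac23\partial_yA_2+4A_1A_3-\frac49A_2^2$; $b_{53}=\frac43\partial_yA_1-\frac23\partial_xA_2+4A_0A_3$; $b_{61}=-2\partial_x\partial_yA_3-4A_2\partial_xA_3-\frac43A_3\partial_xA_2+\frac23A_3\partial_yA_1-\frac43A_1\partial_yA_3-4A_0A_3^2-\frac83A_1A_2A_3$; $b_{62}=2\partial_x^2A_3-\frac43A_2\partial_xA_2-\frac43A_0A_2A_3-\frac23\partial_x\partial_yA_2+4A_1\partial_xA_3+4A_0\partial_yA_3+6A_3\partial_yA_0+\frac43A_3A_1^2+2A_3\partial_xA_1+\frac89A_2\partial_yA_1$; $b_{63}=-\frac23\partial_x^2A_2+\frac89A_1\partial_xA_2+4A_0\partial_xA_3-2A_3\partial_xA_0-\frac{16}9A_1\partial_yA_1+\frac43\partial_x\partial_yA_1+\frac{20}3A_0A_1A_3$;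 $b_{64}=4\partial_xA_3-\frac13\partial_yA_2+3A_1A_3-\frac29A_2^2$; $b_{65}=\partial_xA_2-\frac43\partial_yA_1+5A_0A_3$. For a row-vector valued function $\mathbf W$ set $D_a\mathbf W=\partial_a\mathbf W-\mathbf W\,\mathbf\Omega_a$ ($a=1,2$), iterated: $D_aD_b\mathbf V=\partial_a(D_b\mathbf V)-(D_b\mathbf V)\mathbf\Omega_a$. Round brackets around indices denote symmetrisation. Independence of coordinates means: if $(\bar x,\bar y)$ is another local coordinate system and $\overline{\mathcal M}$ is computed from the coefficients of $[\Gamma]$ in it, then $\det\overline{\mathcal M}\,(d\bar x\wedge d\bar y)^{\otimes14}=\det\mathcal M\,(dx\wedge dy)^{\otimes14}$ on the overlap. *)

theory Defs
  imports "HOL-Analysis.Analysis"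
begin

section \<open>Smooth maps and partial derivatives\<close>

fun higher_differentiable_on ::
  "'a::real_normed_vector set \<Rightarrow> ('a \<Rightarrow> 'b::real_normed_vector) \<Rightarrow> nat \<Rightarrow> bool" where
  "higher_differentiable_on S f 0 \<longleftrightarrow> continuous_on S f"
| "higher_differentiable_on S f (Suc n) \<longleftrightarrow>
     (\<forall>x\<in>S. f differentiable (at x)) \<and>
     (\<forall>v. higher_differentiable_on S (\<lambda>x. frechet_derivative f (at x) v) n)"

text \<open>Only used for open \<open>S\<close>, where it says that \<open>f\<close> is of class $C^\infty$ on \<open>S\<close>.\<close>

definition smooth_on ::
  "'a::real_normed_vector set \<Rightarrow> ('a \<Rightarrow> 'b::real_normed_vector) \<Rightarrow> bool" where
  "smooth_on S f \<longleftrightarrow> (\<forall>n. higher_differentiable_on S f n)"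

definition partial :: "2 \<Rightarrow> (real^2 \<Rightarrow> 'b::real_normed_vector) \<Rightarrow> real^2 \<Rightarrow> 'b" where
  "partial i f p = frechet_derivative f (at p) (axis i 1)"

section \<open>Smooth surfaces\<close>

text \<open>A chart is a pair of its domain and its coordinate map; the values of the coordinate map
  outside the domain are irrelevant.\<close>

type_synonym 'a chart = "'a set \<times> ('a \<Rightarrow> real^2)"

definition chart_image :: "'a chart \<Rightarrow> (real^2) set" where
  "chart_image c = snd c ` fst c"

definition is_chart :: "'a topology \<Rightarrow> 'a chart \<Rightarrow> bool" where
  "is_chart X c \<longleftrightarrow> openin X (fst c) \<and> open (chart_image c) \<and>
     homeomorphic_map (subtopology X (fst c)) (top_of_set (chart_image c)) (snd c)"

text \<open>The change of coordinates from \<open>c\<close> to \<open>d\<close>, meaningful on the part of \<open>chart_image c\<close>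
  that corresponds to the overlap of the two domains.\<close>

definition transition :: "'a chart \<Rightarrow> 'a chart \<Rightarrow> real^2 \<Rightarrow> real^2" where
  "transition c d = snd d \<circ> inv_into (fst c) (snd c)"

definition compatible_charts :: "'a chart \<Rightarrow> 'a chart \<Rightarrow> bool" where
  "compatible_charts c d \<longleftrightarrow>
     smooth_on (snd c ` (fst c \<inter> fst d)) (transition c d) \<and>
     smooth_on (snd d ` (fst c \<inter> fst d)) (transition d c)"

text \<open>The atlas is required to be maximal, so that its members are all the local coordinate
  systems of the surface.\<close>

definition smooth_surface :: "'a topology \<Rightarrow> 'a chart set \<Rightarrow> bool" where
  "smooth_surface X \<A> \<longleftrightarrow>
     Hausdorff_space X \<and> second_countable X \<and>
     (\<forall>c\<in>\<A>. is_chart X c) \<and>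
     (\<Union>c\<in>\<A>. fst c) = topspace X \<and>
     (\<forall>c\<in>\<A>. \<forall>d\<in>\<A>. compatible_charts c d) \<and>
     (\<forall>c. is_chart X c \<and> (\<forall>d\<in>\<A>. compatible_charts c d) \<longrightarrow> c \<in> \<A>)"

section \<open>Geometric objects on a surface, given by their components in all charts\<close>

text \<open>\<open>\<Gamma> k i j\<close> is $\Gamma^k_{ij}$, as a function of the two coordinates.\<close>

type_synonym christoffel = "2 \<Rightarrow> 2 \<Rightarrow> 2 \<Rightarrow> real^2 \<Rightarrow> real"

definition torsion_free_connections :: "'a chart set \<Rightarrow> ('a chart \<Rightarrow> christoffel) set" where
  "torsion_free_connections \<A> = {\<Gamma>.
     (\<forall>c\<in>\<A>. \<forall>k i j. smooth_on (chart_image c) (\<Gamma> c k i j)) \<and>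
     (\<forall>c\<in>\<A>. \<forall>p\<in>chart_image c. \<forall>k i j. \<Gamma> c k i j p = \<Gamma> c k j i p) \<and>
     (\<forall>c\<in>\<A>. \<forall>d\<in>\<A>. \<forall>q\<in>snd d ` (fst c \<inter> fst d). \<forall>k i j.
        let \<tau> = transition c d; \<sigma> = transition d c in
        \<Gamma> d k i j q =
          (\<Sum>r\<in>UNIV. partial r \<tau> (\<sigma> q) $ k *
             (partial i (partial j \<sigma>) q $ r +
              (\<Sum>m\<in>UNIV. \<Sum>n\<in>UNIV.
                 partial i \<sigma> q $ m * partial j \<sigma> q $ n * \<Gamma> c r m n (\<sigma> q)))))}"

definition one_form :: "'a chart set \<Rightarrow> ('a chart \<Rightarrow> 2 \<Rightarrow> real^2 \<Rightarrow> real) \<Rightarrow> bool" where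
  "one_form \<A> \<omega> \<longleftrightarrow>
     (\<forall>c\<in>\<A>. \<forall>i. smooth_on (chart_image c) (\<omega> c i)) \<and>
     (\<forall>c\<in>\<A>. \<forall>d\<in>\<A>. \<forall>q\<in>snd d ` (fst c \<inter> fst d). \<forall>i.
        let \<sigma> = transition d c in
        \<omega> d i q = (\<Sum>m\<in>UNIV. partial i \<sigma> q $ m * \<omega> c m (\<sigma> q)))"

definition projective_equivalence ::
  "'a chart set \<Rightarrow> (('a chart \<Rightarrow> christoffel) \<times> ('a chart \<Rightarrow> christoffel)) set" where
  "projective_equivalence \<A> = {(\<Gamma>, \<Gamma>').
     \<Gamma> \<in> torsion_free_connections \<A> \<and> \<Gamma>' \<in> torsion_free_connections \<A> \<and>
     (\<exists>\<omega>. one_form \<A> \<omega> \<and>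
        (\<forall>c\<in>\<A>. \<forall>p\<in>chart_image c. \<forall>k i j.
           \<Gamma>' c k i j p =
             \<Gamma> c k i j p + of_bool (k = i) * \<omega> c j p + of_bool (k = j) * \<omega> c i p))}"

definition projective_structures :: "'a chart set \<Rightarrow> ('a chart \<Rightarrow> christoffel) set set" where
  "projective_structures \<A> = torsion_free_connections \<A> // projective_equivalence \<A>"

text \<open>Smooth sections of the \<open>w\<close>-th power of the canonical bundle: the family \<open>s\<close> stands for the
  section that equals $s_c\,(dx\wedge dy)^{\otimes w}$ in the coordinates $(x,y)$ of the chart \<open>c\<close>.
  The transformation law is the equality of the expressions for \<open>c\<close> and \<open>d\<close> on the overlap,
  as $d\bar x\wedge d\bar y$ is the Jacobian determinant times $dx\wedge dy$.\<close>

definition canonical_power_section ::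
  "'a chart set \<Rightarrow> nat \<Rightarrow> ('a chart \<Rightarrow> real^2 \<Rightarrow> real) \<Rightarrow> bool" where
  "canonical_power_section \<A> w s \<longleftrightarrow>
     (\<forall>c\<in>\<A>. smooth_on (chart_image c) (s c)) \<and>
     (\<forall>c\<in>\<A>. \<forall>d\<in>\<A>. \<forall>u\<in>fst c \<inter> fst d.
        s d (snd d u) * det (jacobian (transition c d) (at (snd c u))) ^ w = s c (snd c u))"

section \<open>The matrix of the invariant in local coordinates\<close>

abbreviation dx :: "(real^2 \<Rightarrow> real) \<Rightarrow> real^2 \<Rightarrow> real" where "dx \<equiv> partial 1"
abbreviation dy :: "(real^2 \<Rightarrow> real) \<Rightarrow> real^2 \<Rightarrow> real" where "dy \<equiv> partial 2"

context
  fixes \<Gamma> :: christoffel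
begin

definition A0 :: "real^2 \<Rightarrow> real" where "A0 p = - \<Gamma> 2 1 1 p"
definition A1 :: "real^2 \<Rightarrow> real" where "A1 p = \<Gamma> 1 1 1 p - 2 * \<Gamma> 2 1 2 p"
definition A2 :: "real^2 \<Rightarrow> real" where "A2 p = 2 * \<Gamma> 1 1 2 p - \<Gamma> 2 2 2 p"
definition A3 :: "real^2 \<Rightarrow> real" where "A3 p = \<Gamma> 1 2 2 p"

definition L1 :: "real^2 \<Rightarrow> real" where
  "L1 p = 2/3 * dx (dy A1) p - 1/3 * dx (dx A2) p - dy (dy A0) p
     + A0 p * dy A2 p + A2 p * dy A0 p - A3 p * dx A0 p - 2 * A0 p * dx A3 p
     - 2/3 * A1 p * dy A1 p + 1/3 * A1 p * dx A2 p"

definition L2 :: "real^2 \<Rightarrow> real" where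
  "L2 p = 2/3 * dx (dy A2) p - 1/3 * dy (dy A1) p - dx (dx A3) p
     - A3 p * dx A1 p - A1 p * dx A3 p + A0 p * dy A3 p + 2 * A3 p * dy A0 p
     + 2/3 * A2 p * dx A2 p - 1/3 * A2 p * dy A1 p"

definition V :: "real^2 \<Rightarrow> real^6" where
  "V p = vector [
     2 * dy L2 p + 4 * A2 p * L2 p + 8 * A3 p * L1 p,
     - 2 * dy L1 p - 2 * dx L2 p - 4/3 * A1 p * L2 p + 4/3 * A2 p * L1 p,
     2 * dx L1 p - 8 * A0 p * L2 p - 4 * A1 p * L1 p,
     - 5 * L2 p,
     - 5 * L1 p,
     0]"

definition a41 :: "real^2 \<Rightarrow> real" where
  "a41 p = - 4/3 * dx A2 p + 4 * A0 p * A3 p + 2/3 * dy A1 p"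
definition a42 :: "real^2 \<Rightarrow> real" where
  "a42 p = - 2 * dy A0 p + 2/3 * dx A1 p + 4 * A2 p * A0 p - 4/9 * (A1 p)^2"
definition a43 :: "real^2 \<Rightarrow> real" where
  "a43 p = 2 * dx A0 p - 4 * A0 p * A1 p"
definition a61 :: "real^2 \<Rightarrow> real" where
  "a61 p = - 4/3 * dx (dy A2) p - 20/3 * A0 p * A2 p * A3 p + 2/3 * dy (dy A1) p
     + 4 * A3 p * dy A0 p - 2 * A0 p * dy A3 p - 16/9 * A2 p * dx A2 p + 8/9 * A2 p * dy A1 p"
definition a62 :: "real^2 \<Rightarrow> real" where
  "a62 p = 2/3 * dx (dy A1) p - 4/3 * A1 p * dy A1 p + 2 * A0 p * dy A2 p - 2 * dy (dy A0) p
     + 4 * A2 p * dy A0 p + 4 * A3 p * dx A0 p + 6 * A0 p * dx A3 p + 8/9 * A1 p * dx A2 p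
     + 4/3 * A0 p * A1 p * A3 p - 4/3 * A0 p * (A2 p)^2"
definition a63 :: "real^2 \<Rightarrow> real" where
  "a63 p = 2 * dx (dy A0) p + 2/3 * A0 p * dx A2 p - 4/3 * A2 p * dx A0 p - 4 * A1 p * dy A0 p
     - 4/3 * A0 p * dy A1 p + 8/3 * A0 p * A1 p * A2 p + 4 * A3 p * (A0 p)^2"
definition a64 :: "real^2 \<Rightarrow> real" where
  "a64 p = 4/3 * dx A2 p - dy A1 p + 5 * A0 p * A3 p"
definition a65 :: "real^2 \<Rightarrow> real" where
  "a65 p = 1/3 * dx A1 p - 4 * dy A0 p + 3 * A2 p * A0 p - 2/9 * (A1 p)^2"

definition b51 :: "real^2 \<Rightarrow> real" where
  "b51 p = - 2 * dy A3 p - 4 * A3 p * A2 p"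
definition b52 :: "real^2 \<Rightarrow> real" where
  "b52 p = 2 * dx A3 p - 2/3 * dy A2 p + 4 * A1 p * A3 p - 4/9 * (A2 p)^2"
definition b53 :: "real^2 \<Rightarrow> real" where
  "b53 p = 4/3 * dy A1 p - 2/3 * dx A2 p + 4 * A0 p * A3 p"
definition b61 :: "real^2 \<Rightarrow> real" where
  "b61 p = - 2 * dx (dy A3) p - 4 * A2 p * dx A3 p - 4/3 * A3 p * dx A2 p + 2/3 * A3 p * dy A1 p
     - 4/3 * A1 p * dy A3 p - 4 * A0 p * (A3 p)^2 - 8/3 * A1 p * A2 p * A3 p"
definition b62 :: "real^2 \<Rightarrow> real" where
  "b62 p = 2 * dx (dx A3) p - 4/3 * A2 p * dx A2 p - 4/3 * A0 p * A2 p * A3 p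
     - 2/3 * dx (dy A2) p + 4 * A1 p * dx A3 p + 4 * A0 p * dy A3 p + 6 * A3 p * dy A0 p
     + 4/3 * A3 p * (A1 p)^2 + 2 * A3 p * dx A1 p + 8/9 * A2 p * dy A1 p"
definition b63 :: "real^2 \<Rightarrow> real" where
  "b63 p = - 2/3 * dx (dx A2) p + 8/9 * A1 p * dx A2 p + 4 * A0 p * dx A3 p - 2 * A3 p * dx A0 p
     - 16/9 * A1 p * dy A1 p + 4/3 * dx (dy A1) p + 20/3 * A0 p * A1 p * A3 p"
definition b64 :: "real^2 \<Rightarrow> real" where
  "b64 p = 4 * dx A3 p - 1/3 * dy A2 p + 3 * A1 p * A3 p - 2/9 * (A2 p)^2"
definition b65 :: "real^2 \<Rightarrow> real" where
  "b65 p = dx A2 p - 4/3 * dy A1 p + 5 * A0 p * A3 p"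

definition \<Omega>1 :: "real^2 \<Rightarrow> real^6^6" where
  "\<Omega>1 p = vector [
     vector [- 2/3 * A1 p, 2 * A0 p, 0, 0, 0, 0],
     vector [0, 0, 0, - 1/2, 0, 0],
     vector [- 2 * A3 p, - 2/3 * A2 p, 4/3 * A1 p, 0, 1, 0],
     vector [a41 p, a42 p, a43 p, - 1/3 * A1 p, - 3 * A0 p, 0],
     vector [0, 0, 0, 0, 0, - 1],
     vector [a61 p, a62 p, a63 p, a64 p, a65 p, - 1/3 * A1 p]]"

definition \<Omega>2 :: "real^2 \<Rightarrow> real^6^6" where
  "\<Omega>2 p = vector [
     vector [- 4/3 * A2 p, 2/3 * A1 p, 2 * A0 p, 1, 0, 0],
     vector [0, 0, 0, 0, - 1/2, 0],
     vector [0, - 2 * A3 p, 2/3 * A2 p, 0, 0, 0],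
     vector [0, 0, 0, 0, 0, - 1],
     vector [b51 p, b52 p, b53 p, 3 * A3 p, 1/3 * A2 p, 0],
     vector [b61 p, b62 p, b63 p, b64 p, b65 p, 1/3 * A2 p]]"

definition D1 :: "(real^2 \<Rightarrow> real^6) \<Rightarrow> real^2 \<Rightarrow> real^6" where
  "D1 W p = partial 1 W p - W p v* \<Omega>1 p"

definition D2 :: "(real^2 \<Rightarrow> real^6) \<Rightarrow> real^2 \<Rightarrow> real^6" where
  "D2 W p = partial 2 W p - W p v* \<Omega>2 p"

definition \<M> :: "real^2 \<Rightarrow> real^6^6" where
  "\<M> p = vector [
     V p,
     D1 V p,
     D2 V p,
     D1 (D1 V) p,
     (1/2) *\<^sub>R (D1 (D2 V) p + D2 (D1 V) p),
     D2 (D2 V) p]"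

end

end

theory Submission
  imports Defs
begin

text \<open>The entries of $\mathbf V$ and $\mathbf\Omega_a$ are differential polynomials in the $A_i$, so the
  transformation law is an identity in the ring of germs of smooth functions with its two commuting
  derivations. Up to interchanging $x$ and $y$, every change of coordinates is a composition of two
  changes of a single coordinate. If $x = x(u,v)$, $y = v$ and $s = x_u$, there is a matrix $H$ with
  $\det H = s^4$ such that $\mathbf V' = s \mathbf V H$ and, with $\mathbf\Omega_a$ pulled back,
  $\partial_a H = H \mathbf\Omega'_a - \mathbf\Omega_a H + \theta_a H$ for scalars $\theta_a$. Hence
  $\mathcal M' = T \mathcal M \cdot sH$, where $T$ is triangular with $\det T = s^4$, and
  $\det\mathcal M' = s^4 \cdot s^6 \cdot s^4 \det\mathcal M$. The choice of the connection does not matter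
  because $\mathcal M$ depends on it only through the $A_i$.\<close>

section \<open>Algebra of derivations and linear algebra in dimension six\<close>

section \<open>Derivations\<close>

text \<open>In a ring with derivations their transformation is a matter of polynomial identities,
  and smoothness is dealt with only once, in the passage to germs. The price is that germs have zero
  divisors: inverses such as \<open>sk\<close>, \<open>ak\<close> and \<open>\<delta>'\<close> are
  carried along, and division by 3 takes the form of \<open>cancel_3\<close>. A germ is a unit as
  soon as its value at the point is nonzero, and an invertible Jacobian matrix has x_u or y_u
  nonzero there; hence the factorisation exists up to interchanging x and y. The scalars \<theta>_a
  make up for fractional weights. The true change of frame is s^(-2/3) H, and with respect to it V
  has weight 5/3. As s need not have a cube root in the ring, these powers enter only through their
  logarithmic derivatives: two thirds of ds/s is \<open>2 * al\<close>, \<open>2 * be\<close>, and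
  five thirds of it is \<open>5 * al\<close>, \<open>5 * be\<close>.\<close>

definition derivation :: "('r::comm_ring_1 \<Rightarrow> 'r) \<Rightarrow> bool" where
  "derivation d \<longleftrightarrow> (\<forall>x y. d (x + y) = d x + d y) \<and> (\<forall>x y. d (x * y) = d x * y + x * d y)"

context
  fixes d :: "'r::comm_ring_1 \<Rightarrow> 'r"
  assumes d: "derivation d"
begin

lemma derivation_add: "d (x + y) = d x + d y"
  and derivation_mult: "d (x * y) = d x * y + x * d y"
  using d by (auto simp: derivation_def)

lemma derivation_0: "d 0 = 0"
  using derivation_add[of 0 0] by simp

lemma derivation_1: "d 1 = 0"
  using derivation_mult[of 1 1] by simp

lemma derivation_minus: "d (- x) = - d x"
  using derivation_add[of x "- x"] derivation_0 by (simp add: eq_neg_iff_add_eq_0 add.commute)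

lemma derivation_diff: "d (x - y) = d x - d y"
  using derivation_add[of x "- y"] derivation_minus by simp

lemma derivation_of_nat: "d (of_nat n) = 0"
  by (induction n) (simp_all add: derivation_0 derivation_1 derivation_add)

lemma derivation_numeral: "d (numeral n) = 0"
  using derivation_of_nat[of "numeral n"] by simp

lemma derivation_sum: "finite A \<Longrightarrow> d (sum f A) = (\<Sum>i\<in>A. d (f i))"
  by (induction A rule: finite_induct) (simp_all add: derivation_0 derivation_add)

lemmas derivation_simps = derivation_add derivation_mult derivation_0 derivation_1
  derivation_minus derivation_diff derivation_numeral

end

section \<open>Vectors with six components\<close>

lemma exhaust_6:
  fixes x :: 6
  shows "x = 1 \<or> x = 2 \<or> x = 3 \<or> x = 4 \<or> x = 5 \<or> x = 6"
proof (induct x)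
  case (of_int z)
  then have "z = 0 \<or> z = 1 \<or> z = 2 \<or> z = 3 \<or> z = 4 \<or> z = 5" by auto
  then show ?case by auto
qed

lemma forall_6: "(\<forall>i::6. P i) \<longleftrightarrow> P 1 \<and> P 2 \<and> P 3 \<and> P 4 \<and> P 5 \<and> P 6"
  by (metis exhaust_6)

lemma UNIV_6: "UNIV = {1, 2, 3, 4, 5, 6::6}"
  using exhaust_6 by auto

lemma sum_6: "sum f (UNIV::6 set) = f 1 + f 2 + f 3 + f 4 + f 5 + f 6"
  unfolding UNIV_6 by (simp add: ac_simps)

lemma prod_6: "prod f (UNIV::6 set) = f 1 * f 2 * f 3 * f 4 * f 5 * f 6"
  unfolding UNIV_6 by (simp add: ac_simps)

lemma vector_6 [simp]:
  "(vector [a, b, c, d, e, f] :: 'a::zero ^ 6) $ 1 = a"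
  "(vector [a, b, c, d, e, f] :: 'a ^ 6) $ 2 = b"
  "(vector [a, b, c, d, e, f] :: 'a ^ 6) $ 3 = c"
  "(vector [a, b, c, d, e, f] :: 'a ^ 6) $ 4 = d"
  "(vector [a, b, c, d, e, f] :: 'a ^ 6) $ 5 = e"
  "(vector [a, b, c, d, e, f] :: 'a ^ 6) $ 6 = f"
  unfolding vector_def by simp_all

lemma vector_matrix_mult_component: "(v v* A) $ k = (\<Sum>i\<in>UNIV. v $ i * A $ i $ k)"
  by (simp add: vector_matrix_mult_def)

section \<open>The invariant as a differential polynomial with integral coefficients\<close>

section \<open>The invariant over a commutative ring with two derivations\<close>

text \<open>The parameters \<open>B1\<close>, \<open>B2\<close> stand for $A_1/3$, $A_2/3$, and the last three columns of
  \<open>V\<close> are doubled, with \<open>\<Omega>1\<close>, \<open>\<Omega>2\<close> conjugated accordingly: this makes all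
  coefficients integers.\<close>

locale cubic =
  fixes d1 d2 :: "'r::comm_ring_1 \<Rightarrow> 'r" and A0 B1 B2 A3 :: 'r
begin

definition L1 :: 'r where
  "L1 = 2 * d1 (d2 B1) - d1 (d1 B2) - d2 (d2 A0) + 3 * A0 * d2 B2 + 3 * B2 * d2 A0
     - A3 * d1 A0 - 2 * A0 * d1 A3 - 6 * B1 * d2 B1 + 3 * B1 * d1 B2"

definition L2 :: 'r where
  "L2 = 2 * d1 (d2 B2) - d2 (d2 B1) - d1 (d1 A3) - 3 * A3 * d1 B1 - 3 * B1 * d1 A3
     + A0 * d2 A3 + 2 * A3 * d2 A0 + 6 * B2 * d1 B2 - 3 * B2 * d2 B1"

definition V :: "'r^6" where
  "V = vector [
     2 * d2 L2 + 12 * B2 * L2 + 8 * A3 * L1,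
     - 2 * d2 L1 - 2 * d1 L2 - 4 * B1 * L2 + 4 * B2 * L1,
     2 * d1 L1 - 8 * A0 * L2 - 12 * B1 * L1,
     - 10 * L2,
     - 10 * L1,
     0]"

definition a41 :: 'r where "a41 = - 2 * d1 B2 + 2 * A0 * A3 + d2 B1"
definition a42 :: 'r where "a42 = - d2 A0 + d1 B1 + 6 * B2 * A0 - 2 * B1 * B1"
definition a43 :: 'r where "a43 = d1 A0 - 6 * A0 * B1"
definition a61 :: 'r where
  "a61 = - 2 * d1 (d2 B2) - 10 * A0 * B2 * A3 + d2 (d2 B1) + 2 * A3 * d2 A0 - A0 * d2 A3
     - 8 * B2 * d1 B2 + 4 * B2 * d2 B1"
definition a62 :: 'r where
  "a62 = d1 (d2 B1) - 6 * B1 * d2 B1 + 3 * A0 * d2 B2 - d2 (d2 A0) + 6 * B2 * d2 A0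
     + 2 * A3 * d1 A0 + 3 * A0 * d1 A3 + 4 * B1 * d1 B2 + 2 * A0 * B1 * A3 - 6 * A0 * B2 * B2"
definition a63 :: 'r where
  "a63 = d1 (d2 A0) + A0 * d1 B2 - 2 * B2 * d1 A0 - 6 * B1 * d2 A0 - 2 * A0 * d2 B1
     + 12 * A0 * B1 * B2 + 2 * A3 * A0 * A0"
definition a64 :: 'r where "a64 = 4 * d1 B2 - 3 * d2 B1 + 5 * A0 * A3"
definition a65 :: 'r where "a65 = d1 B1 - 4 * d2 A0 + 9 * B2 * A0 - 2 * B1 * B1"

definition b51 :: 'r where "b51 = - d2 A3 - 6 * A3 * B2"
definition b52 :: 'r where "b52 = d1 A3 - d2 B2 + 6 * B1 * A3 - 2 * B2 * B2"
definition b53 :: 'r where "b53 = 2 * d2 B1 - d1 B2 + 2 * A0 * A3"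
definition b61 :: 'r where
  "b61 = - d1 (d2 A3) - 6 * B2 * d1 A3 - 2 * A3 * d1 B2 + A3 * d2 B1 - 2 * B1 * d2 A3
     - 2 * A0 * A3 * A3 - 12 * B1 * B2 * A3"
definition b62 :: 'r where
  "b62 = d1 (d1 A3) - 6 * B2 * d1 B2 - 2 * A0 * B2 * A3 - d1 (d2 B2) + 6 * B1 * d1 A3
     + 2 * A0 * d2 A3 + 3 * A3 * d2 A0 + 6 * A3 * B1 * B1 + 3 * A3 * d1 B1 + 4 * B2 * d2 B1"
definition b63 :: 'r where
  "b63 = - d1 (d1 B2) + 4 * B1 * d1 B2 + 2 * A0 * d1 A3 - A3 * d1 A0 - 8 * B1 * d2 B1
     + 2 * d1 (d2 B1) + 10 * A0 * B1 * A3"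
definition b64 :: 'r where "b64 = 4 * d1 A3 - d2 B2 + 9 * B1 * A3 - 2 * B2 * B2"
definition b65 :: 'r where "b65 = 3 * d1 B2 - 4 * d2 B1 + 5 * A0 * A3"

definition \<Omega>1 :: "'r^6^6" where
  "\<Omega>1 = vector [
     vector [- 2 * B1, 2 * A0, 0, 0, 0, 0],
     vector [0, 0, 0, - 1, 0, 0],
     vector [- 2 * A3, - 2 * B2, 4 * B1, 0, 2, 0],
     vector [a41, a42, a43, - B1, - 3 * A0, 0],
     vector [0, 0, 0, 0, 0, - 1],
     vector [a61, a62, a63, a64, a65, - B1]]"

definition \<Omega>2 :: "'r^6^6" where
  "\<Omega>2 = vector [
     vector [- 4 * B2, 2 * B1, 2 * A0, 2, 0, 0],
     vector [0, 0, 0, 0, - 1, 0],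
     vector [0, - 2 * A3, 2 * B2, 0, 0, 0],
     vector [0, 0, 0, 0, 0, - 1],
     vector [b51, b52, b53, 3 * A3, B2, 0],
     vector [b61, b62, b63, b64, b65, B2]]"

definition D1 :: "'r^6 \<Rightarrow> 'r^6" where "D1 W = (\<chi> j. d1 (W $ j)) - W v* \<Omega>1"
definition D2 :: "'r^6 \<Rightarrow> 'r^6" where "D2 W = (\<chi> j. d2 (W $ j)) - W v* \<Omega>2"

text \<open>The fifth row is twice the symmetrised derivative, since 2 need not be invertible in the
  ring.\<close>

definition M :: "'r^6^6" where
  "M = vector [V, D1 V, D2 V, D1 (D1 V), D1 (D2 V) + D2 (D1 V), D2 (D2 V)]"

lemmas coeff_defs = a41_def a42_def a43_def a61_def a62_def a63_def a64_def a65_def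
  b51_def b52_def b53_def b61_def b62_def b63_def b64_def b65_def

end

section \<open>Covariance under x = x(u,v), y = v\<close>

section \<open>Change of the first coordinate\<close>

text \<open>Gauge covariance. In the Leibniz expansion of d (f W H) the terms W H
  \<open>\<Omega>'\<close> cancel, the terms W \<open>\<Omega>\<close> H complete d W to a covariant
  derivative, and f and H leave the scalars \<open>\<phi>\<close> and \<open>\<theta>\<close>. Here
  \<open>\<Omega>\<close> is a function of two indices, so that a pulled-back combination of
  matrices can be inserted directly.\<close>

lemma covariant_derivative_change:
  fixes H \<Omega>' :: "'r::comm_ring_1^'n^'n" and W :: "'r^'n"
  assumes d: "derivation d"
    and H: "\<And>i j. d (H $ i $ j) = (\<Sum>l\<in>UNIV. H $ i $ l * \<Omega>' $ l $ j)
      - (\<Sum>l\<in>UNIV. \<Omega> i l * H $ l $ j) + \<theta> * H $ i $ j"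
    and f: "d f = f * \<phi>"
    and U: "\<And>i. U $ i = d (W $ i) - (\<Sum>l\<in>UNIV. W $ l * \<Omega> l i) + (\<phi> + \<theta>) * W $ i"
  shows "(\<chi> j. d ((f *s (W v* H)) $ j)) - (f *s (W v* H)) v* \<Omega>' = f *s (U v* H)"
proof (unfold vec_eq_iff, intro allI)
  fix j
  let ?P = "\<lambda>i. \<Sum>l\<in>UNIV. H $ i $ l * \<Omega>' $ l $ j"
  let ?Q = "\<lambda>i. \<Sum>l\<in>UNIV. \<Omega> i l * H $ l $ j"
  have 1: "(\<Sum>l\<in>UNIV. (\<Sum>i\<in>UNIV. W $ i * H $ i $ l) * \<Omega>' $ l $ j) = (\<Sum>i\<in>UNIV. W $ i * ?P i)"
    unfolding sum_distrib_left sum_distrib_right by (subst sum.swap) (simp add: mult_ac)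
  have 2: "(\<Sum>i\<in>UNIV. W $ i * ?Q i) = (\<Sum>l\<in>UNIV. (\<Sum>i\<in>UNIV. W $ i * \<Omega> i l) * H $ l $ j)"
    unfolding sum_distrib_left sum_distrib_right by (subst sum.swap) (simp add: mult_ac)
  have 3: "d (\<Sum>i\<in>UNIV. W $ i * H $ i $ j) = (\<Sum>i\<in>UNIV. W $ i * ?P i) - (\<Sum>i\<in>UNIV. W $ i * ?Q i)
      + \<theta> * (\<Sum>i\<in>UNIV. W $ i * H $ i $ j) + (\<Sum>i\<in>UNIV. d (W $ i) * H $ i $ j)"
    by (simp add: derivation_sum[OF d] derivation_mult[OF d] H algebra_simps sum.distrib sum_subtractf
        sum_distrib_left)
  have 4: "(\<Sum>i\<in>UNIV. U $ i * H $ i $ j) = (\<Sum>i\<in>UNIV. d (W $ i) * H $ i $ j)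
      - (\<Sum>l\<in>UNIV. (\<Sum>i\<in>UNIV. W $ i * \<Omega> i l) * H $ l $ j)
      + (\<phi> + \<theta>) * (\<Sum>i\<in>UNIV. W $ i * H $ i $ j)"
    by (simp add: U algebra_simps sum.distrib sum_subtractf sum_distrib_left)
  have 5: "(\<Sum>l\<in>UNIV. (f * (\<Sum>i\<in>UNIV. W $ i * H $ i $ l)) * \<Omega>' $ l $ j)
      = f * (\<Sum>i\<in>UNIV. W $ i * ?P i)"
    unfolding 1[symmetric] by (simp add: sum_distrib_left mult_ac)
  show "((\<chi> j. d ((f *s (W v* H)) $ j)) - (f *s (W v* H)) v* \<Omega>') $ j = (f *s (U v* H)) $ j"
    unfolding vector_minus_component vec_lambda_beta vector_smult_component
      vector_matrix_mult_component 5 4 derivation_mult[OF d] 3 2 f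
    by (simp add: algebra_simps)
qed

text \<open>The derivations \<open>E1\<close>, \<open>E2\<close> belong to coordinates $(x,y)$ and \<open>d1\<close>, \<open>d2\<close> to
  coordinates $(u,v)$ with $x = x(u,v)$ and $y = v$. Here \<open>s\<close> $= x_u$, \<open>t\<close> $= x_v$,
  \<open>al\<close> $= x_{uu}/3x_u$, \<open>be\<close> $= x_{uv}/3x_u$, \<open>g\<close> $= x_{vv}/x_u$, and
  \<open>N0\<close>, ..., \<open>N3\<close> are the coefficients of the projective structure in the
  coordinates $(u,v)$.\<close>

locale triangular_change =
  fixes d1 d2 E1 E2 :: "'r::comm_ring_1 \<Rightarrow> 'r" and A0 B1 B2 A3 s sk t al be g :: 'r
  assumes d1: "derivation d1" and d2: "derivation d2"
    and E1: "derivation E1" and E2: "derivation E2"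
    and d_comm: "d2 (d1 x) = d1 (d2 x)" and E_comm: "E2 (E1 x) = E1 (E2 x)"
    and d1_E: "d1 x = s * E1 x" and d2_E: "d2 x = t * E1 x + E2 x"
    and s_sk: "s * sk = 1"
    and d1_s: "d1 s = 3 * s * al" and d2_s: "d2 s = 3 * s * be"
    and d1_t: "d1 t = 3 * s * be" and d2_t: "d2 t = s * g"
    and cancel_3: "3 * x = 3 * y \<Longrightarrow> x = y"
begin

text \<open>These are the general law (\<open>cubic_law\<close> below) for the Jacobian entries x_u
  = s, x_v = t, y_u = 0, y_v = 1, solved for the new coefficients. Its right-hand sides are then
  divisible by s except in \<open>N3\<close>, whence \<open>sk\<close>.\<close>

definition N0 :: 'r where "N0 = s * s * A0"
definition N1 :: 'r where "N1 = al + s * B1 + s * A0 * t"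
definition N2 :: 'r where "N2 = 2 * be + B2 + 2 * B1 * t + A0 * t * t"
definition N3 :: 'r where
  "N3 = g + sk * (A3 + 3 * B2 * t + 3 * B1 * t * t + A0 * t * t * t)"

sublocale old: cubic E1 E2 A0 B1 B2 A3 .
sublocale new: cubic d1 d2 N0 N1 N2 N3 .

lemmas N_defs = N0_def N1_def N2_def N3_def
lemmas d_simps = derivation_simps[OF d1] derivation_simps[OF d2]
  derivation_simps[OF E1] derivation_simps[OF E2]

lemma s_cancel: "s * x = s * y \<Longrightarrow> x = y"
  by (metis mult.assoc mult.commute mult_1 s_sk)

lemma d1_sk: "d1 sk = - 3 * sk * al" and d2_sk: "d2 sk = - 3 * sk * be"
proof -
  have "s * d1 sk + d1 s * sk = 0" "s * d2 sk + d2 s * sk = 0"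
    using derivation_mult[OF d1, of s sk] derivation_mult[OF d2, of s sk]
    by (simp_all add: s_sk derivation_1[OF d1] derivation_1[OF d2] add.commute)
  then have "s * d1 sk = s * (- 3 * sk * al)" "s * d2 sk = s * (- 3 * sk * be)"
    unfolding d1_s d2_s by (simp_all add: eq_neg_iff_add_eq_0 algebra_simps)
  then show "d1 sk = - 3 * sk * al" "d2 sk = - 3 * sk * be"
    using s_cancel by blast+
qed

text \<open>Equality of the mixed derivatives of s = x_u; \<open>d1_g\<close> is the same for t =
  x_v. They remove every \<open>d1\<close> in front of \<open>be\<close> and \<open>g\<close>, which
  gives the derivatives of the frame a normal form.\<close>

lemma d1_be: "d1 be = d2 al"
proof -
  have "s * (3 * d1 be) = s * (3 * d2 al)"
    using d_comm[of s] unfolding d1_s d2_s d_simps by (simp add: algebra_simps)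
  then show ?thesis using s_cancel cancel_3 by blast
qed

lemma d1_g: "d1 g = 3 * d2 be + 9 * be * be - 3 * al * g"
proof -
  have "s * d1 g = s * (3 * d2 be + 9 * be * be - 3 * al * g)"
    using d_comm[of t] unfolding d1_t d2_t d_simps d1_s d2_s by (simp add: algebra_simps)
  then show ?thesis using s_cancel by blast
qed

lemmas frame_simps = d1_s d2_s d1_t d2_t d1_sk d2_sk d1_be d1_g d_comm E_comm

text \<open>\<open>d_comm\<close> moves \<open>d1\<close> to the outside and so hides the redex of
  \<open>d1_be\<close>; the second-order instances have to be supplied.\<close>

lemma d12_be: "d1 (d2 be) = d2 (d2 al)"
  using d_comm[of be] by (simp add: d1_be)

lemma d12_g: "d1 (d2 g) = d2 (3 * d2 be + 9 * be * be - 3 * al * g)"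
  using d_comm[of g] by (simp add: d1_g)

text \<open>Only instances: the general rules would also rewrite derivatives of s, t,
  \<open>al\<close>, \<open>be\<close>, \<open>g\<close>, which are known with respect to (u,v)
  only.\<close>

lemmas E_expand =
  d1_E[of A0] d1_E[of B1] d1_E[of B2] d1_E[of A3] d2_E[of A0] d2_E[of B1] d2_E[of B2] d2_E[of A3]
  d1_E[of "E1 A0"] d1_E[of "E1 B1"] d1_E[of "E1 B2"] d1_E[of "E1 A3"]
  d2_E[of "E1 A0"] d2_E[of "E1 B1"] d2_E[of "E1 B2"] d2_E[of "E1 A3"]
  d1_E[of "E2 A0"] d1_E[of "E2 B1"] d1_E[of "E2 B2"] d1_E[of "E2 A3"]
  d2_E[of "E2 A0"] d2_E[of "E2 B1"] d2_E[of "E2 B2"] d2_E[of "E2 A3"]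

lemma s_sk': "s * (sk * x) = x"
  by (metis mult.assoc mult_1 s_sk)

text \<open>(L_1 dx + L_2 dy) \<otimes> (dx \<and> dy) is a tensor: one factor s comes from the area
  form, the rest is the change of a covector. The same holds for \<open>new_L2\<close>.\<close>

lemma new_L1: "new.L1 = s * s * old.L1"
  unfolding new.L1_def old.L1_def
  by (simp add: N_defs d_simps frame_simps E_expand d12_be d12_g s_sk s_sk' algebra_simps)

lemma new_L2: "new.L2 = s * (old.L2 + t * old.L1)"
  unfolding new.L2_def old.L2_def old.L1_def
  by (simp add: N_defs d_simps frame_simps E_expand d12_be d12_g s_sk s_sk' algebra_simps)

text \<open>A solution $\Psi$ of the linear system $\partial_a\Psi + \Omega_a\Psi = 0$ consists of a weighted
  symmetric tensor $(\Psi_1,\Psi_2,\Psi_3)$ and of its derivatives $\Psi_4 = \partial_x\Psi_2$,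
  $\Psi_5 = \partial_y\Psi_2$, $\Psi_6 = \partial_x\Psi_5$. The matrix \<open>H\<close> expresses $\Psi$ by its
  counterpart in the coordinates $(u,v)$, up to a power of \<open>s\<close>.\<close>

definition h41 :: 'r where "h41 = - 2 * A0 * t * t - 2 * B1 * t - 3 * be"
definition h42 :: 'r where "h42 = 2 * A0 * s * t + al"
definition h51 :: 'r where
  "h51 = - 2 * A0 * t * t * t - 6 * B1 * t * t - 4 * B2 * t - 3 * be * t - g * s"
definition h52 :: 'r where "h52 = 2 * B1 * s * t + al * t + be * s"
definition h53 :: 'r where "h53 = 2 * A0 * s * s * t"
definition h61 :: 'r where
  "h61 = 2 * A0 * A3 * t - 10 * A0 * B1 * t * t * t - 2 * A0 * B2 * t * t - 15 * A0 * be * t * t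
     - A0 * g * s * t - 2 * A0 * A0 * t * t * t * t - E2 A0 * t * t - E1 A0 * t * t * t
     - 8 * B1 * B2 * t - 33 * B1 * be * t - 2 * B1 * g * s - 12 * B1 * B1 * t * t
     - E2 B1 * t - 3 * E1 B1 * t * t - 12 * B2 * be - 2 * E1 B2 * t - 18 * be * be - 3 * d2 be"
definition h62 :: 'r where
  "h62 = 12 * A0 * B1 * s * t * t + 6 * A0 * B2 * s * t + A0 * al * t * t + 5 * A0 * be * s * t
     + 2 * A0 * g * s * s + 4 * A0 * A0 * s * t * t * t + E2 A0 * s * t + 3 * B1 * al * t
     + 6 * B1 * be * s + 2 * B1 * B1 * s * t + E1 B1 * s * t + 4 * al * be + d2 al"
definition h63 :: 'r where
  "h63 = - 2 * A0 * B1 * s * s * t + 6 * A0 * be * s * s - 2 * A0 * A0 * s * s * t * t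
     + E1 A0 * s * s * t"
definition h64 :: 'r where "h64 = A0 * t * t + 3 * B1 * t + 4 * be"
definition h65 :: 'r where "h65 = - A0 * s * t + al"

definition H :: "'r^6^6" where
  "H = vector [
     vector [1, 0, 0, 0, 0, 0],
     vector [- t, s, 0, 0, 0, 0],
     vector [t * t, - 2 * t * s, s * s, 0, 0, 0],
     vector [h41, h42, 0, 1, 0, 0],
     vector [h51, h52, h53, t, s, 0],
     vector [h61, h62, h63, h64, h65, 1]]"

lemmas h_defs = h41_def h42_def h51_def h52_def h53_def h61_def h62_def h63_def h64_def h65_def

lemmas frame_expand = N_defs h_defs d_simps frame_simps E_expand d12_be d12_g s_sk s_sk'

text \<open>As \<open>d1\<close> is s times \<open>E1\<close>, the pulled-back matrix is s times
  \<open>old.\<Omega>1\<close>. The upper three rows of \<open>H\<close> are the symmetric square of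
  the matrix with rows (1, 0) and (- t, s). The lower three are forced by the equations of the
  system that introduce \<Psi>_4, \<Psi>_5, \<Psi>_6 as derivatives.\<close>

lemma H_d1:
  "d1 (H $ i $ j) = (\<Sum>l\<in>UNIV. H $ i $ l * new.\<Omega>1 $ l $ j)
     - (\<Sum>l\<in>UNIV. s * old.\<Omega>1 $ i $ l * H $ l $ j) + 2 * al * H $ i $ j"
proof -
  have "\<forall>i j. d1 (H $ i $ j) = (\<Sum>l\<in>UNIV. H $ i $ l * new.\<Omega>1 $ l $ j)
      - (\<Sum>l\<in>UNIV. s * old.\<Omega>1 $ i $ l * H $ l $ j) + 2 * al * H $ i $ j"
    unfolding forall_6 sum_6 H_def new.\<Omega>1_def old.\<Omega>1_def
    \<comment> \<open>The sums are evaluated while the coefficients are still opaque, so that the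
      zero entries disappear before anything is expanded; the entries are then checked one by
      one.\<close>
    apply simp
    apply (intro conjI)
    apply (unfold new.coeff_defs old.coeff_defs)
    by (simp_all add: frame_expand algebra_simps)
  then show ?thesis by blast
qed

lemma H_d2:
  "d2 (H $ i $ j) = (\<Sum>l\<in>UNIV. H $ i $ l * new.\<Omega>2 $ l $ j)
     - (\<Sum>l\<in>UNIV. (t * old.\<Omega>1 $ i $ l + old.\<Omega>2 $ i $ l) * H $ l $ j) + 2 * be * H $ i $ j"
proof -
  have "\<forall>i j. d2 (H $ i $ j) = (\<Sum>l\<in>UNIV. H $ i $ l * new.\<Omega>2 $ l $ j)
      - (\<Sum>l\<in>UNIV. (t * old.\<Omega>1 $ i $ l + old.\<Omega>2 $ i $ l) * H $ l $ j) + 2 * be * H $ i $ j"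
    unfolding forall_6 sum_6 H_def new.\<Omega>2_def old.\<Omega>1_def old.\<Omega>2_def
    apply simp
    apply (intro conjI)
    apply (unfold new.coeff_defs old.coeff_defs)
    by (simp_all add: frame_expand algebra_simps)
  then show ?thesis by blast
qed

text \<open>V is of first order in L_1 and L_2, so these stay opaque and \<open>new_L1\<close>,
  \<open>new_L2\<close> carry the computation. As V ends in 0, the product involves the first five
  rows of \<open>H\<close>.\<close>

lemma new_V: "new.V = s *s (old.V v* H)"
proof -
  note L_E = d1_E[of old.L1] d2_E[of old.L1] d1_E[of old.L2] d2_E[of old.L2]
  show ?thesis
    unfolding vec_eq_iff forall_6 vector_matrix_mult_def vector_scalar_mult_def sum_6
      H_def new.V_def old.V_def new_L1 new_L2
    by (simp add: h_defs N_defs d_simps frame_simps L_E s_sk s_sk' algebra_simps)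
qed

end

text \<open>The order of the type \<open>6\<close> does not apply directly, since \<open>6 = 0\<close> is its least element.\<close>

lemma det_lower_triangular_6:
  fixes A :: "'r::comm_ring_1^6^6"
  assumes "\<forall>(i, j) \<in> {(1,2),(1,3),(1,4),(1,5),(1,6),(2,3),(2,4),(2,5),(2,6),(3,4),(3,5),(3,6),
    (4,5),(4,6),(5,6)}. A $ i $ j = 0"
  shows "det A = A $ 1 $ 1 * A $ 2 $ 2 * A $ 3 $ 3 * A $ 4 $ 4 * A $ 5 $ 5 * A $ 6 $ 6"
proof -
  \<comment> \<open>In the order 6 < 1 < ... < 5 of the type, \<open>p\<close> sends the indices to
    1, ..., 6. Permuting rows and columns by the same \<open>p\<close> multiplies the determinant by
    a squared sign.\<close>
  define p :: "6 \<Rightarrow> 6" where "p = (\<lambda>i. i + 1)"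
  have p: "p permutes UNIV"
    by (rule bij_imp_permutes, rule bij_betw_byWitness[where f' = "\<lambda>i. i - 1"]) (auto simp: p_def)
  have p_simps: "p 1 = 2" "p 2 = 3" "p 3 = 4" "p 4 = 5" "p 5 = 6" "p 6 = 1"
    by (simp_all add: p_def)
  define B where "B = (\<chi> i j. A $ p i $ p j)"
  have "det B = of_int (sign p) * (of_int (sign p) * det A)"
    using det_permute_columns[OF p, of "\<chi> i. A $ p i"]
    unfolding det_permute_rows[OF p] by (simp add: B_def)
  also have "\<dots> = det A"
    by (simp add: sign_def)
  finally have "det A = det B" ..
  also have "\<dots> = (\<Prod>i\<in>UNIV. B $ i $ i)"
  proof (rule det_lowerdiagonal)
    fix i j :: 6
    assume "i < j"
    then show "B $ i $ j = 0"
      using exhaust_6[of i] exhaust_6[of j] assms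
      by (elim disjE) (simp_all add: B_def p_simps less_bit0_def bit0.Rep_numeral bit0.Rep_1)
  qed
  finally show ?thesis
    by (simp add: prod_6 B_def p_simps mult_ac)
qed

lemma scale_vector_matrix_mult: "(c *s W) v* A = c *s (W v* A)"
  for c :: "'r::comm_ring_1"
  by (simp add: vec_eq_iff vector_matrix_mult_component sum_distrib_left mult.assoc)

context cubic
begin

lemma D1_add: "derivation d1 \<Longrightarrow> D1 (W + W') = D1 W + D1 W'"
  by (simp add: D1_def vec_eq_iff derivation_add vector_matrix_mult_component algebra_simps sum.distrib)

lemma D2_add: "derivation d2 \<Longrightarrow> D2 (W + W') = D2 W + D2 W'"
  by (simp add: D2_def vec_eq_iff derivation_add vector_matrix_mult_component algebra_simps sum.distrib)

lemma D1_scale: "derivation d1 \<Longrightarrow> D1 (c *s W) = d1 c *s W + c *s D1 W"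
  by (simp add: D1_def vec_eq_iff derivation_mult scale_vector_matrix_mult algebra_simps)

lemma D2_scale: "derivation d2 \<Longrightarrow> D2 (c *s W) = d2 c *s W + c *s D2 W"
  by (simp add: D2_def vec_eq_iff derivation_mult scale_vector_matrix_mult algebra_simps)

end

context triangular_change
begin

text \<open>The coefficient 5 is 3 + 2: \<open>3 * al\<close> from the factor s and
  \<open>2 * al\<close> from \<open>H\<close>.\<close>

lemma new_D1: "new.D1 (s *s (W v* H)) = s *s ((s *s old.D1 W + (5 * al) *s W) v* H)"
  unfolding new.D1_def
  by (rule covariant_derivative_change[OF d1 H_d1, where \<phi> = "3 * al"])
    (simp_all only: d1_s, simp_all add: d1_E old.D1_def vector_matrix_mult_component sum_distrib_left algebra_simps)

lemma new_D2: "new.D2 (s *s (W v* H)) = s *s ((t *s old.D1 W + old.D2 W + (5 * be) *s W) v* H)"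
  unfolding new.D2_def
  by (rule covariant_derivative_change[OF d2 H_d2, where \<phi> = "3 * be"])
    (simp_all only: d2_s, simp_all add: d2_E old.D1_def old.D2_def vector_matrix_mult_component sum_distrib_left
      sum.distrib algebra_simps)

text \<open>The coefficients that arise when \<open>new_D1\<close> and \<open>new_D2\<close> are
  applied twice. The two mixed derivatives separately produce s D_1 D_2 and s D_2 D_1; only their
  sum is a combination of rows of \<open>M\<close>, so symmetrising takes the place of commuting D_1
  and D_2.\<close>

definition T :: "'r^6^6" where
  "T = vector [
     vector [1, 0, 0, 0, 0, 0],
     vector [5 * al, s, 0, 0, 0, 0],
     vector [5 * be, t, 1, 0, 0, 0],
     vector [25 * al * al + 5 * d1 al, 13 * s * al, 0, s * s, 0, 0],
     vector [10 * d2 al + 50 * al * be, 16 * s * be + 10 * al * t, 10 * al, 2 * s * t, s, 0],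
     vector [25 * be * be + 5 * d2 be, s * g + 10 * be * t, 10 * be, t * t, t, 1]]"

lemma new_M_row: "new.M $ i = s *s ((T ** old.M) $ i v* H)"
proof -
  \<comment> \<open>The \<open>E\<close>-derivatives of s, t, \<open>al\<close>, \<open>be\<close>
    have no formula of their own. They occur only in the combinations \<open>s * E1 c\<close> and
    \<open>t * E1 c + E2 c\<close>, which are \<open>d1 c\<close> and \<open>d2 c\<close>.\<close>
  have E2_d2: "E2 c = d2 c - t * E1 c" for c
    by (simp add: d2_E)
  note E2_simps = E2_d2[of s] E2_d2[of t] E2_d2[of "5 * al"] E2_d2[of "5 * be"]
  note d_simps' = derivation_mult[OF d1] derivation_mult[OF d2]
    derivation_numeral[OF d1] derivation_numeral[OF d2]
  have 1: "new.D1 new.V = s *s ((s *s old.D1 old.V + (5 * al) *s old.V) v* H)"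
    unfolding new_V by (rule new_D1)
  have 2: "new.D2 new.V = s *s ((t *s old.D1 old.V + old.D2 old.V + (5 * be) *s old.V) v* H)"
    unfolding new_V by (rule new_D2)
  have s_E1: "s * (E1 c * x) = d1 c * x" for c x
    by (simp add: d1_E mult.assoc)
  note D_simps = old.D1_add[OF E1] old.D2_add[OF E2] old.D1_scale[OF E1] old.D2_scale[OF E2]
  have row: "(T ** old.M) $ i = (\<Sum>j\<in>UNIV. T $ i $ j *s old.M $ j)" for i
    by (simp add: vec_eq_iff matrix_matrix_mult_def)
  have R1: "new.M $ 1 = s *s ((T ** old.M) $ 1 v* H)"
    unfolding row sum_6 by (simp add: new.M_def old.M_def T_def new_V)
  have R2: "new.M $ 2 = s *s ((T ** old.M) $ 2 v* H)"
    unfolding row sum_6 by (simp add: new.M_def old.M_def T_def 1 add.commute)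
  have R3: "new.M $ 3 = s *s ((T ** old.M) $ 3 v* H)"
    unfolding row sum_6 by (simp add: new.M_def old.M_def T_def 2 add_ac)
  have R4: "new.M $ 4 = s *s ((T ** old.M) $ 4 v* H)"
  proof -
    have "s *s old.D1 (s *s old.D1 old.V + (5 * al) *s old.V)
        + (5 * al) *s (s *s old.D1 old.V + (5 * al) *s old.V) = (T ** old.M) $ 4"
      unfolding row sum_6 D_simps
      by (simp add: old.M_def T_def vec_eq_iff algebra_simps s_E1 d_simps' d1_s)
    then show ?thesis by (simp add: new.M_def 1 new_D1)
  qed
  have R5: "new.M $ 5 = s *s ((T ** old.M) $ 5 v* H)"
  proof -
    have "(s *s old.D1 (t *s old.D1 old.V + old.D2 old.V + (5 * be) *s old.V)
        + (5 * al) *s (t *s old.D1 old.V + old.D2 old.V + (5 * be) *s old.V))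
      + (t *s old.D1 (s *s old.D1 old.V + (5 * al) *s old.V)
        + old.D2 (s *s old.D1 old.V + (5 * al) *s old.V)
        + (5 * be) *s (s *s old.D1 old.V + (5 * al) *s old.V)) = (T ** old.M) $ 5"
      unfolding row sum_6 D_simps E2_simps
      by (simp add: old.M_def T_def vec_eq_iff algebra_simps s_E1 d_simps' d1_s d2_s d1_t d2_t d1_be)
    then show ?thesis
      by (simp add: new.M_def 1 2 new_D1 new_D2 vector_add_ldistrib[symmetric]
          vector_matrix_left_distrib[symmetric])
  qed
  have R6: "new.M $ 6 = s *s ((T ** old.M) $ 6 v* H)"
  proof -
    have "t *s old.D1 (t *s old.D1 old.V + old.D2 old.V + (5 * be) *s old.V)
        + old.D2 (t *s old.D1 old.V + old.D2 old.V + (5 * be) *s old.V)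
        + (5 * be) *s (t *s old.D1 old.V + old.D2 old.V + (5 * be) *s old.V) = (T ** old.M) $ 6"
      unfolding row sum_6 D_simps E2_simps
      by (simp add: old.M_def T_def vec_eq_iff algebra_simps s_E1 d_simps' d1_s d2_s d1_t d2_t d1_be)
    then show ?thesis by (simp add: new.M_def 2 new_D2)
  qed
  show ?thesis using exhaust_6[of i] R1 R2 R3 R4 R5 R6 by blast
qed

lemma det_H: "det H = s ^ 4"
  by (subst det_lower_triangular_6) (simp_all add: H_def power4_eq_xxxx mult_ac)

lemma det_T: "det T = s ^ 4"
  by (subst det_lower_triangular_6) (simp_all add: T_def power4_eq_xxxx mult_ac)

theorem det_new_M: "det new.M = s ^ 14 * det old.M"
proof -
  have "new.M = (\<chi> i. s *s ((T ** old.M ** H) $ i))"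
    unfolding vec_eq_iff[of new.M] new_M_row
    by (simp add: vec_eq_iff matrix_matrix_mult_def vector_matrix_mult_def)
  then have "det new.M = s ^ 6 * det (T ** old.M ** H)"
    using det_rows_mul[of "\<lambda>_. s" "\<lambda>i. (T ** old.M ** H) $ i"] by simp
  also have "\<dots> = s ^ 14 * det old.M"
    unfolding det_mul det_H det_T by (simp add: power_numeral_reduce mult_ac)
  finally show ?thesis .
qed

end

section \<open>Invariance under interchanging x and y\<close>

section \<open>Interchange of the coordinates\<close>

text \<open>The interchange exchanges the tensor components \<Psi>_1, \<Psi>_3 and the derivatives
  \<Psi>_4, \<Psi>_5, and it fixes \<Psi>_2 and its mixed derivative \<Psi>_6. In the same way
  \<open>swap_row\<close> exchanges D_1 with D_2 and their squares.\<close>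

definition swap_col :: "6 \<Rightarrow> 6" where
  "swap_col = Transposition.transpose 1 3 \<circ> Transposition.transpose 4 5"

definition swap_row :: "6 \<Rightarrow> 6" where
  "swap_row = Transposition.transpose 2 3 \<circ> Transposition.transpose 4 6"

lemma swap_col_simps:
  "swap_col 1 = 3" "swap_col 2 = 2" "swap_col 3 = 1" "swap_col 4 = 5" "swap_col 5 = 4" "swap_col 6 = 6"
  by (simp_all add: swap_col_def Transposition.transpose_def)

lemma swap_row_simps:
  "swap_row 1 = 1" "swap_row 2 = 3" "swap_row 3 = 2" "swap_row 4 = 6" "swap_row 5 = 5" "swap_row 6 = 4"
  by (simp_all add: swap_row_def Transposition.transpose_def)

lemma swap_permutes: "swap_col permutes UNIV" "swap_row permutes UNIV"
  unfolding swap_col_def swap_row_def by (intro permutes_compose permutes_swap_id UNIV_I)+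

lemma sign_swap: "sign swap_col = 1" "sign swap_row = 1"
  unfolding swap_col_def swap_row_def
  by (simp_all add: sign_compose permutation_swap_id sign_swap_id)

text \<open>Both permutations are products of two transpositions, hence even, and the signs of the
  six rows cancel.\<close>

lemma det_swap:
  fixes A B :: "'r::comm_ring_1^6^6"
  assumes "\<And>i j. B $ i $ j = - (A $ swap_row i $ swap_col j)"
  shows "det B = det A"
proof -
  have "B = (\<chi> i. (- 1) *s (\<chi> i j. (\<chi> i. A $ swap_row i) $ i $ swap_col j) $ i)"
    by (simp add: vec_eq_iff assms)
  then have "det B = (- 1) ^ 6 * det (\<chi> i j. (\<chi> i. A $ swap_row i) $ i $ swap_col j)"
    using det_rows_mul[of "\<lambda>_. - 1" "\<lambda>i. (\<chi> i j. (\<chi> i. A $ swap_row i) $ i $ swap_col j) $ i"]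
    by simp
  also have "\<dots> = det A"
    unfolding det_permute_columns[OF swap_permutes(1)] det_permute_rows[OF swap_permutes(2)]
    by (simp add: sign_swap)
  finally show ?thesis .
qed

locale coordinate_swap =
  fixes d1 d2 :: "'r::comm_ring_1 \<Rightarrow> 'r" and A0 B1 B2 A3 :: 'r
  assumes d1: "derivation d1" and d2: "derivation d2"
    and d_comm: "d2 (d1 x) = d1 (d2 x)"
begin

sublocale old: cubic d1 d2 A0 B1 B2 A3 .
text \<open>Exchanging the indices 1 and 2 of the Christoffel symbols turns A_0 into - A_3 and A_1
  into - A_2, and vice versa.\<close>

sublocale new: cubic d2 d1 "- A3" "- B2" "- B1" "- A0" .

lemmas d_simps = derivation_simps[OF d1] derivation_simps[OF d2] d_comm

lemma new_L1: "new.L1 = - old.L2"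
  unfolding new.L1_def old.L2_def by (simp add: d_simps algebra_simps)

lemma new_L2: "new.L2 = - old.L1"
  unfolding new.L2_def old.L1_def by (simp add: d_simps algebra_simps)

lemma new_V: "new.V = - (\<chi> j. old.V $ swap_col j)"
  by (simp add: vec_eq_iff forall_6 swap_col_simps new.V_def old.V_def new_L1 new_L2 d_simps algebra_simps)

lemma new_Omega1: "new.\<Omega>1 $ i $ j = old.\<Omega>2 $ swap_col i $ swap_col j"
proof -
  have "\<forall>i j. new.\<Omega>1 $ i $ j = old.\<Omega>2 $ swap_col i $ swap_col j"
    unfolding forall_6 swap_col_simps new.\<Omega>1_def old.\<Omega>2_def
    by (simp add: new.coeff_defs old.coeff_defs) (simp add: d_simps algebra_simps)
  then show ?thesis by blast
qed

lemma new_Omega2: "new.\<Omega>2 $ i $ j = old.\<Omega>1 $ swap_col i $ swap_col j"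
proof -
  have "\<forall>i j. new.\<Omega>2 $ i $ j = old.\<Omega>1 $ swap_col i $ swap_col j"
    unfolding forall_6 swap_col_simps new.\<Omega>2_def old.\<Omega>1_def
    by (simp add: new.coeff_defs old.coeff_defs) (simp add: d_simps algebra_simps)
  then show ?thesis by blast
qed

lemma sum_swap_col: "(\<Sum>i\<in>UNIV. f (swap_col i)) = (\<Sum>i\<in>UNIV. f i)"
  by (simp add: sum_6 swap_col_simps ac_simps)

lemma new_D1: "new.D1 (- (\<chi> j. W $ swap_col j)) = - (\<chi> j. old.D2 W $ swap_col j)"
  using sum_swap_col[of "\<lambda>i. W $ i * old.\<Omega>2 $ i $ swap_col j" for j]
  by (simp add: vec_eq_iff new.D1_def old.D2_def vector_matrix_mult_def new_Omega1 d_simps sum_negf)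

lemma new_D2: "new.D2 (- (\<chi> j. W $ swap_col j)) = - (\<chi> j. old.D1 W $ swap_col j)"
  using sum_swap_col[of "\<lambda>i. W $ i * old.\<Omega>1 $ i $ swap_col j" for j]
  by (simp add: vec_eq_iff new.D2_def old.D1_def vector_matrix_mult_def new_Omega2 d_simps sum_negf)

theorem det_new_M: "det new.M = det old.M"
proof (rule det_swap)
  have "\<forall>i. new.M $ i = - (\<chi> j. old.M $ swap_row i $ swap_col j)"
    unfolding forall_6 by (simp add: new.M_def old.M_def swap_row_simps new_V new_D1 new_D2 vec_eq_iff)
  then show "new.M $ i $ j = - (old.M $ swap_row i $ swap_col j)" for i j
    by simp
qed

end

section \<open>Factorisation of a general change of coordinates\<close>

section \<open>Arbitrary changes of coordinates\<close>

text \<open>The Jacobian matrix is \<open>a\<close> $= x_u$, \<open>b\<close> $= x_v$, \<open>c\<close> $= y_u$, \<open>e\<close> $= y_v$, and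
  \<open>E1\<close>, \<open>E2\<close> are the derivations with respect to $x$ and $y$.\<close>

locale coordinate_change =
  fixes d1 d2 :: "'r::comm_ring_1 \<Rightarrow> 'r" and a b c e \<delta>' h :: 'r
  assumes d1: "derivation d1" and d2: "derivation d2"
    and d_comm: "d2 (d1 x) = d1 (d2 x)"
    and d2_a: "d2 a = d1 b" and d2_c: "d2 c = d1 e"
    and inverse_\<delta>: "(a * e - b * c) * \<delta>' = 1"
    and third: "3 * h = 1"
begin

text \<open>The chain rule solved by Cramer's rule.\<close>

definition E1 :: "'r \<Rightarrow> 'r" where "E1 x = \<delta>' * (e * d1 x - c * d2 x)"
definition E2 :: "'r \<Rightarrow> 'r" where "E2 x = \<delta>' * (a * d2 x - b * d1 x)"

definition \<delta> :: 'r where "\<delta> = a * e - b * c"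

lemma \<delta>_\<delta>': "\<delta> * \<delta>' = 1" "\<delta> * (\<delta>' * x) = x"
  using inverse_\<delta> by (simp_all add: \<delta>_def flip: mult.assoc)

lemma derivation_E1: "derivation E1" and derivation_E2: "derivation E2"
  unfolding derivation_def E1_def E2_def
  by (simp_all add: derivation_simps[OF d1] derivation_simps[OF d2] algebra_simps)

lemma d1_E: "d1 x = a * E1 x + c * E2 x" and d2_E: "d2 x = b * E1 x + e * E2 x"
proof -
  have "a * E1 x + c * E2 x = \<delta> * (\<delta>' * d1 x)" "b * E1 x + e * E2 x = \<delta> * (\<delta>' * d2 x)"
    unfolding E1_def E2_def \<delta>_def by (simp_all add: algebra_simps)
  then show "d1 x = a * E1 x + c * E2 x" "d2 x = b * E1 x + e * E2 x"
    by (simp_all add: \<delta>_\<delta>')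
qed

lemma \<delta>_cancel: "\<delta> * x = \<delta> * y \<Longrightarrow> x = y"
  by (metis \<delta>_\<delta>'(2) mult.left_commute)

lemma cancel_3: "3 * x = 3 * y \<Longrightarrow> x = y" for x y :: 'r
  by (metis mult.assoc mult.commute mult_1 third)

lemma d_\<delta>': "\<delta> * d1 \<delta>' = - \<delta>' * d1 \<delta>" "\<delta> * d2 \<delta>' = - \<delta>' * d2 \<delta>"
proof -
  have "d1 \<delta> * \<delta>' + \<delta> * d1 \<delta>' = 0" "d2 \<delta> * \<delta>' + \<delta> * d2 \<delta>' = 0"
    by (metis \<delta>_\<delta>'(1) derivation_mult[OF d1] derivation_1[OF d1])
      (metis \<delta>_\<delta>'(1) derivation_mult[OF d2] derivation_1[OF d2])
  then show "\<delta> * d1 \<delta>' = - \<delta>' * d1 \<delta>" "\<delta> * d2 \<delta>' = - \<delta>' * d2 \<delta>"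
    by (simp_all add: eq_neg_iff_add_eq_0 algebra_simps)
qed

text \<open>The Jacobian matrix is closed (\<open>d2_a\<close>, \<open>d2_c\<close>), which reduces
  the commutator to multiples of the derivatives of \<open>\<delta> * \<delta>'\<close> = 1.\<close>

lemma E_comm: "E2 (E1 x) = E1 (E2 x)"
proof -
  have "E2 (E1 x) - E1 (E2 x) = \<delta>' * ((\<delta> * d2 \<delta>' + \<delta>' * d2 \<delta>) * d1 x - (\<delta> * d1 \<delta>' + \<delta>' * d1 \<delta>) * d2 x)"
    unfolding E1_def E2_def \<delta>_def
    by (simp add: derivation_simps[OF d1] derivation_simps[OF d2] d_comm d2_a d2_c algebra_simps)
  then show ?thesis by (simp add: d_\<delta>')
qed

text \<open>Multiplied by the Jacobian determinant \<open>\<delta>\<close>, the transformation law of the coefficients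
  of a projective structure is free of denominators.\<close>

definition cubic_law :: "'r \<Rightarrow> 'r \<Rightarrow> 'r \<Rightarrow> 'r \<Rightarrow> 'r \<Rightarrow> 'r \<Rightarrow> 'r \<Rightarrow> 'r \<Rightarrow> bool" where
  "cubic_law p0 p1 p2 p3 q0 q1 q2 q3 \<longleftrightarrow>
     \<delta> * q0 = c * d1 a - a * d1 c
       + a * a * a * p0 + 3 * a * a * c * p1 + 3 * a * c * c * p2 + c * c * c * p3 \<and>
     3 * \<delta> * q1 = e * d1 a - b * d1 c - 2 * a * d1 e + 2 * c * d1 b
       + 3 * (a * a * b * p0 + (a * a * e + 2 * a * b * c) * p1 + (2 * a * c * e + b * c * c) * p2
         + c * c * e * p3) \<and>
     3 * \<delta> * q2 = 2 * e * d1 b - 2 * b * d1 e - a * d2 e + c * d2 b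
       + 3 * (a * b * b * p0 + (2 * a * b * e + b * b * c) * p1 + (a * e * e + 2 * b * c * e) * p2
         + c * e * e * p3) \<and>
     \<delta> * q3 = e * d2 b - b * d2 e
       + b * b * b * p0 + 3 * b * b * e * p1 + 3 * b * e * e * p2 + e * e * e * p3"

context
  fixes ak :: 'r
  assumes ak: "a * ak = 1"
begin

text \<open>The derivations of the intermediate coordinates $(x,v)$.\<close>

definition F1 :: "'r \<Rightarrow> 'r" where "F1 x = ak * d1 x"
definition F2 :: "'r \<Rightarrow> 'r" where "F2 x = d2 x - b * (ak * d1 x)"

lemma ak': "a * (ak * x) = x"
  using ak by (simp flip: mult.assoc)

lemma a_cancel: "a * x = a * y \<Longrightarrow> x = y"
  by (metis ak' mult.left_commute)

lemma derivation_F1: "derivation F1" and derivation_F2: "derivation F2"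
  unfolding derivation_def F1_def F2_def
  by (simp_all add: derivation_simps[OF d1] derivation_simps[OF d2] algebra_simps)

lemma d_ak: "d1 ak = - ak * ak * d1 a" "d2 ak = - ak * ak * d1 b"
proof -
  have "a * d1 ak = - ak * d1 a" "a * d2 ak = - ak * d1 b"
  proof -
    have "d1 a * ak + a * d1 ak = 0" "d2 a * ak + a * d2 ak = 0"
      by (metis ak derivation_mult[OF d1] derivation_1[OF d1])
        (metis ak derivation_mult[OF d2] derivation_1[OF d2])
    then show "a * d1 ak = - ak * d1 a" "a * d2 ak = - ak * d1 b"
      by (simp_all add: d2_a eq_neg_iff_add_eq_0 algebra_simps)
  qed
  then have "a * d1 ak = a * (- ak * ak * d1 a)" "a * d2 ak = a * (- ak * ak * d1 b)"
    by (simp_all add: ak' mult.assoc)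
  then show "d1 ak = - ak * ak * d1 a" "d2 ak = - ak * ak * d1 b"
    using a_cancel by blast+
qed

lemma F_comm: "F2 (F1 x) = F1 (F2 x)"
  unfolding F1_def F2_def
  by (simp add: derivation_simps[OF d1] derivation_simps[OF d2] d_comm d_ak algebra_simps)

lemma third': "3 * (h * x) = x"
  using third by (simp flip: mult.assoc)

text \<open>The chain rule from (x,v) to (x,y): y_v is \<open>\<delta> * ak\<close> and y_x is
  \<open>c * ak\<close>.\<close>

lemma F_E: "F2 x = (\<delta> * ak) * E2 x" "F1 x = (c * ak) * E2 x + E1 x"
proof -
  have "a * F2 x = a * ((\<delta> * ak) * E2 x)" "a * F1 x = a * ((c * ak) * E2 x + E1 x)"
    unfolding F1_def F2_def d1_E[of x] d2_E[of x] \<delta>_def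
    by (simp_all add: algebra_simps ak')
  then show "F2 x = (\<delta> * ak) * E2 x" "F1 x = (c * ak) * E2 x + E1 x"
    using a_cancel by blast+
qed

text \<open>From (x,y) to (x,v) it is the second coordinate that changes, so this factor becomes
  triangular after an interchange, which is undone before passing on to (u,v). The two factors
  contribute y_v and x_u, whose product is \<open>\<delta>\<close>.\<close>

lemma det_change_aux:
  assumes law: "cubic_law p0 p1 p2 p3 q0 q1 q2 q3"
  shows "det (cubic.M d1 d2 q0 q1 q2 q3) = \<delta> ^ 14 * det (cubic.M E1 E2 p0 p1 p2 p3)"
proof -
  \<comment> \<open>s = y_v and t = y_x; with v as the first and x as the second variable,
    \<open>al\<close>, \<open>be\<close>, \<open>g\<close> are y_vv / 3 y_v, y_vx / 3 y_v and y_xx /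
    y_v.\<close>
  define s t sk where "s = \<delta> * ak" and "t = c * ak" and "sk = \<delta>' * a"
  define al be g where "al = h * (sk * F2 s)" and "be = h * (sk * F1 s)" and "g = sk * F1 t"
  have "s * sk = \<delta> * (\<delta>' * (a * ak))"
    by (simp add: s_def sk_def mult_ac)
  then have s_sk: "s * sk = 1"
    by (simp add: \<delta>_\<delta>' ak)
  have s_sk': "s * (sk * x) = x" for x
    using s_sk by (simp flip: mult.assoc)
  have d_\<delta>: "d1 \<delta> = d1 a * e + a * d1 e - d1 b * c - b * d1 c"
    "d2 \<delta> = d1 b * e + a * d2 e - d2 b * c - b * d1 e"
    unfolding \<delta>_def by (simp_all add: derivation_simps[OF d1] derivation_simps[OF d2] d2_a d2_c)
  have F_s: "F1 s = F2 t"
    unfolding F1_def F2_def s_def t_def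
    by (simp add: derivation_simps[OF d1] derivation_simps[OF d2] d_ak d_\<delta> \<delta>_def d2_c algebra_simps ak')
  interpret inner: triangular_change F2 F1 E2 E1 "- p3" "- p2" "- p1" "- p0" s sk t al be g
  proof
    show "derivation F2" "derivation F1" "derivation E2" "derivation E1"
      by (fact derivation_F2 derivation_F1 derivation_E2 derivation_E1)+
    show "F1 (F2 x) = F2 (F1 x)" "E1 (E2 x) = E2 (E1 x)" for x
      by (simp_all add: F_comm E_comm)
    show "F2 x = s * E2 x" "F1 x = t * E2 x + E1 x" for x
      by (simp_all add: F_E s_def t_def)
    show "s * sk = 1" by (fact s_sk)
    show "F2 s = 3 * s * al" "F1 s = 3 * s * be" "F2 t = 3 * s * be" "F1 t = s * g"
      by (simp_all add: al_def be_def g_def F_s[symmetric] mult.assoc s_sk' mult.left_commute[of s h] third')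
    show "3 * x = 3 * y \<Longrightarrow> x = y" for x y :: 'r
      by (rule cancel_3)
  qed
  \<comment> \<open>The coefficients of \<open>inner\<close> belong to the order (v,x); reversing
    and negating them returns to (x,v).\<close>
  interpret outer: triangular_change d1 d2 F1 F2 "- inner.N3" "- inner.N2" "- inner.N1" "- inner.N0"
    a ak b "h * (ak * d1 a)" "h * (ak * d1 b)" "ak * d2 b"
  proof
    show "derivation d1" "derivation d2" "derivation F1" "derivation F2"
      by (fact d1 d2 derivation_F1 derivation_F2)+
    show "d2 (d1 x) = d1 (d2 x)" "F2 (F1 x) = F1 (F2 x)" for x
      by (simp_all add: F_comm d_comm)
    show "d1 x = a * F1 x" "d2 x = b * F1 x + F2 x" for x
      by (simp_all add: F1_def F2_def ak')
    show "a * ak = 1" by (fact ak)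
    show "d1 a = 3 * a * (h * (ak * d1 a))" "d2 a = 3 * a * (h * (ak * d1 b))"
      "d1 b = 3 * a * (h * (ak * d1 b))" "d2 b = a * (ak * d2 b)"
      by (simp_all add: mult.assoc mult.left_commute[of a h] third' ak' d2_a)
    show "3 * x = 3 * y \<Longrightarrow> x = y" for x y :: 'r
      by (rule cancel_3)
  qed
  interpret swap_inner: coordinate_swap E1 E2 p0 p1 p2 p3
    by standard (simp_all add: derivation_E1 derivation_E2 E_comm)
  interpret swap_outer: coordinate_swap F1 F2 "- inner.N3" "- inner.N2" "- inner.N1" "- inner.N0"
    by standard (simp_all add: derivation_F1 derivation_F2 F_comm)
  \<comment> \<open>A separate name for the determinant: it is cancelled against
    \<open>\<delta>'\<close> first and expanded by \<open>\<delta>0_E\<close> only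
    afterwards.\<close>
  define \<delta>0 where "\<delta>0 = \<delta>"
  note cubic = law[unfolded cubic_law_def, folded \<delta>0_def]
  note law' = cubic[THEN conjunct1] cubic[THEN conjunct2, THEN conjunct1]
    cubic[THEN conjunct2, THEN conjunct2, THEN conjunct1]
    cubic[THEN conjunct2, THEN conjunct2, THEN conjunct2]
  note expand = al_def be_def g_def s_def[folded \<delta>0_def] t_def sk_def F1_def F2_def
  have d_\<delta>0: "d1 \<delta>0 = d1 a * e + a * d1 e - d1 b * c - b * d1 c"
    "d2 \<delta>0 = d1 b * e + a * d2 e - d2 b * c - b * d1 e"
    by (simp_all add: \<delta>0_def d_\<delta>)
  have \<delta>0_\<delta>': "\<delta>' * \<delta>0 = 1" "\<delta>' * (\<delta>0 * x) = x" for x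
    using \<delta>_\<delta>' unfolding \<delta>0_def by (metis mult.commute, metis mult.commute mult.left_commute)
  have \<delta>0_E: "\<delta>0 = a * e - b * c"
    by (simp add: \<delta>0_def \<delta>_def)
  have h_numeral: "h * (x * 3) = x" "h * (x * 6) = x * 2" "h * (x * 9) = x * 3"
    "h * (x * (y * 6)) = x * (y * 2)" "h * (x * (y * 9)) = x * (y * 3)" "h * (x * (y * 3)) = x * y" for x y
  proof -
    have *: "h * (x * (3 * n)) = x * n" for x n
    proof -
      have "h * (x * (3 * n)) = (3 * h) * (x * n)" by (simp only: mult_ac)
      then show ?thesis by (simp add: third)
    qed
    from *[of _ 1] *[of _ 2] *[of _ 3] show "h * (x * 3) = x" "h * (x * 6) = x * 2" "h * (x * 9) = x * 3"
      by simp_all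
    from *[of "x * y" 1] *[of "x * y" 2] *[of "x * y" 3] show "h * (x * (y * 6)) = x * (y * 2)" "h * (x * (y * 9)) = x * (y * 3)" "h * (x * (y * 3)) = x * y"
      by (simp_all add: mult.assoc)
  qed
  note simps = h_numeral d_ak d_\<delta>0 d2_a d2_c derivation_simps[OF d1] derivation_simps[OF d2]
    ak ak' \<delta>0_\<delta>' third third'
  \<comment> \<open>The law for the full Jacobian matrix agrees with the composition of the two
    triangular laws; units are cancelled at the end.\<close>
  have "\<delta>0 * q0 = \<delta>0 * outer.N0"
    unfolding law' outer.N_defs unfolding inner.N_defs unfolding expand
    by (simp add: simps algebra_simps, (simp add: \<delta>0_E simps algebra_simps)?)
  moreover have "3 * \<delta>0 * q1 = 3 * \<delta>0 * outer.N1"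
    unfolding law' outer.N_defs unfolding inner.N_defs unfolding expand
    by (simp add: simps algebra_simps, (simp add: \<delta>0_E simps algebra_simps)?)
  moreover have "3 * \<delta>0 * q2 = 3 * \<delta>0 * outer.N2"
    unfolding law' outer.N_defs unfolding inner.N_defs unfolding expand
    by (simp add: simps algebra_simps, (simp add: \<delta>0_E simps algebra_simps)?)
  moreover have "\<delta>0 * q3 = \<delta>0 * outer.N3"
    unfolding law' outer.N_defs unfolding inner.N_defs unfolding expand
    by (simp add: simps algebra_simps, (simp add: \<delta>0_E simps algebra_simps)?)
  ultimately have q0: "q0 = outer.N0" and q1: "q1 = outer.N1" and q2: "q2 = outer.N2" and q3: "q3 = outer.N3"
    by (simp_all add: \<delta>0_def mult.assoc) (blast intro: \<delta>_cancel cancel_3)+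
  have "det (cubic.M d1 d2 q0 q1 q2 q3) = a ^ 14 * (s ^ 14 * det (cubic.M E1 E2 p0 p1 p2 p3))"
    unfolding q0 q1 q2 q3 outer.det_new_M swap_outer.det_new_M[symmetric] minus_minus
      inner.det_new_M swap_inner.det_new_M ..
  also have "a ^ 14 * (s ^ 14 * det (cubic.M E1 E2 p0 p1 p2 p3)) = (a * s) ^ 14 * det (cubic.M E1 E2 p0 p1 p2 p3)"
    by (simp add: power_mult_distrib mult.assoc)
  also have "a * s = \<delta>"
    by (simp add: s_def mult.left_commute[of a \<delta>] ak)
  finally show ?thesis .
qed

end

text \<open>When y_u is the unit, x and y are interchanged first. This negates
  \<open>\<delta>\<close>, which is harmless to an even power.\<close>

theorem det_change:
  assumes law: "cubic_law p0 p1 p2 p3 q0 q1 q2 q3"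
    and unit: "(\<exists>ak. a * ak = 1) \<or> (\<exists>ck. c * ck = 1)"
  shows "det (cubic.M d1 d2 q0 q1 q2 q3) = \<delta> ^ 14 * det (cubic.M E1 E2 p0 p1 p2 p3)"
  using unit
proof
  assume "\<exists>ak. a * ak = 1"
  then show ?thesis using det_change_aux law by blast
next
  assume "\<exists>ck. c * ck = 1"
  then obtain ck where ck: "c * ck = 1" ..
  interpret swapped: coordinate_change d1 d2 c e a b "- \<delta>'" h
  proof
    show "(c * b - e * a) * - \<delta>' = 1"
      using inverse_\<delta> by (simp add: algebra_simps)
  qed (fact d1 d2 d_comm d2_a d2_c third)+
  have E: "swapped.E1 = E2" "swapped.E2 = E1" "swapped.\<delta> = - \<delta>"
    by (simp_all add: fun_eq_iff swapped.E1_def E2_def swapped.E2_def E1_def swapped.\<delta>_def \<delta>_def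
        algebra_simps)
  interpret swap: coordinate_swap E1 E2 p0 p1 p2 p3
    by standard (simp_all add: derivation_E1 derivation_E2 E_comm)
  have "swapped.cubic_law (- p3) (- p2) (- p1) (- p0) q0 q1 q2 q3"
    unfolding swapped.cubic_law_def E
    apply (intro conjI)
    using law[unfolded cubic_law_def]
    by (simp_all add: algebra_simps)
  then have "det (cubic.M d1 d2 q0 q1 q2 q3)
      = swapped.\<delta> ^ 14 * det (cubic.M swapped.E1 swapped.E2 (- p3) (- p2) (- p1) (- p0))"
    using swapped.det_change_aux ck by blast
  also have "cubic.M swapped.E1 swapped.E2 (- p3) (- p2) (- p1) (- p0) = swap.new.M"
    by (simp add: E)
  finally show ?thesis
    by (simp add: E swap.det_new_M)
qed

text \<open>Here \<open>u11\<close>, \<open>w11\<close>, ... are the Christoffel symbols $\bar\Gamma^1_{11}$, $\bar\Gamma^2_{11}$, ...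
  in the coordinates $(u,v)$, and \<open>x11\<close>, \<open>y11\<close>, ... are those in the coordinates $(x,y)$.\<close>

lemma cubic_law_of_connection:
  assumes "a * u11 + b * w11 = d1 a + (a * a * x11 + 2 * a * c * x12 + c * c * x22)"
    and "c * u11 + e * w11 = d1 c + (a * a * y11 + 2 * a * c * y12 + c * c * y22)"
    and "a * u12 + b * w12 = d1 b + (a * b * x11 + (a * e + b * c) * x12 + c * e * x22)"
    and "c * u12 + e * w12 = d1 e + (a * b * y11 + (a * e + b * c) * y12 + c * e * y22)"
    and "a * u22 + b * w22 = d2 b + (b * b * x11 + 2 * b * e * x12 + e * e * x22)"
    and "c * u22 + e * w22 = d2 e + (b * b * y11 + 2 * b * e * y12 + e * e * y22)"
  shows "cubic_law (- y11) (h * (x11 - 2 * y12)) (h * (2 * x12 - y22)) x22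
    (- w11) (h * (u11 - 2 * w12)) (h * (2 * u12 - w22)) u22"
proof -
  have 3: "3 * (h * x) = x" for x
    using third by (simp flip: mult.assoc)
  \<comment> \<open>Cramer's rule: each projective combination of new symbols, times
    \<open>\<delta>\<close>, is a combination of the left-hand sides of the assumptions.\<close>
  have 0: "\<delta> * - w11 = c * (a * u11 + b * w11) - a * (c * u11 + e * w11)"
    by (simp add: \<delta>_def algebra_simps)
  have 1: "\<delta> * (u11 - 2 * w12) = e * (a * u11 + b * w11) - b * (c * u11 + e * w11)
      - 2 * a * (c * u12 + e * w12) + 2 * c * (a * u12 + b * w12)"
    by (simp add: \<delta>_def algebra_simps)
  have 2: "\<delta> * (2 * u12 - w22) = 2 * e * (a * u12 + b * w12) - 2 * b * (c * u12 + e * w12)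
      - a * (c * u22 + e * w22) + c * (a * u22 + b * w22)"
    by (simp add: \<delta>_def algebra_simps)
  have 4: "\<delta> * u22 = e * (a * u22 + b * w22) - b * (c * u22 + e * w22)"
    by (simp add: \<delta>_def algebra_simps)
  have 5: "3 * \<delta> * (h * x) = \<delta> * x" for x
    by (simp add: mult.assoc mult.left_commute[of 3 \<delta>] 3)
  have 6: "3 * (l * (h * x)) = l * x" for l x
    by (subst mult.left_commute) (simp add: 3)
  have 7: "3 * (k * p + l * (h * x) + m * (h * y) + n * q) = 3 * k * p + l * x + m * y + 3 * n * q"
    for k l m n p q x y
    by (simp add: distrib_left 6 mult.assoc)
  have 8: "3 * k * l * m * (h * x) = k * l * m * x" for k l m x
    using 6[of "k * l * m" x] by (simp add: mult.assoc)
  show ?thesis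
    unfolding cubic_law_def 5 7 8 unfolding 0 1 2 4 assms
    by (simp add: algebra_simps)
qed

end

section \<open>Smooth functions on open sets of normed spaces\<close>

section \<open>Smooth functions\<close>

lemma frechet_derivative_cong:
  assumes "open S" "x \<in> S" "\<And>y. y \<in> S \<Longrightarrow> f y = g y"
  shows "frechet_derivative f (at x) = frechet_derivative g (at x)"
proof -
  have "(f has_derivative D) (at x) \<longleftrightarrow> (g has_derivative D) (at x)" for D
    using assms has_derivative_transform_within_open[of f D x UNIV S g]
      has_derivative_transform_within_open[of g D x UNIV S f] by auto
  then show ?thesis
    by (simp add: frechet_derivative_def)
qed

lemma differentiable_cong:
  assumes "open S" "x \<in> S" "\<And>y. y \<in> S \<Longrightarrow> f y = g y"
  shows "f differentiable (at x) \<longleftrightarrow> g differentiable (at x)"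
  using assms has_derivative_transform_within_open[of f _ x UNIV S g]
    has_derivative_transform_within_open[of g _ x UNIV S f]
  unfolding differentiable_def by metis

text \<open>The closure properties below are inductions in which this rule replaces the Frechet
  derivative by the formula that holds for it on the open set.\<close>

lemma higher_differentiable_on_cong:
  assumes "open S" "\<And>y. y \<in> S \<Longrightarrow> f y = g y"
  shows "higher_differentiable_on S f n \<longleftrightarrow> higher_differentiable_on S g n"
  using assms(2)
proof (induction n arbitrary: f g)
  case 0
  then show ?case using continuous_on_cong by auto
next
  case (Suc n)
  have "higher_differentiable_on S (\<lambda>x. frechet_derivative f (at x) v) n
      \<longleftrightarrow> higher_differentiable_on S (\<lambda>x. frechet_derivative g (at x) v) n" for v
    by (rule Suc.IH) (metis Suc.prems assms(1) frechet_derivative_cong)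
  then show ?case
    using differentiable_cong[OF assms(1) _ Suc.prems] by auto
qed

lemma higher_differentiable_on_Suc_imp:
  "higher_differentiable_on S f (Suc n) \<Longrightarrow> higher_differentiable_on S f n"
proof (induction n arbitrary: f)
  case 0
  then show ?case
    by (auto intro!: differentiable_imp_continuous_on simp: differentiable_on_def
        differentiable_at_withinI)
next
  case (Suc n)
  then show ?case by (metis higher_differentiable_on.simps(2))
qed

lemma higher_differentiable_on_subset:
  "higher_differentiable_on S f n \<Longrightarrow> T \<subseteq> S \<Longrightarrow> higher_differentiable_on T f n"
  by (induction n arbitrary: f) (auto intro: continuous_on_subset)

lemma higher_differentiable_on_const:
  "open S \<Longrightarrow> higher_differentiable_on S (\<lambda>x. c) n"
  by (induction n arbitrary: c) (simp_all add: frechet_derivative_const)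

lemma higher_differentiable_on_add:
  assumes "open S" "higher_differentiable_on S f n" "higher_differentiable_on S g n"
  shows "higher_differentiable_on S (\<lambda>x. f x + g x) n"
  using assms(2,3)
proof (induction n arbitrary: f g)
  case 0
  then show ?case by (auto intro: continuous_on_add)
next
  case (Suc n)
  have "higher_differentiable_on S (\<lambda>x. frechet_derivative (\<lambda>x. f x + g x) (at x) v) n" for v
  proof (subst higher_differentiable_on_cong[OF assms(1)])
    show "frechet_derivative (\<lambda>x. f x + g x) (at x) v
        = frechet_derivative f (at x) v + frechet_derivative g (at x) v" if "x \<in> S" for x
      using Suc.prems that
      by (subst frechet_derivative_at[symmetric, OF has_derivative_add[OF
            frechet_derivative_works[THEN iffD1] frechet_derivative_works[THEN iffD1]]]) auto
  qed (use Suc in auto)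
  then show ?case using Suc.prems by auto
qed

lemma higher_differentiable_on_mult:
  fixes f g :: "'a::real_normed_vector \<Rightarrow> real"
  assumes "open S" "higher_differentiable_on S f n" "higher_differentiable_on S g n"
  shows "higher_differentiable_on S (\<lambda>x. f x * g x) n"
  using assms(2,3)
proof (induction n arbitrary: f g)
  case 0
  then show ?case by (auto intro: continuous_on_mult)
next
  case (Suc n)
  have "higher_differentiable_on S (\<lambda>x. frechet_derivative (\<lambda>x. f x * g x) (at x) v) n" for v
  proof (subst higher_differentiable_on_cong[OF assms(1)])
    show "frechet_derivative (\<lambda>x. f x * g x) (at x) v
        = f x * frechet_derivative g (at x) v + frechet_derivative f (at x) v * g x" if "x \<in> S" for x
      using Suc.prems that
      by (subst frechet_derivative_at[symmetric, OF has_derivative_mult[OF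
            frechet_derivative_works[THEN iffD1] frechet_derivative_works[THEN iffD1]]]) auto
  qed (use Suc in \<open>auto intro!: higher_differentiable_on_add[OF assms(1)] Suc.IH
      intro: higher_differentiable_on_Suc_imp\<close>)
  then show ?case using Suc.prems by auto
qed

lemma higher_differentiable_on_inverse:
  fixes f :: "'a::real_normed_vector \<Rightarrow> real"
  assumes "open S" "higher_differentiable_on S f n" "\<And>x. x \<in> S \<Longrightarrow> f x \<noteq> 0"
  shows "higher_differentiable_on S (\<lambda>x. inverse (f x)) n"
  using assms(2)
\<comment> \<open>The function stays fixed: the derivative of 1/f is again built from 1/f and the
  derivative of f.\<close>
proof (induction n)
  case 0
  then show ?case using assms(3) by (auto intro: continuous_on_inverse)
next
  case (Suc n)
  have "higher_differentiable_on S (\<lambda>x. frechet_derivative (\<lambda>x. inverse (f x)) (at x) v) n" for v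
  proof (subst higher_differentiable_on_cong[OF assms(1)])
    show "frechet_derivative (\<lambda>x. inverse (f x)) (at x) v
        = (- 1) * (inverse (f x) * frechet_derivative f (at x) v * inverse (f x))" if "x \<in> S" for x
      using Suc.prems that assms(3)[OF that]
      by (subst frechet_derivative_at[symmetric, OF Deriv.has_derivative_inverse[OF _
            frechet_derivative_works[THEN iffD1]]]) auto
    show "higher_differentiable_on S
        (\<lambda>x. (- 1) * (inverse (f x) * frechet_derivative f (at x) v * inverse (f x))) n"
      using Suc.prems Suc.IH[OF higher_differentiable_on_Suc_imp[OF Suc.prems]] assms(1)
      by (intro higher_differentiable_on_mult higher_differentiable_on_const) auto
  qed
  moreover have "(\<lambda>x. inverse (f x)) differentiable (at x)" if "x \<in> S" for x
    using Suc.prems that assms(3)[OF that] by (auto intro!: differentiable_inverse)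
  ultimately show ?case by auto
qed

lemma higher_differentiable_on_bounded_linear:
  assumes "open S" "bounded_linear h" "higher_differentiable_on S f n"
  shows "higher_differentiable_on S (\<lambda>x. h (f x)) n"
  using assms(3)
proof (induction n arbitrary: f)
  case 0
  then show ?case
    using bounded_linear.continuous_on[OF assms(2)] by auto
next
  case (Suc n)
  have D: "((\<lambda>x. h (f x)) has_derivative (\<lambda>v. h (frechet_derivative f (at x) v))) (at x)" if "x \<in> S" for x
    using Suc.prems that by (intro bounded_linear.has_derivative[OF assms(2)])
      (auto simp: frechet_derivative_works)
  have "higher_differentiable_on S (\<lambda>x. frechet_derivative (\<lambda>x. h (f x)) (at x) v) n" for v
  proof (subst higher_differentiable_on_cong[OF assms(1)])
    show "frechet_derivative (\<lambda>x. h (f x)) (at x) v = h (frechet_derivative f (at x) v)"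
      if "x \<in> S" for x
      using frechet_derivative_at[OF D[OF that]] by metis
  qed (use Suc in auto)
  then show ?case using D by (auto simp: differentiable_def)
qed

lemma frechet_derivative_eq_partials:
  fixes f :: "real^2 \<Rightarrow> 'b::real_normed_vector"
  assumes "f differentiable (at x)"
  shows "frechet_derivative f (at x) v = v $ 1 *\<^sub>R partial 1 f x + v $ 2 *\<^sub>R partial 2 f x"
proof -
  interpret linear "frechet_derivative f (at x)"
    using assms by (rule linear_frechet_derivative)
  have "v = v $ 1 *\<^sub>R axis 1 1 + v $ 2 *\<^sub>R axis 2 1"
    by (simp add: vec_eq_iff forall_2 axis_def)
  then have "frechet_derivative f (at x) v = frechet_derivative f (at x) (v $ 1 *\<^sub>R axis 1 1 + v $ 2 *\<^sub>R axis 2 1)"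
    by simp
  then show ?thesis by (simp add: add scale partial_def)
qed

lemma frechet_derivative_compose_eq:
  assumes "f differentiable (at (\<sigma> x))" "\<sigma> differentiable (at x)"
  shows "frechet_derivative (\<lambda>x. f (\<sigma> x)) (at x) v
    = frechet_derivative f (at (\<sigma> x)) (frechet_derivative \<sigma> (at x) v)"
  using frechet_derivative_compose[OF assms(2,1)] by (simp add: o_def)

lemma higher_differentiable_on_compose:
  fixes f :: "real^2 \<Rightarrow> real" and \<sigma> :: "'a::real_normed_vector \<Rightarrow> real^2"
  assumes "open S" "\<And>x. x \<in> S \<Longrightarrow> \<sigma> x \<in> T"
    and "higher_differentiable_on T f n" "higher_differentiable_on S \<sigma> n"
  shows "higher_differentiable_on S (\<lambda>x. f (\<sigma> x)) n"
  using assms(3,4)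
proof (induction n arbitrary: f)
  case 0
  then show ?case using assms(2) by (auto intro!: continuous_on_compose2[of T f])
next
  case (Suc n)
  have "higher_differentiable_on S (\<lambda>x. frechet_derivative (\<lambda>x. f (\<sigma> x)) (at x) v) n" for v
  proof (subst higher_differentiable_on_cong[OF assms(1)])
    show "frechet_derivative (\<lambda>x. f (\<sigma> x)) (at x) v
        = frechet_derivative \<sigma> (at x) v $ 1 * partial 1 f (\<sigma> x)
          + frechet_derivative \<sigma> (at x) v $ 2 * partial 2 f (\<sigma> x)" if "x \<in> S" for x
      using Suc.prems that assms(2)[OF that]
      by (subst frechet_derivative_compose_eq) (auto simp: frechet_derivative_eq_partials)
    show "higher_differentiable_on S (\<lambda>x. frechet_derivative \<sigma> (at x) v $ 1 * partial 1 f (\<sigma> x)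
          + frechet_derivative \<sigma> (at x) v $ 2 * partial 2 f (\<sigma> x)) n"
      using Suc.prems higher_differentiable_on_Suc_imp[OF Suc.prems(2)]
      by (intro higher_differentiable_on_add higher_differentiable_on_mult assms(1) Suc.IH
          higher_differentiable_on_bounded_linear[OF assms(1) bounded_linear_vec_nth])
        (auto simp: partial_def[abs_def])
  qed
  moreover have "(\<lambda>x. f (\<sigma> x)) differentiable (at x)" if "x \<in> S" for x
    using differentiable_chain_at[of \<sigma> x f] Suc.prems that assms(2)[OF that] by (simp add: o_def)
  ultimately show ?case by auto
qed

lemma smooth_on_differentiable: "smooth_on S f \<Longrightarrow> x \<in> S \<Longrightarrow> f differentiable (at x)"
  unfolding smooth_on_def by (metis higher_differentiable_on.simps(2))

lemma smooth_on_continuous: "smooth_on S f \<Longrightarrow> continuous_on S f"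
  unfolding smooth_on_def by (metis higher_differentiable_on.simps(1))

lemma smooth_on_cong:
  "open S \<Longrightarrow> (\<And>y. y \<in> S \<Longrightarrow> f y = g y) \<Longrightarrow> smooth_on S f \<longleftrightarrow> smooth_on S g"
  unfolding smooth_on_def using higher_differentiable_on_cong by blast

lemma smooth_on_subset: "smooth_on S f \<Longrightarrow> T \<subseteq> S \<Longrightarrow> smooth_on T f"
  unfolding smooth_on_def using higher_differentiable_on_subset by blast

lemma smooth_on_const: "open S \<Longrightarrow> smooth_on S (\<lambda>x. c)"
  unfolding smooth_on_def using higher_differentiable_on_const by blast

lemma smooth_on_add: "open S \<Longrightarrow> smooth_on S f \<Longrightarrow> smooth_on S g \<Longrightarrow> smooth_on S (\<lambda>x. f x + g x)"
  unfolding smooth_on_def using higher_differentiable_on_add by blast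

lemma smooth_on_mult:
  fixes f g :: "'a::real_normed_vector \<Rightarrow> real"
  shows "open S \<Longrightarrow> smooth_on S f \<Longrightarrow> smooth_on S g \<Longrightarrow> smooth_on S (\<lambda>x. f x * g x)"
  unfolding smooth_on_def using higher_differentiable_on_mult by blast

lemma smooth_on_minus:
  fixes f :: "'a::real_normed_vector \<Rightarrow> real"
  shows "open S \<Longrightarrow> smooth_on S f \<Longrightarrow> smooth_on S (\<lambda>x. - f x)"
  using smooth_on_mult[of S "\<lambda>_. - 1" f] smooth_on_const[of S "- 1"] by simp

lemma smooth_on_diff:
  fixes f g :: "'a::real_normed_vector \<Rightarrow> real"
  shows "open S \<Longrightarrow> smooth_on S f \<Longrightarrow> smooth_on S g \<Longrightarrow> smooth_on S (\<lambda>x. f x - g x)"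
  using smooth_on_add[of S f "\<lambda>x. - g x"] smooth_on_minus[of S g] by simp

lemma smooth_on_inverse:
  fixes f :: "'a::real_normed_vector \<Rightarrow> real"
  shows "open S \<Longrightarrow> smooth_on S f \<Longrightarrow> (\<And>x. x \<in> S \<Longrightarrow> f x \<noteq> 0) \<Longrightarrow> smooth_on S (\<lambda>x. inverse (f x))"
  unfolding smooth_on_def using higher_differentiable_on_inverse by blast

lemma smooth_on_power2:
  fixes f :: "'a::real_normed_vector \<Rightarrow> real"
  shows "open S \<Longrightarrow> smooth_on S f \<Longrightarrow> smooth_on S (\<lambda>x. (f x)\<^sup>2)"
  unfolding power2_eq_square by (rule smooth_on_mult)

lemma smooth_on_sum:
  fixes f :: "'i \<Rightarrow> 'a::real_normed_vector \<Rightarrow> real"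
  shows "open S \<Longrightarrow> (\<And>i. i \<in> I \<Longrightarrow> smooth_on S (f i)) \<Longrightarrow> smooth_on S (\<lambda>x. \<Sum>i\<in>I. f i x)"
  by (induction I rule: infinite_finite_induct) (simp_all add: smooth_on_const smooth_on_add)

lemma smooth_on_prod:
  fixes f :: "'i \<Rightarrow> 'a::real_normed_vector \<Rightarrow> real"
  shows "open S \<Longrightarrow> (\<And>i. i \<in> I \<Longrightarrow> smooth_on S (f i)) \<Longrightarrow> smooth_on S (\<lambda>x. \<Prod>i\<in>I. f i x)"
  by (induction I rule: infinite_finite_induct) (simp_all add: smooth_on_const smooth_on_mult)

lemma smooth_on_vec_nth: "open S \<Longrightarrow> smooth_on S f \<Longrightarrow> smooth_on S (\<lambda>x. f x $ i)"
  unfolding smooth_on_def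
  using higher_differentiable_on_bounded_linear[OF _ bounded_linear_vec_nth] by blast

lemma smooth_on_partial: "smooth_on S f \<Longrightarrow> smooth_on S (partial i f)"
  unfolding smooth_on_def partial_def[abs_def] by (metis higher_differentiable_on.simps(2))

lemma smooth_on_compose:
  fixes f :: "real^2 \<Rightarrow> real" and \<sigma> :: "'a::real_normed_vector \<Rightarrow> real^2"
  assumes "open S" "\<And>x. x \<in> S \<Longrightarrow> \<sigma> x \<in> T" "smooth_on T f" "smooth_on S \<sigma>"
  shows "smooth_on S (\<lambda>x. f (\<sigma> x))"
  using assms higher_differentiable_on_compose unfolding smooth_on_def by blast

section \<open>Partial derivatives and their commutation\<close>

section \<open>Partial derivatives\<close>

lemma partial_cong:
  "open S \<Longrightarrow> x \<in> S \<Longrightarrow> (\<And>y. y \<in> S \<Longrightarrow> f y = g y) \<Longrightarrow> partial i f x = partial i g x"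
  unfolding partial_def by (metis frechet_derivative_cong)

lemma partial_const: "partial i (\<lambda>x. c) x = 0"
  by (simp add: partial_def frechet_derivative_const)

lemma partial_add:
  assumes "f differentiable (at x)" "g differentiable (at x)"
  shows "partial i (\<lambda>x. f x + g x) x = partial i f x + partial i g x"
  unfolding partial_def using assms
  by (subst frechet_derivative_at[symmetric, OF has_derivative_add[OF
        frechet_derivative_works[THEN iffD1] frechet_derivative_works[THEN iffD1]]]) auto

lemma partial_mult:
  fixes f g :: "real^2 \<Rightarrow> real"
  assumes "f differentiable (at x)" "g differentiable (at x)"
  shows "partial i (\<lambda>x. f x * g x) x = partial i f x * g x + f x * partial i g x"
  unfolding partial_def using assms
  by (subst frechet_derivative_at[symmetric, OF has_derivative_mult[OF
        frechet_derivative_works[THEN iffD1] frechet_derivative_works[THEN iffD1]]]) auto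

lemma partial_vec_nth:
  assumes "f differentiable (at x)"
  shows "partial i (\<lambda>x. f x $ k) x = partial i f x $ k"
proof -
  have "((\<lambda>x. f x $ k) has_derivative (\<lambda>v. frechet_derivative f (at x) v $ k)) (at x)"
    using assms by (intro bounded_linear.has_derivative[OF bounded_linear_vec_nth])
      (simp add: frechet_derivative_works)
  from frechet_derivative_at[OF this, symmetric] show ?thesis
    by (simp add: partial_def)
qed

lemma partial_compose:
  fixes f :: "real^2 \<Rightarrow> real" and \<sigma> :: "real^2 \<Rightarrow> real^2"
  assumes "f differentiable (at (\<sigma> x))" "\<sigma> differentiable (at x)"
  shows "partial i (\<lambda>x. f (\<sigma> x)) x
    = partial i \<sigma> x $ 1 * partial 1 f (\<sigma> x) + partial i \<sigma> x $ 2 * partial 2 f (\<sigma> x)"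
  using frechet_derivative_compose_eq[OF assms] frechet_derivative_eq_partials[OF assms(1)]
  by (simp add: partial_def[of i])

lemma partial_has_real_derivative:
  fixes f :: "real^2 \<Rightarrow> real"
  assumes "f differentiable (at (p + r *\<^sub>R axis i 1))"
  shows "((\<lambda>r. f (p + r *\<^sub>R axis i 1)) has_real_derivative partial i f (p + r *\<^sub>R axis i 1)) (at r)"
proof -
  have "((\<lambda>r. p + r *\<^sub>R axis i 1) has_derivative (\<lambda>r. r *\<^sub>R axis i 1)) (at r)"
    by (auto intro!: derivative_eq_intros)
  then have "((\<lambda>r. f (p + r *\<^sub>R axis i 1)) has_derivative
      (\<lambda>u. frechet_derivative f (at (p + r *\<^sub>R axis i 1)) (u *\<^sub>R axis i 1))) (at r)"
    using diff_chain_at[of "\<lambda>r. p + r *\<^sub>R axis i 1" "\<lambda>r. r *\<^sub>R axis i 1" r f]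
      assms[unfolded frechet_derivative_works] by (simp add: o_def)
  then show ?thesis
    unfolding has_field_derivative_def partial_def
    using linear_frechet_derivative[OF assms] by (simp add: linear_scale mult_commute_abs)
qed

text \<open>The mean value theorem twice: in direction i for the difference of two opposite sides of
  the square, then in direction j. The second difference on the left is symmetric in i and
  j.\<close>

lemma mixed_difference:
  fixes f :: "real^2 \<Rightarrow> real"
  assumes h: "h > 0"
    and sq: "\<And>r u. 0 \<le> r \<Longrightarrow> r \<le> h \<Longrightarrow> 0 \<le> u \<Longrightarrow> u \<le> h \<Longrightarrow> p + r *\<^sub>R axis i 1 + u *\<^sub>R axis j 1 \<in> S"
    and S: "smooth_on S f"
  obtains r u where "0 \<le> r" "r \<le> h" "0 \<le> u" "u \<le> h"
    "f (p + h *\<^sub>R axis i 1 + h *\<^sub>R axis j 1) - f (p + h *\<^sub>R axis i 1) - f (p + h *\<^sub>R axis j 1) + f p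
       = h * h * partial j (partial i f) (p + r *\<^sub>R axis i 1 + u *\<^sub>R axis j 1)"
proof -
  define x where "x r u = p + r *\<^sub>R axis i 1 + u *\<^sub>R axis j (1::real)" for r u
  have x_i: "x r u = (p + u *\<^sub>R axis j 1) + r *\<^sub>R axis i 1" for r u
    by (simp add: x_def)
  note diff = smooth_on_differentiable
  have Di: "((\<lambda>r. f (x r u)) has_real_derivative partial i f (x r u)) (at r)"
    if "0 \<le> r" "r \<le> h" "0 \<le> u" "u \<le> h" for r u
    unfolding x_i using diff[OF S sq[OF that]]
    by (intro partial_has_real_derivative) (simp add: add_ac)
  have Dj: "((\<lambda>u. partial i f (x r u)) has_real_derivative partial j (partial i f) (x r u)) (at u)"
    if "0 \<le> r" "r \<le> h" "0 \<le> u" "u \<le> h" for r u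
    unfolding x_def using diff[OF smooth_on_partial[OF S] sq[OF that]]
    by (rule partial_has_real_derivative)
  have "\<exists>r>0. r < h \<and> (f (x h h) - f (x h 0)) - (f (x 0 h) - f (x 0 0))
      = (h - 0) * (partial i f (x r h) - partial i f (x r 0))"
    using h by (intro MVT2 DERIV_diff Di) auto
  then obtain r where r: "0 < r" "r < h"
    "(f (x h h) - f (x h 0)) - (f (x 0 h) - f (x 0 0)) = h * (partial i f (x r h) - partial i f (x r 0))"
    by auto
  have "\<exists>u>0. u < h \<and> partial i f (x r h) - partial i f (x r 0) = (h - 0) * partial j (partial i f) (x r u)"
    using h r by (intro MVT2 Dj) auto
  then obtain u where u: "0 < u" "u < h"
    "partial i f (x r h) - partial i f (x r 0) = h * partial j (partial i f) (x r u)"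
    by auto
  show ?thesis
  proof (rule that[of r u])
    have "f (x h h) - f (x h 0) - f (x 0 h) + f (x 0 0) = h * h * partial j (partial i f) (x r u)"
      using r(3) u(3) by simp
    then show "f (p + h *\<^sub>R axis i 1 + h *\<^sub>R axis j 1) - f (p + h *\<^sub>R axis i 1)
        - f (p + h *\<^sub>R axis j 1) + f p
      = h * h * partial j (partial i f) (p + r *\<^sub>R axis i 1 + u *\<^sub>R axis j 1)"
      by (simp add: x_def)
  qed (use r u in simp_all)
qed

text \<open>Schwarz's theorem. One and the same second difference over a small square gives a value
  of either mixed derivative near p; continuity brings both within half the supposed gap of their
  values at p.\<close>

lemma partial_commute:
  fixes f :: "real^2 \<Rightarrow> real"
  assumes "open S" "p \<in> S" "smooth_on S f"
  shows "partial i (partial j f) p = partial j (partial i f) p"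
proof (rule ccontr)
  let ?F = "partial i (partial j f)" and ?G = "partial j (partial i f)"
  assume "?F p \<noteq> ?G p"
  define e where "e = \<bar>?F p - ?G p\<bar> / 2"
  then have e: "e > 0" using \<open>?F p \<noteq> ?G p\<close> by simp
  have near: "\<exists>d>0. \<forall>x. dist x p < d \<longrightarrow> \<bar>H x - H p\<bar> < e" if "smooth_on S H" for H :: "real^2 \<Rightarrow> real"
  proof -
    have "isCont H p"
      using smooth_on_continuous[OF that] assms by (simp add: continuous_on_eq_continuous_at)
    then show ?thesis using e unfolding continuous_at_eps_delta dist_real_def by simp
  qed
  obtain d1 where d1: "d1 > 0" "\<And>x. dist x p < d1 \<Longrightarrow> \<bar>?F x - ?F p\<bar> < e"
    using near[OF smooth_on_partial[OF smooth_on_partial[OF assms(3)]], of i j] by auto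
  obtain d2 where d2: "d2 > 0" "\<And>x. dist x p < d2 \<Longrightarrow> \<bar>?G x - ?G p\<bar> < e"
    using near[OF smooth_on_partial[OF smooth_on_partial[OF assms(3)]], of j i] by auto
  obtain d3 where d3: "d3 > 0" "ball p d3 \<subseteq> S"
    using assms open_contains_ball by blast
  \<comment> \<open>Points of the square are at distance at most 2h from p, hence less than
    3h.\<close>
  define h where "h = min d1 (min d2 d3) / 3"
  have h: "h > 0" "3 * h \<le> d1" "3 * h \<le> d2" "3 * h \<le> d3"
    using d1 d2 d3 by (auto simp: h_def)
  have dist: "dist (p + r *\<^sub>R axis i 1 + u *\<^sub>R axis j 1) p < 3 * h" if "0 \<le> r" "r \<le> h" "0 \<le> u" "u \<le> h"
    for r u and i j :: 2
  proof -
    have "dist (p + r *\<^sub>R axis i 1 + u *\<^sub>R axis j 1) p \<le> norm (r *\<^sub>R axis i (1::real)) + norm (u *\<^sub>R axis j (1::real))"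
      using norm_triangle_ineq[of "r *\<^sub>R axis i 1" "u *\<^sub>R axis j (1::real)"] by (simp add: dist_norm add.assoc del: norm_scaleR)
    also have "\<dots> < 3 * h" using that h by simp
    finally show ?thesis .
  qed
  have in_S: "p + r *\<^sub>R axis i 1 + u *\<^sub>R axis j 1 \<in> S" if "0 \<le> r" "r \<le> h" "0 \<le> u" "u \<le> h"
    for r u and i j :: 2
  proof -
    have "p + r *\<^sub>R axis i 1 + u *\<^sub>R axis j 1 \<in> ball p d3"
      using dist[OF that, of i j] h(4) unfolding mem_ball dist_commute[of p] by linarith
    then show ?thesis using d3(2) by blast
  qed
  obtain r u where ru: "0 \<le> r" "r \<le> h" "0 \<le> u" "u \<le> h"
    "f (p + h *\<^sub>R axis j 1 + h *\<^sub>R axis i 1) - f (p + h *\<^sub>R axis j 1) - f (p + h *\<^sub>R axis i 1) + f p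
       = h * h * ?F (p + r *\<^sub>R axis j 1 + u *\<^sub>R axis i 1)"
    by (rule mixed_difference[OF h(1) in_S assms(3)])
  obtain r' u' where ru': "0 \<le> r'" "r' \<le> h" "0 \<le> u'" "u' \<le> h"
    "f (p + h *\<^sub>R axis i 1 + h *\<^sub>R axis j 1) - f (p + h *\<^sub>R axis i 1) - f (p + h *\<^sub>R axis j 1) + f p
       = h * h * ?G (p + r' *\<^sub>R axis i 1 + u' *\<^sub>R axis j 1)"
    by (rule mixed_difference[OF h(1) in_S assms(3)])
  have "p + h *\<^sub>R axis j 1 + h *\<^sub>R axis i 1 = p + h *\<^sub>R axis i 1 + h *\<^sub>R axis j (1::real)"
    by simp
  from ru(5)[unfolded this] have "h * h * ?F (p + r *\<^sub>R axis j 1 + u *\<^sub>R axis i 1) = h * h * ?G (p + r' *\<^sub>R axis i 1 + u' *\<^sub>R axis j 1)"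
    using ru'(5) by linarith
  then have eq: "?F (p + r *\<^sub>R axis j 1 + u *\<^sub>R axis i 1) = ?G (p + r' *\<^sub>R axis i 1 + u' *\<^sub>R axis j 1)"
    using h by simp
  have F: "\<bar>?F (p + r *\<^sub>R axis j 1 + u *\<^sub>R axis i 1) - ?F p\<bar> < e"
    by (rule d1(2)) (use dist[OF ru(1-4), of j i] h(2) in linarith)
  have G: "\<bar>?G (p + r' *\<^sub>R axis i 1 + u' *\<^sub>R axis j 1) - ?G p\<bar> < e"
    by (rule d2(2)) (use dist[OF ru'(1-4), of i j] h(3) in linarith)
  have contra: "False" if "x = y" "\<bar>x - F\<bar> < e" "\<bar>y - G\<bar> < e" "e = \<bar>F - G\<bar> / 2" for x y F G
  proof -
    have "\<bar>F - G\<bar> \<le> \<bar>x - G\<bar> + \<bar>x - F\<bar>"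
      using abs_triangle_ineq4[of "x - G" "x - F"] by simp
    moreover have "\<bar>x - F\<bar> + \<bar>x - G\<bar> < e + e"
      using that(1-3) by (intro add_strict_mono) simp_all
    ultimately show False using that(4) by simp
  qed
  show False by (rule contra[OF eq F G e_def])
qed

section \<open>The local ring of germs with two commuting derivations\<close>

section \<open>Germs of smooth functions\<close>

definition smooth_at :: "real^2 \<Rightarrow> (real^2 \<Rightarrow> real) \<Rightarrow> bool" where
  "smooth_at q f \<longleftrightarrow> (\<exists>S. open S \<and> q \<in> S \<and> smooth_on S f)"

lemma smooth_atI: "open S \<Longrightarrow> q \<in> S \<Longrightarrow> smooth_on S f \<Longrightarrow> smooth_at q f"
  unfolding smooth_at_def by blast

lemma smooth_at_binary:
  assumes "smooth_at q f" "smooth_at q g"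
    and "\<And>S. open S \<Longrightarrow> smooth_on S f \<Longrightarrow> smooth_on S g \<Longrightarrow> smooth_on S h"
  shows "smooth_at q h"
proof -
  obtain S T where "open S" "q \<in> S" "smooth_on S f" "open T" "q \<in> T" "smooth_on T g"
    using assms(1,2) unfolding smooth_at_def by blast
  then show ?thesis
    by (intro smooth_atI[of "S \<inter> T"] assms(3)) (auto intro: smooth_on_subset)
qed

lemma smooth_at_const: "smooth_at q (\<lambda>x. c)"
  by (rule smooth_atI[of UNIV]) (simp_all add: smooth_on_const)

lemma smooth_at_add: "smooth_at q f \<Longrightarrow> smooth_at q g \<Longrightarrow> smooth_at q (\<lambda>x. f x + g x)"
  by (erule (1) smooth_at_binary) (rule smooth_on_add)

lemma smooth_at_mult: "smooth_at q f \<Longrightarrow> smooth_at q g \<Longrightarrow> smooth_at q (\<lambda>x. f x * g x)"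
  by (erule (1) smooth_at_binary) (rule smooth_on_mult)

lemma smooth_at_minus: "smooth_at q f \<Longrightarrow> smooth_at q (\<lambda>x. - f x)"
  unfolding smooth_at_def using smooth_on_minus by blast

lemma smooth_at_partial: "smooth_at q f \<Longrightarrow> smooth_at q (partial i f)"
  unfolding smooth_at_def using smooth_on_partial by blast

lemma smooth_at_inverse:
  assumes "smooth_at q f" "f q \<noteq> 0"
  shows "smooth_at q (\<lambda>x. inverse (f x))"
proof -
  obtain S where S: "open S" "q \<in> S" "smooth_on S f"
    using assms(1) unfolding smooth_at_def by blast
  let ?S = "S \<inter> f -` (- {0})"
  have "open ?S"
    using continuous_open_preimage[OF smooth_on_continuous[OF S(3)] S(1), of "- {0}"] by (simp add: open_Compl)
  then show ?thesis
    using S assms(2) by (intro smooth_atI[of ?S] smooth_on_inverse) (auto intro: smooth_on_subset)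
qed

lemma smooth_at_differentiable: "smooth_at q f \<Longrightarrow> f differentiable (at q)"
  unfolding smooth_at_def using smooth_on_differentiable by blast

lemma smooth_at_eventually: "smooth_at q f \<Longrightarrow> eventually (\<lambda>x. smooth_at x f) (nhds q)"
  unfolding smooth_at_def eventually_nhds by blast

text \<open>All germs are taken at the origin, which makes them a single type;
  \<open>germ_at\<close> translates another base point there. The relation is reflexive only on
  functions smooth near 0, whence the partial quotient.\<close>

definition germ_eq :: "(real^2 \<Rightarrow> real) \<Rightarrow> (real^2 \<Rightarrow> real) \<Rightarrow> bool" where
  "germ_eq f g \<longleftrightarrow> smooth_at 0 f \<and> smooth_at 0 g \<and> eventually (\<lambda>x. f x = g x) (nhds 0)"

quotient_type germ = "real^2 \<Rightarrow> real" / partial: germ_eq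
proof (rule part_equivpI)
  show "\<exists>f. germ_eq f f"
    using smooth_at_const by (auto simp: germ_eq_def)
  show "symp germ_eq"
    by (rule sympI) (simp add: germ_eq_def eq_commute)
  show "transp germ_eq"
  proof (rule transpI)
    fix f g h
    assume "germ_eq f g" "germ_eq g h"
    then show "germ_eq f h"
      unfolding germ_eq_def using eventually_elim2[of "\<lambda>x. f x = g x" "nhds 0" "\<lambda>x. g x = h x"] by auto
  qed
qed

lemma germ_eq_partial: "germ_eq f g \<Longrightarrow> germ_eq (partial i f) (partial i g)"
proof -
  assume a: "germ_eq f g"
  then obtain S where S: "open S" "0 \<in> S" "\<And>x. x \<in> S \<Longrightarrow> f x = g x"
    unfolding germ_eq_def eventually_nhds by blast
  have "eventually (\<lambda>x. partial i f x = partial i g x) (nhds 0)"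
    unfolding eventually_nhds using S partial_cong[of S _ f g i] by blast
  with a show ?thesis
    by (auto simp: germ_eq_def smooth_at_partial)
qed

instantiation germ :: comm_ring_1
begin

lift_definition zero_germ :: germ is "\<lambda>x. 0"
  by (simp add: germ_eq_def smooth_at_const)
lift_definition one_germ :: germ is "\<lambda>x. 1"
  by (simp add: germ_eq_def smooth_at_const)
lift_definition plus_germ :: "germ \<Rightarrow> germ \<Rightarrow> germ" is "\<lambda>f g x. f x + g x"
  unfolding germ_eq_def
  by (intro conjI smooth_at_add; (elim conjE)?; assumption?) (erule (1) eventually_elim2, simp)
lift_definition times_germ :: "germ \<Rightarrow> germ \<Rightarrow> germ" is "\<lambda>f g x. f x * g x"
  unfolding germ_eq_def
  by (intro conjI smooth_at_mult; (elim conjE)?; assumption?) (erule (1) eventually_elim2, simp)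
lift_definition uminus_germ :: "germ \<Rightarrow> germ" is "\<lambda>f x. - f x"
  unfolding germ_eq_def
  by (intro conjI smooth_at_minus; (elim conjE)?; assumption?) (erule eventually_mono, simp)
definition minus_germ :: "germ \<Rightarrow> germ \<Rightarrow> germ" where "minus_germ f g = f + - g"

instance
proof
  fix f g h :: germ
  show "f + g + h = f + (g + h)"
    by transfer (auto simp: germ_eq_def add.assoc intro!: smooth_at_add)
  show "f + g = g + f"
    by transfer (auto simp: germ_eq_def add.commute intro!: smooth_at_add)
  show "0 + f = f"
    by transfer (auto simp: germ_eq_def)
  show "- f + f = 0"
    by transfer (auto simp: germ_eq_def intro!: smooth_at_add smooth_at_minus smooth_at_const)
  show "f - g = f + - g"
    by (rule minus_germ_def)
  show "f * g * h = f * (g * h)"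
    by transfer (auto simp: germ_eq_def mult.assoc intro!: smooth_at_mult)
  show "f * g = g * f"
    by transfer (auto simp: germ_eq_def mult.commute intro!: smooth_at_mult)
  show "1 * f = f"
    by transfer (auto simp: germ_eq_def)
  show "(f + g) * h = f * h + g * h"
    by transfer (auto simp: germ_eq_def distrib_right intro!: smooth_at_add smooth_at_mult)
  show "(0::germ) \<noteq> 1"
    by transfer (auto simp: germ_eq_def)
qed

end

instantiation germ :: real_algebra_1
begin

lift_definition scaleR_germ :: "real \<Rightarrow> germ \<Rightarrow> germ" is "\<lambda>r f x. r * f x"
  unfolding germ_eq_def
  by (intro conjI smooth_at_mult smooth_at_const; (elim conjE)?; assumption?) (erule eventually_mono, simp)

instance
proof
  fix r s :: real and f g :: germ
  show "r *\<^sub>R (f + g) = r *\<^sub>R f + r *\<^sub>R g"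
    by (transfer fixing: r)
      (auto simp: germ_eq_def distrib_left intro!: smooth_at_add smooth_at_mult smooth_at_const)
  show "(r + s) *\<^sub>R f = r *\<^sub>R f + s *\<^sub>R f"
    by (transfer fixing: r s)
      (auto simp: germ_eq_def distrib_right intro!: smooth_at_add smooth_at_mult smooth_at_const)
  show "r *\<^sub>R s *\<^sub>R f = (r * s) *\<^sub>R f"
    by (transfer fixing: r s) (auto simp: germ_eq_def mult.assoc intro!: smooth_at_mult smooth_at_const)
  show "1 *\<^sub>R f = f"
    by transfer (auto simp: germ_eq_def)
  show "r *\<^sub>R f * g = r *\<^sub>R (f * g)"
    by (transfer fixing: r) (auto simp: germ_eq_def mult.assoc intro!: smooth_at_mult smooth_at_const)
  show "f * r *\<^sub>R g = r *\<^sub>R (f * g)"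
    by (transfer fixing: r) (auto simp: germ_eq_def mult_ac intro!: smooth_at_mult smooth_at_const)
qed

end

lift_definition germ_partial :: "2 \<Rightarrow> germ \<Rightarrow> germ" is partial
  by (rule germ_eq_partial)

lift_definition germ_value :: "germ \<Rightarrow> real" is "\<lambda>f. f 0"
  by (auto simp: germ_eq_def dest: eventually_nhds_x_imp_x)

lemma derivation_germ_partial: "derivation (germ_partial i)"
  unfolding derivation_def
proof (intro conjI allI)
  have diff: "eventually (\<lambda>x. f differentiable (at x)) (nhds 0)" if "smooth_at 0 f" for f
    using smooth_at_eventually[OF that] by (rule eventually_mono) (rule smooth_at_differentiable)
  fix x y :: germ
  show "germ_partial i (x + y) = germ_partial i x + germ_partial i y"
  proof (transfer fixing: i)
    fix f g assume "germ_eq f f" "germ_eq g g"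
    then have f: "smooth_at 0 f" and g: "smooth_at 0 g" by (auto simp: germ_eq_def)
    have "eventually (\<lambda>x. partial i (\<lambda>x. f x + g x) x = partial i f x + partial i g x) (nhds 0)"
      using diff[OF f] diff[OF g] by eventually_elim (rule partial_add)
    then show "germ_eq (partial i (\<lambda>x. f x + g x)) (\<lambda>x. partial i f x + partial i g x)"
      using f g by (auto simp: germ_eq_def intro!: smooth_at_add smooth_at_partial)
  qed
  show "germ_partial i (x * y) = germ_partial i x * y + x * germ_partial i y"
  proof (transfer fixing: i)
    fix f g assume "germ_eq f f" "germ_eq g g"
    then have f: "smooth_at 0 f" and g: "smooth_at 0 g" by (auto simp: germ_eq_def)
    have "eventually (\<lambda>x. partial i (\<lambda>x. f x * g x) x = partial i f x * g x + f x * partial i g x) (nhds 0)"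
      using diff[OF f] diff[OF g] by eventually_elim (rule partial_mult)
    then show "germ_eq (partial i (\<lambda>x. f x * g x)) (\<lambda>x. partial i f x * g x + f x * partial i g x)"
      using f g by (auto simp: germ_eq_def intro!: smooth_at_add smooth_at_mult smooth_at_partial)
  qed
qed

lemma germ_partial_commute: "germ_partial i (germ_partial j x) = germ_partial j (germ_partial i x)"
proof (transfer fixing: i j)
  fix f assume "germ_eq f f"
  then have f: "smooth_at 0 f" by (simp add: germ_eq_def)
  have "eventually (\<lambda>x. partial i (partial j f) x = partial j (partial i f) x) (nhds 0)"
    using smooth_at_eventually[OF f]
    by (rule eventually_mono) (use partial_commute in \<open>auto simp: smooth_at_def\<close>)
  then show "germ_eq (partial i (partial j f)) (partial j (partial i f))"
    using f by (auto simp: germ_eq_def intro!: smooth_at_partial)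
qed

text \<open>By continuity a function that is nonzero at the base point is nonzero nearby, so its
  reciprocal has a smooth germ. All units of the algebraic part come from here.\<close>

lemma germ_inverse_exists:
  assumes "germ_value x \<noteq> 0"
  shows "\<exists>y. x * y = 1"
  using assms
proof transfer
  fix f assume "germ_eq f f" and nz: "f 0 \<noteq> 0"
  then have f: "smooth_at 0 f" by (simp add: germ_eq_def)
  have "isCont f 0"
    using smooth_at_differentiable[OF f] by (simp add: differentiable_imp_continuous_within)
  then have "eventually (\<lambda>x. f x \<noteq> 0) (nhds 0)"
    unfolding isCont_def eventually_nhds_conv_at using nz tendsto_imp_eventually_ne by blast
  then have "eventually (\<lambda>x. f x * inverse (f x) = 1) (nhds 0)"
    by (rule eventually_mono) simp
  then show "\<exists>y\<in>{g. germ_eq g g}. germ_eq (\<lambda>x. f x * y x) (\<lambda>x. 1)"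
    using f smooth_at_inverse[OF f nz]
    by (intro bexI[of _ "\<lambda>x. inverse (f x)"]) (simp_all add: germ_eq_def smooth_at_mult smooth_at_const)
qed

lemma germ_value_add: "germ_value (x + y) = germ_value x + germ_value y"
  and germ_value_mult: "germ_value (x * y) = germ_value x * germ_value y"
  and germ_value_minus: "germ_value (- x) = - germ_value x"
  and germ_value_0: "germ_value 0 = 0"
  and germ_value_1: "germ_value 1 = 1"
  by (transfer; simp)+

lemma germ_value_of_nat: "germ_value (of_nat n) = of_nat n"
  by (induction n) (simp_all add: germ_value_0 germ_value_1 germ_value_add)

lemma germ_value_of_int: "germ_value (of_int z) = of_int z"
  by (cases z rule: int_cases2) (simp_all add: germ_value_of_nat germ_value_minus)

lemma germ_value_sum: "germ_value (sum f I) = (\<Sum>i\<in>I. germ_value (f i))"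
  by (induction I rule: infinite_finite_induct) (simp_all add: germ_value_0 germ_value_add)

lemma germ_value_prod: "germ_value (prod f I) = (\<Prod>i\<in>I. germ_value (f i))"
  by (induction I rule: infinite_finite_induct) (simp_all add: germ_value_1 germ_value_mult)

lemma germ_value_power: "germ_value (x ^ n) = germ_value x ^ n"
  by (induction n) (simp_all add: germ_value_1 germ_value_mult)

lemma germ_value_det: "germ_value (det A) = det (\<chi> i j. germ_value (A $ i $ j))"
  by (simp add: det_def germ_value_sum germ_value_mult germ_value_prod germ_value_of_int)

subsection \<open>The germ of a function at a point\<close>

definition germ_at :: "real^2 \<Rightarrow> (real^2 \<Rightarrow> real) \<Rightarrow> germ" where
  "germ_at q f = abs_germ (\<lambda>z. f (q + z))"

lemma open_shift: "open S \<Longrightarrow> open ((\<lambda>z. q + z) -` S)" for q :: "'a::real_normed_vector"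
  by (intro open_vimage continuous_intros)

lemma smooth_at_shift:
  assumes "smooth_at q f"
  shows "smooth_at 0 (\<lambda>z. f (q + z))"
proof -
  obtain S where S: "open S" "q \<in> S" "smooth_on S f"
    using assms unfolding smooth_at_def by blast
  have T: "open ((\<lambda>z. q + z) -` S)"
    by (rule open_shift) (rule S(1))
  have "higher_differentiable_on T (\<lambda>z. q + z) n" if "open T" for T n
  proof (cases n)
    case (Suc m)
    have "frechet_derivative (\<lambda>z. q + z) (at x) v = v" for x v
    proof -
      have "((\<lambda>z. q + z) has_derivative (\<lambda>v. v)) (at x)"
        by (auto intro!: derivative_eq_intros)
      from frechet_derivative_at[OF this, symmetric] show ?thesis by simp
    qed
    moreover have "(\<lambda>z. q + z) differentiable (at x)" for x :: "real^2"
      by simp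
    ultimately show ?thesis
      using Suc by (simp add: higher_differentiable_on_const[OF that])
  qed (simp, intro continuous_intros)
  then have "smooth_on ((\<lambda>z. q + z) -` S) (\<lambda>z. q + z)"
    using T by (simp add: smooth_on_def)
  then show ?thesis
    using S(2) by (intro smooth_atI[OF T] smooth_on_compose[OF T _ S(3)]) simp_all
qed

lemma abs_germ_cong: "germ_eq f g \<Longrightarrow> abs_germ f = abs_germ g"
  using Quotient3_germ by (rule Quotient3_rel_abs)

lemma germ_at_cong:
  assumes "smooth_at q f" "open S" "q \<in> S" "\<And>x. x \<in> S \<Longrightarrow> f x = g x"
  shows "germ_at q f = germ_at q g"
proof -
  obtain S' where S': "open S'" "q \<in> S'" "smooth_on S' f"
    using assms(1) unfolding smooth_at_def by blast
  have "smooth_on (S \<inter> S') g"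
    using smooth_on_cong[of "S \<inter> S'" f g] S' assms smooth_on_subset[OF S'(3), of "S \<inter> S'"] by auto
  then have "smooth_at q g"
    using S' assms by (auto intro!: smooth_atI[of "S \<inter> S'"])
  moreover have "eventually (\<lambda>z. f (q + z) = g (q + z)) (nhds 0)"
    unfolding eventually_nhds
    using assms by (intro exI[of _ "(\<lambda>z. q + z) -` S"]) (auto intro!: open_shift)
  ultimately show ?thesis
    unfolding germ_at_def using assms(1)
    by (intro abs_germ_cong) (simp add: germ_eq_def smooth_at_shift)
qed

lemma germ_eq_refl: "smooth_at q f \<Longrightarrow> germ_eq (\<lambda>z. f (q + z)) (\<lambda>z. f (q + z))"
  by (simp add: germ_eq_def smooth_at_shift)

lemma germ_at_add: "smooth_at q f \<Longrightarrow> smooth_at q g \<Longrightarrow> germ_at q (\<lambda>x. f x + g x) = germ_at q f + germ_at q g"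
  by (simp add: germ_at_def plus_germ.abs_eq germ_eq_refl)

lemma germ_at_mult: "smooth_at q f \<Longrightarrow> smooth_at q g \<Longrightarrow> germ_at q (\<lambda>x. f x * g x) = germ_at q f * germ_at q g"
  by (simp add: germ_at_def times_germ.abs_eq germ_eq_refl)

lemma germ_at_const: "germ_at q (\<lambda>x. c) = c *\<^sub>R 1"
  by (simp add: germ_at_def one_germ_def scaleR_germ.abs_eq germ_eq_def smooth_at_const)

lemma germ_value_scaleR: "germ_value (r *\<^sub>R x) = r * germ_value x"
  by (transfer fixing: r) simp

lemma germ_value_at: "smooth_at q f \<Longrightarrow> germ_value (germ_at q f) = f q"
  by (simp add: germ_at_def germ_value.abs_eq germ_eq_refl)

lemma germ_at_partial:
  assumes "smooth_at q f"
  shows "germ_at q (partial i f) = germ_partial i (germ_at q f)"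
proof -
  have *: "partial i f (q + z) = partial i (\<lambda>z. f (q + z)) z" if "f differentiable (at (q + z))" for z
  proof -
    have "((\<lambda>z. q + z) has_derivative (\<lambda>v. v)) (at z)"
      by (auto intro!: derivative_eq_intros)
    from diff_chain_at[OF this that[unfolded frechet_derivative_works]]
    have "((\<lambda>z. f (q + z)) has_derivative frechet_derivative f (at (q + z))) (at z)"
      by (simp add: o_def)
    from frechet_derivative_at[OF this, symmetric] show ?thesis
      by (simp add: partial_def)
  qed
  have "eventually (\<lambda>z. f differentiable (at (q + z))) (nhds 0)"
  proof -
    obtain S where S: "open S" "q \<in> S" "smooth_on S f"
      using assms unfolding smooth_at_def by blast
    then show ?thesis
      unfolding eventually_nhds using smooth_on_differentiable[OF S(3)]
      by (intro exI[of _ "(\<lambda>z. q + z) -` S"]) (auto intro!: open_shift)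
  qed
  from this and * have "eventually (\<lambda>z. partial i f (q + z) = partial i (\<lambda>z. f (q + z)) z) (nhds 0)"
    by (rule eventually_mono)
  then have "germ_eq (\<lambda>z. partial i f (q + z)) (partial i (\<lambda>z. f (q + z)))"
    using assms by (simp add: germ_eq_def smooth_at_shift smooth_at_partial)
  then show ?thesis
    using assms by (simp add: germ_at_def germ_partial.abs_eq germ_eq_refl abs_germ_cong)
qed

section \<open>Comparison of the rescaled matrix of germs with the given one\<close>

section \<open>From germs back to the matrix of the invariant\<close>

lemma numeral_mult_scaleR:
  fixes x :: germ
  shows "numeral n * x = numeral n *\<^sub>R x" "x * numeral n = numeral n *\<^sub>R x"
  by (simp_all add: scaleR_conv_of_real mult.commute)

lemma numeral_scaleR_1: "numeral n *\<^sub>R (1::germ) = numeral n"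
  by (simp add: scaleR_conv_of_real)

text \<open>Integers are killed by every derivation, but real constants need not be.\<close>

lemma derivation_scaleR:
  fixes d :: "'r::{comm_ring_1, real_algebra_1} \<Rightarrow> 'r"
  assumes "derivation d" "\<And>r. d (of_real r) = 0"
  shows "d (r *\<^sub>R x) = r *\<^sub>R d x"
  using derivation_mult[OF assms(1), of "of_real r" x] by (simp add: assms(2) scaleR_conv_of_real)

lemma differentiable_vec:
  fixes F :: "real^2 \<Rightarrow> real^'n"
  assumes "\<And>j. (\<lambda>x. F x $ j) differentiable (at p)"
  shows "F differentiable (at p)"
  by (subst differentiable_componentwise_within) (use assms in \<open>auto simp: Basis_vec_def inner_axis\<close>)

text \<open>The factors by which the columns and rows of \<^const>\<open>cubic.M\<close> differ from those of
  \<^const>\<open>\<M>\<close>: the fifth row of \<^const>\<open>cubic.M\<close> lacks the factor $1/2$ of the symmetrisation.\<close>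

definition col_scale :: "6 \<Rightarrow> real" where
  "col_scale j = vector [1, 1, 1, 2, 2, 2] $ j"

definition row_scale :: "6 \<Rightarrow> real" where
  "row_scale j = vector [1, 1, 1, 1, 2, 1] $ j"

text \<open>\<open>T\<close> stands for two maps from functions to germs: the germ at a point, with
  the partial derivatives, and the pullback along a change of coordinates, with the derivations
  \<open>E1\<close>, \<open>E2\<close> of the old coordinates. The matrix is thus carried over to
  the ring once for both.\<close>

locale germ_evaluation =
  fixes T :: "(real^2 \<Rightarrow> real) \<Rightarrow> germ" and E1 E2 :: "germ \<Rightarrow> germ" and U p
  assumes U: "open U" and p: "p \<in> U"
    and derivation_E1: "derivation E1" and derivation_E2: "derivation E2"
    and T_add: "smooth_on U f \<Longrightarrow> smooth_on U g \<Longrightarrow> T (\<lambda>x. f x + g x) = T f + T g"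
    and T_mult: "smooth_on U f \<Longrightarrow> smooth_on U g \<Longrightarrow> T (\<lambda>x. f x * g x) = T f * T g"
    and T_const: "T (\<lambda>x. c) = c *\<^sub>R 1"
    and T_partial: "smooth_on U f \<Longrightarrow> T (partial 1 f) = E1 (T f)"
      "smooth_on U f \<Longrightarrow> T (partial 2 f) = E2 (T f)"
    and T_cong: "smooth_on U f \<Longrightarrow> (\<And>x. x \<in> U \<Longrightarrow> f x = g x) \<Longrightarrow> T f = T g"
    and T_value: "smooth_on U f \<Longrightarrow> germ_value (T f) = f p"
begin

lemmas smooth_intros = smooth_on_const[OF U] smooth_on_add[OF U] smooth_on_mult[OF U]
  smooth_on_minus[OF U] smooth_on_diff[OF U] smooth_on_power2[OF U] smooth_on_partial

lemma T_minus: "smooth_on U f \<Longrightarrow> T (\<lambda>x. - f x) = - T f"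
  using T_mult[of "\<lambda>_. - 1" f] smooth_on_const[OF U, of "- 1"] by (simp add: T_const)

lemma T_diff: "smooth_on U f \<Longrightarrow> smooth_on U g \<Longrightarrow> T (\<lambda>x. f x - g x) = T f - T g"
  using T_add[of f "\<lambda>x. - g x"] T_minus[of g] smooth_on_minus[OF U, of g] by simp

lemma T_power2: "smooth_on U f \<Longrightarrow> T (\<lambda>x. (f x)\<^sup>2) = T f * T f"
  unfolding power2_eq_square by (rule T_mult)

lemma T_sum:
  assumes "finite I" "\<And>i. i \<in> I \<Longrightarrow> smooth_on U (f i)"
  shows "T (\<lambda>x. \<Sum>i\<in>I. f i x) = (\<Sum>i\<in>I. T (f i))"
  using assms by (induction I rule: finite_induct) (simp_all add: T_add T_const smooth_on_sum[OF U])

lemma E_scaleR: "E1 (r *\<^sub>R x) = r *\<^sub>R E1 x" "E2 (r *\<^sub>R x) = r *\<^sub>R E2 x"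
proof -
  have 0: "partial i (\<lambda>x. r) = (\<lambda>x. 0)" for i and r :: real
    by (simp add: fun_eq_iff partial_const)
  have "E1 (of_real r) = 0" "E2 (of_real r) = 0" for r
    using T_partial[of "\<lambda>_. r"] smooth_on_const[OF U, of r] T_const[of 0]
    unfolding 0 by (simp_all add: T_const of_real_def)
  then show "E1 (r *\<^sub>R x) = r *\<^sub>R E1 x" "E2 (r *\<^sub>R x) = r *\<^sub>R E2 x"
    by (simp_all add: derivation_scaleR[OF derivation_E1] derivation_scaleR[OF derivation_E2])
qed

lemmas T_simps = T_add T_mult T_minus T_diff T_power2 T_const T_partial

context
  fixes \<Gamma> :: christoffel and B1 B2 :: germ
  assumes \<Gamma>: "\<And>k i j. smooth_on U (\<Gamma> k i j)"
    and B1: "T (A1 \<Gamma>) = 3 *\<^sub>R B1" and B2: "T (A2 \<Gamma>) = 3 *\<^sub>R B2"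
begin

interpretation ring: cubic E1 E2 "T (A0 \<Gamma>)" B1 B2 "T (A3 \<Gamma>)" .

lemma smooth_A:
  "smooth_on U (A0 \<Gamma>)" "smooth_on U (A1 \<Gamma>)" "smooth_on U (A2 \<Gamma>)" "smooth_on U (A3 \<Gamma>)"
  unfolding A0_def[abs_def] A1_def[abs_def] A2_def[abs_def] A3_def[abs_def]
  by (intro smooth_intros \<Gamma>)+

lemma smooth_L: "smooth_on U (L1 \<Gamma>)" "smooth_on U (L2 \<Gamma>)"
  unfolding L1_def[abs_def] L2_def[abs_def] by (intro smooth_intros smooth_A)+

lemmas T_A_simps = T_simps B1 B2 smooth_A smooth_L smooth_intros

lemmas ring_simps = E_scaleR numeral_scaleR_1 numeral_mult_scaleR
  derivation_simps[OF derivation_E1] derivation_simps[OF derivation_E2]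

lemma T_L: "T (L1 \<Gamma>) = ring.L1" "T (L2 \<Gamma>) = ring.L2"
  unfolding L1_def[abs_def] L2_def[abs_def] ring.L1_def ring.L2_def
  by (simp_all only: T_A_simps) (simp_all add: ring_simps algebra_simps)

lemma smooth_coeffs:
  "smooth_on U (a41 \<Gamma>)" "smooth_on U (a42 \<Gamma>)" "smooth_on U (a43 \<Gamma>)" "smooth_on U (a61 \<Gamma>)"
  "smooth_on U (a62 \<Gamma>)" "smooth_on U (a63 \<Gamma>)" "smooth_on U (a64 \<Gamma>)" "smooth_on U (a65 \<Gamma>)"
  "smooth_on U (b51 \<Gamma>)" "smooth_on U (b52 \<Gamma>)" "smooth_on U (b53 \<Gamma>)" "smooth_on U (b61 \<Gamma>)"
  "smooth_on U (b62 \<Gamma>)" "smooth_on U (b63 \<Gamma>)" "smooth_on U (b64 \<Gamma>)" "smooth_on U (b65 \<Gamma>)"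
  unfolding a41_def[abs_def] a42_def[abs_def] a43_def[abs_def] a61_def[abs_def] a62_def[abs_def]
    a63_def[abs_def] a64_def[abs_def] a65_def[abs_def] b51_def[abs_def] b52_def[abs_def]
    b53_def[abs_def] b61_def[abs_def] b62_def[abs_def] b63_def[abs_def] b64_def[abs_def] b65_def[abs_def]
  by (intro smooth_intros smooth_A)+

lemma T_coeffs:
  "T (a41 \<Gamma>) = 2 *\<^sub>R ring.a41" "T (a42 \<Gamma>) = 2 *\<^sub>R ring.a42" "T (a43 \<Gamma>) = 2 *\<^sub>R ring.a43"
  "T (a61 \<Gamma>) = 2 *\<^sub>R ring.a61" "T (a62 \<Gamma>) = 2 *\<^sub>R ring.a62" "T (a63 \<Gamma>) = 2 *\<^sub>R ring.a63"
  "T (a64 \<Gamma>) = ring.a64" "T (a65 \<Gamma>) = ring.a65"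
  "T (b51 \<Gamma>) = 2 *\<^sub>R ring.b51" "T (b52 \<Gamma>) = 2 *\<^sub>R ring.b52" "T (b53 \<Gamma>) = 2 *\<^sub>R ring.b53"
  "T (b61 \<Gamma>) = 2 *\<^sub>R ring.b61" "T (b62 \<Gamma>) = 2 *\<^sub>R ring.b62" "T (b63 \<Gamma>) = 2 *\<^sub>R ring.b63"
  "T (b64 \<Gamma>) = ring.b64" "T (b65 \<Gamma>) = ring.b65"
  unfolding a41_def[abs_def] a42_def[abs_def] a43_def[abs_def] a61_def[abs_def] a62_def[abs_def]
    a63_def[abs_def] a64_def[abs_def] a65_def[abs_def] b51_def[abs_def] b52_def[abs_def]
    b53_def[abs_def] b61_def[abs_def] b62_def[abs_def] b63_def[abs_def] b64_def[abs_def] b65_def[abs_def]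
    ring.coeff_defs
  by (simp_all only: T_A_simps) (simp_all add: ring_simps algebra_simps)

definition smooth_vec :: "(real^2 \<Rightarrow> real^6) \<Rightarrow> bool" where
  "smooth_vec F \<longleftrightarrow> (\<forall>j. smooth_on U (\<lambda>p. F p $ j))"

definition T_vec :: "(real^2 \<Rightarrow> real^6) \<Rightarrow> germ^6" where
  "T_vec F = (\<chi> j. col_scale j *\<^sub>R T (\<lambda>p. F p $ j))"

lemma smooth_V: "smooth_vec (V \<Gamma>)"
  unfolding smooth_vec_def forall_6 V_def vector_6
  by (intro conjI smooth_intros smooth_A smooth_L)

lemma T_V: "T_vec (V \<Gamma>) = ring.V"
  unfolding T_vec_def vec_eq_iff forall_6 V_def vector_6 ring.V_def vec_lambda_beta
  by (intro conjI; simp only: T_A_simps T_L)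
    (simp_all add: col_scale_def ring_simps algebra_simps)

lemma smooth_Omega: "smooth_on U (\<lambda>p. \<Omega>1 \<Gamma> p $ i $ j)" "smooth_on U (\<lambda>p. \<Omega>2 \<Gamma> p $ i $ j)"
proof -
  have "\<forall>i j. smooth_on U (\<lambda>p. \<Omega>1 \<Gamma> p $ i $ j)"
    unfolding forall_6 \<Omega>1_def vector_6 by (intro conjI smooth_intros smooth_A smooth_coeffs)
  moreover have "\<forall>i j. smooth_on U (\<lambda>p. \<Omega>2 \<Gamma> p $ i $ j)"
    unfolding forall_6 \<Omega>2_def vector_6 by (intro conjI smooth_intros smooth_A smooth_coeffs)
  ultimately show "smooth_on U (\<lambda>p. \<Omega>1 \<Gamma> p $ i $ j)" "smooth_on U (\<lambda>p. \<Omega>2 \<Gamma> p $ i $ j)"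
    by blast+
qed

text \<open>Conjugation by the diagonal matrix of \<open>col_scale\<close>, written without
  division.\<close>

lemma T_Omega:
  "col_scale j *\<^sub>R T (\<lambda>p. \<Omega>1 \<Gamma> p $ i $ j) = col_scale i *\<^sub>R ring.\<Omega>1 $ i $ j"
  "col_scale j *\<^sub>R T (\<lambda>p. \<Omega>2 \<Gamma> p $ i $ j) = col_scale i *\<^sub>R ring.\<Omega>2 $ i $ j"
proof -
  have "\<forall>i j. col_scale j *\<^sub>R T (\<lambda>p. \<Omega>1 \<Gamma> p $ i $ j) = col_scale i *\<^sub>R ring.\<Omega>1 $ i $ j"
    unfolding forall_6 \<Omega>1_def vector_6 ring.\<Omega>1_def
    by (intro conjI; simp only: T_A_simps T_coeffs)
      (simp_all add: col_scale_def ring_simps algebra_simps)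
  moreover have "\<forall>i j. col_scale j *\<^sub>R T (\<lambda>p. \<Omega>2 \<Gamma> p $ i $ j) = col_scale i *\<^sub>R ring.\<Omega>2 $ i $ j"
    unfolding forall_6 \<Omega>2_def vector_6 ring.\<Omega>2_def
    by (intro conjI; simp only: T_A_simps T_coeffs)
      (simp_all add: col_scale_def ring_simps algebra_simps)
  ultimately show
    "col_scale j *\<^sub>R T (\<lambda>p. \<Omega>1 \<Gamma> p $ i $ j) = col_scale i *\<^sub>R ring.\<Omega>1 $ i $ j"
    "col_scale j *\<^sub>R T (\<lambda>p. \<Omega>2 \<Gamma> p $ i $ j) = col_scale i *\<^sub>R ring.\<Omega>2 $ i $ j"
    by blast+
qed

lemma T_covariant_derivative:
  assumes F: "smooth_vec F"
    and \<Omega>: "\<And>i j. smooth_on U (\<lambda>p. \<Omega> p $ i $ j)"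
      "\<And>i j. col_scale j *\<^sub>R T (\<lambda>p. \<Omega> p $ i $ j) = col_scale i *\<^sub>R \<Omega>' $ i $ j"
    and E: "\<And>r x. E (r *\<^sub>R x) = r *\<^sub>R E x" "\<And>f. smooth_on U f \<Longrightarrow> T (partial b f) = E (T f)"
    and DF: "\<And>p. DF p = partial b F p - F p v* \<Omega> p"
  shows "smooth_vec DF" "T_vec DF = (\<chi> j. E (T_vec F $ j)) - T_vec F v* \<Omega>'"
proof -
  have F': "smooth_on U (\<lambda>p. F p $ j)" for j
    using F by (simp add: smooth_vec_def)
  \<comment> \<open>\<open>DF\<close> differentiates the vector-valued F, while \<open>T\<close>
    acts on scalar functions. The componentwise expression agrees with it on U, where F is
    differentiable, and \<open>T_cong\<close> asks for no more.\<close>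
  define g where "g j p = partial b (\<lambda>p. F p $ j) p - (\<Sum>i\<in>UNIV. F p $ i * \<Omega> p $ i $ j)" for j p
  have sum: "smooth_on U (\<lambda>p. \<Sum>i\<in>UNIV. F p $ i * \<Omega> p $ i $ j)" for j
    by (intro smooth_on_sum smooth_intros U F' \<Omega>)
  have g: "smooth_on U (g j)" for j
    unfolding g_def[abs_def] by (intro smooth_intros sum F')
  have eq: "g j x = DF x $ j" if "x \<in> U" for j x
  proof -
    have "F differentiable (at x)"
      by (rule differentiable_vec) (rule smooth_on_differentiable[OF F' that])
    then show ?thesis
      by (simp add: g_def DF partial_vec_nth vector_matrix_mult_component)
  qed
  show "smooth_vec DF"
    unfolding smooth_vec_def using smooth_on_cong[OF U, of "g j" "\<lambda>p. DF p $ j" for j] eq g by blast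
  have "col_scale j *\<^sub>R T (\<lambda>p. DF p $ j)
      = E (col_scale j *\<^sub>R T (\<lambda>p. F p $ j)) - (\<Sum>i\<in>UNIV. col_scale i *\<^sub>R T (\<lambda>p. F p $ i) * \<Omega>' $ i $ j)" for j
  proof -
    have "T (\<lambda>p. DF p $ j) = T (g j)"
      using T_cong[OF g eq] by simp
    also have "\<dots> = E (T (\<lambda>p. F p $ j)) - (\<Sum>i\<in>UNIV. T (\<lambda>p. F p $ i) * T (\<lambda>p. \<Omega> p $ i $ j))"
      unfolding g_def[abs_def]
      by (subst T_diff, intro smooth_intros F', rule sum)
        (simp add: E(2)[OF F'] T_sum T_mult F' \<Omega>(1) smooth_intros)
    finally have "col_scale j *\<^sub>R T (\<lambda>p. DF p $ j) = col_scale j *\<^sub>R E (T (\<lambda>p. F p $ j))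
        - (\<Sum>i\<in>UNIV. T (\<lambda>p. F p $ i) * (col_scale j *\<^sub>R T (\<lambda>p. \<Omega> p $ i $ j)))"
      by (simp add: scaleR_right_diff_distrib scaleR_sum_right)
    then show ?thesis
      by (simp add: \<Omega>(2) E(1))
  qed
  then show "T_vec DF = (\<chi> j. E (T_vec F $ j)) - T_vec F v* \<Omega>'"
    by (simp add: vec_eq_iff T_vec_def vector_matrix_mult_component)
qed

lemma T_D1: "smooth_vec F \<Longrightarrow> smooth_vec (D1 \<Gamma> F)" "smooth_vec F \<Longrightarrow> T_vec (D1 \<Gamma> F) = ring.D1 (T_vec F)"
  unfolding ring.D1_def
  using T_covariant_derivative[where \<Omega> = "\<Omega>1 \<Gamma>" and \<Omega>' = "ring.\<Omega>1" and E = E1 and b = 1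
      and DF = "D1 \<Gamma> F"]
  by (simp_all add: smooth_Omega T_Omega E_scaleR T_partial D1_def)

lemma T_D2: "smooth_vec F \<Longrightarrow> smooth_vec (D2 \<Gamma> F)" "smooth_vec F \<Longrightarrow> T_vec (D2 \<Gamma> F) = ring.D2 (T_vec F)"
  unfolding ring.D2_def
  using T_covariant_derivative[where \<Omega> = "\<Omega>2 \<Gamma>" and \<Omega>' = "ring.\<Omega>2" and E = E2 and b = 2
      and DF = "D2 \<Gamma> F"]
  by (simp_all add: smooth_Omega T_Omega E_scaleR T_partial D2_def)

lemma T_M:
  "smooth_on U (\<lambda>p. \<M> \<Gamma> p $ i $ j)"
  "ring.M $ i $ j = (row_scale i * col_scale j) *\<^sub>R T (\<lambda>p. \<M> \<Gamma> p $ i $ j)"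
proof -
  note D = T_D1 T_D2 smooth_V T_V
  have smooth: "smooth_on U (\<lambda>p. F p $ j)" if "smooth_vec F" for F j
    using that by (simp add: smooth_vec_def)
  have T: "T_vec F $ j = col_scale j *\<^sub>R T (\<lambda>p. F p $ j)" for F j
    by (simp add: T_vec_def)
  have M_rows: "\<M> \<Gamma> p $ 1 = V \<Gamma> p" "\<M> \<Gamma> p $ 2 = D1 \<Gamma> (V \<Gamma>) p" "\<M> \<Gamma> p $ 3 = D2 \<Gamma> (V \<Gamma>) p"
    "\<M> \<Gamma> p $ 4 = D1 \<Gamma> (D1 \<Gamma> (V \<Gamma>)) p"
    "\<M> \<Gamma> p $ 5 = (1 / 2) *\<^sub>R (D1 \<Gamma> (D2 \<Gamma> (V \<Gamma>)) p + D2 \<Gamma> (D1 \<Gamma> (V \<Gamma>)) p)"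
    "\<M> \<Gamma> p $ 6 = D2 \<Gamma> (D2 \<Gamma> (V \<Gamma>)) p" for p
    by (simp_all add: \<M>_def)
  have "\<forall>i. smooth_on U (\<lambda>p. \<M> \<Gamma> p $ i $ j)" for j
    unfolding forall_6 M_rows vector_scaleR_component vector_add_component real_scaleR_def
    by (intro conjI smooth_intros smooth D)
  then show "smooth_on U (\<lambda>p. \<M> \<Gamma> p $ i $ j)" by blast
  have ring_D: "T_vec (D1 \<Gamma> (D1 \<Gamma> (V \<Gamma>))) = ring.D1 (ring.D1 ring.V)"
    "T_vec (D1 \<Gamma> (D2 \<Gamma> (V \<Gamma>))) = ring.D1 (ring.D2 ring.V)"
    "T_vec (D2 \<Gamma> (D1 \<Gamma> (V \<Gamma>))) = ring.D2 (ring.D1 ring.V)"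
    "T_vec (D2 \<Gamma> (D2 \<Gamma> (V \<Gamma>))) = ring.D2 (ring.D2 ring.V)"
    "T_vec (D1 \<Gamma> (V \<Gamma>)) = ring.D1 ring.V" "T_vec (D2 \<Gamma> (V \<Gamma>)) = ring.D2 ring.V"
    "T_vec (V \<Gamma>) = ring.V"
    by (simp_all add: D)
  note ring_Dj = T[of "V \<Gamma>", unfolded ring_D] T[of "D1 \<Gamma> (V \<Gamma>)", unfolded ring_D]
    T[of "D2 \<Gamma> (V \<Gamma>)", unfolded ring_D] T[of "D1 \<Gamma> (D1 \<Gamma> (V \<Gamma>))", unfolded ring_D]
    T[of "D1 \<Gamma> (D2 \<Gamma> (V \<Gamma>))", unfolded ring_D] T[of "D2 \<Gamma> (D1 \<Gamma> (V \<Gamma>))", unfolded ring_D]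
    T[of "D2 \<Gamma> (D2 \<Gamma> (V \<Gamma>))", unfolded ring_D]
  have half: "T (\<lambda>p. 1 / 2 * (F p $ j + G p $ j)) = (1 / 2) *\<^sub>R (T (\<lambda>p. F p $ j) + T (\<lambda>p. G p $ j))"
    if "smooth_vec F" "smooth_vec G" for F G j
    using that by (simp only: T_mult T_add T_const smooth smooth_intros) simp
  note half' = half[of "D1 \<Gamma> (D2 \<Gamma> (V \<Gamma>))" "D2 \<Gamma> (D1 \<Gamma> (V \<Gamma>))", OF T_D1(1)[OF T_D2(1)[OF smooth_V]] T_D2(1)[OF T_D1(1)[OF smooth_V]]]
  have "\<forall>i. ring.M $ i $ j = (row_scale i * col_scale j) *\<^sub>R T (\<lambda>p. \<M> \<Gamma> p $ i $ j)" for j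
    unfolding forall_6 M_rows vector_scaleR_component vector_add_component real_scaleR_def
      ring.M_def vector_6 half'
    by (simp add: ring_Dj row_scale_def scaleR_right_distrib)
  then show "ring.M $ i $ j = (row_scale i * col_scale j) *\<^sub>R T (\<lambda>p. \<M> \<Gamma> p $ i $ j)" by blast
qed

text \<open>16 is 2 for the doubled fifth row times 2^3 for the three doubled columns.\<close>

theorem germ_value_det_M: "germ_value (det ring.M) = 16 * det (\<M> \<Gamma> p)"
proof -
  have "germ_value (det ring.M) = det (\<chi> i j. row_scale i * (col_scale j * \<M> \<Gamma> p $ i $ j))"
    by (simp add: germ_value_det T_M germ_value_scaleR T_value mult.assoc)
  also have "\<dots> = det (\<chi> i. row_scale i *s (\<chi> i j. col_scale j * \<M> \<Gamma> p $ i $ j) $ i)"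
    by (simp add: vector_scalar_mult_def)
  also have "\<dots> = 2 * det (\<chi> i j. col_scale j * \<M> \<Gamma> p $ i $ j)"
    unfolding det_rows_mul by (simp add: prod_6 row_scale_def)
  also have "(\<chi> i j. col_scale j * \<M> \<Gamma> p $ i $ j) = transpose (\<chi> i. col_scale i *s transpose (\<M> \<Gamma> p) $ i)"
    by (simp add: transpose_def vec_eq_iff)
  also have "2 * det \<dots> = 16 * det (\<M> \<Gamma> p)"
    unfolding det_transpose det_rows_mul by (simp add: prod_6 col_scale_def)
  finally show ?thesis .
qed

end

end

section \<open>The transformation of the determinant at a single point\<close>

section \<open>The transformation law\<close>

lemma germ_value_diff: "germ_value (x - y) = germ_value x - germ_value y"
  unfolding minus_germ_def germ_value_add germ_value_minus by simp

lemma germ_evaluation_at: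
  assumes "open U" "q \<in> U"
  shows "germ_evaluation (germ_at q) (germ_partial 1) (germ_partial 2) U q"
proof
  have sm: "smooth_at q f" if "smooth_on U f" for f
    using assms that by (rule smooth_atI)
  show "germ_at q f = germ_at q g" if "smooth_on U f" "\<And>x. x \<in> U \<Longrightarrow> f x = g x" for f g
    using germ_at_cong[OF sm[OF that(1)] assms that(2)] .
  show "germ_value (germ_at q f) = f q" if "smooth_on U f" for f
    by (rule germ_value_at) (rule sm[OF that])
  show "germ_at q (\<lambda>x. f x + g x) = germ_at q f + germ_at q g"
    "germ_at q (\<lambda>x. f x * g x) = germ_at q f * germ_at q g" if "smooth_on U f" "smooth_on U g" for f g
    by (simp_all add: germ_at_add germ_at_mult sm that)
  show "germ_at q (partial 1 f) = germ_partial 1 (germ_at q f)"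
    "germ_at q (partial 2 f) = germ_partial 2 (germ_at q f)" if "smooth_on U f" for f
    by (simp_all add: germ_at_partial sm that)
qed (use assms in \<open>simp_all add: derivation_germ_partial germ_at_const\<close>)

text \<open>\<sigma> expresses the old coordinates (x,y) in U by the new ones (u,v) in W. Germs are
  taken at q in the new coordinates.\<close>

locale coordinate_germs =
  fixes \<sigma> :: "real^2 \<Rightarrow> real^2" and W U :: "(real^2) set" and q :: "real^2"
  assumes W: "open W" and q: "q \<in> W" and \<sigma>: "smooth_on W \<sigma>"
    and U: "open U" and \<sigma>_U: "\<And>x. x \<in> W \<Longrightarrow> \<sigma> x \<in> U"
    and jacobian: "partial 1 \<sigma> q $ 1 * partial 2 \<sigma> q $ 2 - partial 2 \<sigma> q $ 1 * partial 1 \<sigma> q $ 2 \<noteq> 0"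
begin

definition J :: "2 \<Rightarrow> 2 \<Rightarrow> germ" where "J i r = germ_at q (\<lambda>x. partial i \<sigma> x $ r)"

lemma smooth_at_W: "smooth_on W f \<Longrightarrow> smooth_at q f"
  using W q by (rule smooth_atI)

lemma smooth_J: "smooth_on W (\<lambda>x. partial i \<sigma> x $ r)"
  by (intro smooth_on_vec_nth W smooth_on_partial \<sigma>)

lemma smooth_J2: "smooth_on W (\<lambda>x. partial i (partial j \<sigma>) x $ r)"
  by (intro smooth_on_vec_nth W smooth_on_partial \<sigma>)

lemma J_eq: "J i r = germ_partial i (germ_at q (\<lambda>x. \<sigma> x $ r))"
proof -
  have "J i r = germ_at q (partial i (\<lambda>x. \<sigma> x $ r))"
    unfolding J_def
    by (rule germ_at_cong[OF smooth_at_W[OF smooth_J] W q])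
      (simp add: partial_vec_nth smooth_on_differentiable[OF \<sigma>])
  also have "\<dots> = germ_partial i (germ_at q (\<lambda>x. \<sigma> x $ r))"
    by (intro germ_at_partial smooth_at_W smooth_on_vec_nth W \<sigma>)
  finally show ?thesis .
qed

lemma germ_partial_J: "germ_partial i (J j r) = germ_at q (\<lambda>x. partial i (partial j \<sigma>) x $ r)"
proof -
  have "germ_partial i (J j r) = germ_at q (partial i (\<lambda>x. partial j \<sigma> x $ r))"
    unfolding J_def by (intro germ_at_partial[symmetric] smooth_at_W smooth_J)
  also have "\<dots> = germ_at q (\<lambda>x. partial i (partial j \<sigma>) x $ r)"
    by (rule germ_at_cong[OF _ W q])
      (auto simp: partial_vec_nth smooth_on_differentiable[OF smooth_on_partial[OF \<sigma>]]
        intro: smooth_at_W smooth_on_partial smooth_J)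
  finally show ?thesis .
qed

lemma J_sym: "germ_partial i (J j r) = germ_partial j (J i r)"
  by (simp add: J_eq germ_partial_commute)

lemma value_J: "germ_value (J i r) = partial i \<sigma> q $ r"
  unfolding J_def by (intro germ_value_at smooth_at_W smooth_J)

text \<open>A choice, because the locale takes the inverse as a parameter; one exists since the
  Jacobian determinant is nonzero at q.\<close>

definition \<delta>_inverse :: germ where
  "\<delta>_inverse = (SOME y. (J 1 1 * J 2 2 - J 2 1 * J 1 2) * y = 1)"

text \<open>The first index of \<open>J\<close> is the variable of differentiation, so x_v is
  \<open>J 2 1\<close> and y_u is \<open>J 1 2\<close>.\<close>

sublocale coordinate_change "germ_partial 1" "germ_partial 2" "J 1 1" "J 2 1" "J 1 2" "J 2 2"
  \<delta>_inverse "(1 / 3) *\<^sub>R 1"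
proof
  show "(J 1 1 * J 2 2 - J 2 1 * J 1 2) * \<delta>_inverse = 1"
    unfolding \<delta>_inverse_def
    by (rule someI_ex, rule germ_inverse_exists)
      (use jacobian in \<open>simp add: germ_value_diff germ_value_mult value_J\<close>)
  show "3 * ((1 / 3) *\<^sub>R 1) = (1::germ)"
    by (simp flip: numeral_scaleR_1)
qed (simp_all add: derivation_germ_partial germ_partial_commute J_sym)

definition T :: "(real^2 \<Rightarrow> real) \<Rightarrow> germ" where "T f = germ_at q (\<lambda>x. f (\<sigma> x))"

lemma smooth_pullback: "smooth_on U f \<Longrightarrow> smooth_on W (\<lambda>x. f (\<sigma> x))" for f :: "real^2 \<Rightarrow> real"
  using smooth_on_compose[OF W _ _ \<sigma>, of U f] \<sigma>_U by blast

lemma germ_partial_T: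
  assumes "smooth_on U f"
  shows "germ_partial i (T f) = J i 1 * T (partial 1 f) + J i 2 * T (partial 2 f)"
proof -
  note sm = smooth_pullback[OF smooth_on_partial[OF assms]]
  have "germ_partial i (T f) = germ_at q (partial i (\<lambda>x. f (\<sigma> x)))"
    unfolding T_def by (intro germ_at_partial[symmetric] smooth_at_W smooth_pullback assms)
  also have "\<dots> = germ_at q (\<lambda>x. partial i \<sigma> x $ 1 * partial 1 f (\<sigma> x) + partial i \<sigma> x $ 2 * partial 2 f (\<sigma> x))"
    by (rule germ_at_cong[OF _ W q])
      (auto intro!: smooth_at_W smooth_on_partial smooth_pullback assms partial_compose
        smooth_on_differentiable[OF assms] smooth_on_differentiable[OF \<sigma>] \<sigma>_U)
  also have "\<dots> = J i 1 * T (partial 1 f) + J i 2 * T (partial 2 f)"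
    unfolding J_def T_def
    by (subst germ_at_add germ_at_mult; (intro smooth_at_W smooth_on_mult W smooth_J sm)?)+ simp
  finally show ?thesis .
qed

sublocale T: germ_evaluation T E1 E2 U "\<sigma> q"
proof
  show "T (partial 1 f) = E1 (T f)" "T (partial 2 f) = E2 (T f)" if "smooth_on U f" for f
  proof -
    have "E1 (T f) = \<delta> * (\<delta>_inverse * T (partial 1 f))" "E2 (T f) = \<delta> * (\<delta>_inverse * T (partial 2 f))"
      unfolding E1_def E2_def \<delta>_def germ_partial_T[OF that] by (simp_all add: algebra_simps)
    then show "T (partial 1 f) = E1 (T f)" "T (partial 2 f) = E2 (T f)"
      by (simp_all add: \<delta>_\<delta>')
  qed
  show "T f = T g" if "smooth_on U f" "\<And>x. x \<in> U \<Longrightarrow> f x = g x" for f g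
    unfolding T_def
    by (rule germ_at_cong[OF smooth_at_W[OF smooth_pullback[OF that(1)]] W q]) (simp add: that(2) \<sigma>_U)
  show "T (\<lambda>x. f x + g x) = T f + T g" "T (\<lambda>x. f x * g x) = T f * T g"
    if "smooth_on U f" "smooth_on U g" for f g
    unfolding T_def by (intro germ_at_add germ_at_mult smooth_at_W smooth_pullback that)+
  show "germ_value (T f) = f (\<sigma> q)" if "smooth_on U f" for f
    unfolding T_def by (rule germ_value_at[OF smooth_at_W[OF smooth_pullback[OF that]]])
qed (simp_all add: T_def U \<sigma>_U q derivation_E1 derivation_E2 germ_at_const)

interpretation T': germ_evaluation "germ_at q" "germ_partial 1" "germ_partial 2" W q
  using W q by (rule germ_evaluation_at)

text \<open>The law of the connection is taken with the Jacobian matrix on the left-hand side, as in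
  \<open>cubic_law_of_connection\<close>, so that no inverse matrix occurs. The identity of germs is
  evaluated at the base point at the end.\<close>

theorem det_M_change:
  fixes \<Gamma> \<Gamma>' :: christoffel
  assumes \<Gamma>: "\<And>k i j. smooth_on U (\<Gamma> k i j)" and \<Gamma>': "\<And>k i j. smooth_on W (\<Gamma>' k i j)"
    and sym: "\<And>x k. x \<in> U \<Longrightarrow> \<Gamma> k 2 1 x = \<Gamma> k 1 2 x"
    and law: "\<And>x r i j. x \<in> W \<Longrightarrow> (\<Sum>k\<in>UNIV. partial k \<sigma> x $ r * \<Gamma>' k i j x)
      = partial i (partial j \<sigma>) x $ r
        + (\<Sum>m\<in>UNIV. \<Sum>n\<in>UNIV. partial i \<sigma> x $ m * partial j \<sigma> x $ n * \<Gamma> r m n (\<sigma> x))"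
  shows "det (\<M> \<Gamma>' q) = (partial 1 \<sigma> q $ 1 * partial 2 \<sigma> q $ 2 - partial 2 \<sigma> q $ 1 * partial 1 \<sigma> q $ 2) ^ 14
    * det (\<M> \<Gamma> (\<sigma> q))"
proof -
  have sym': "T (\<Gamma> k 2 1) = T (\<Gamma> k 1 2)" for k
    by (rule T.T_cong) (simp_all add: \<Gamma> sym)
  have law': "J 1 r * germ_at q (\<Gamma>' 1 i j) + J 2 r * germ_at q (\<Gamma>' 2 i j) = germ_partial i (J j r)
      + (J i 1 * J j 1 * T (\<Gamma> r 1 1) + J i 1 * J j 2 * T (\<Gamma> r 1 2) + J i 2 * J j 1 * T (\<Gamma> r 1 2)
        + J i 2 * J j 2 * T (\<Gamma> r 2 2))" for r i j
  proof -
    note sm = smooth_on_mult[OF W] smooth_on_add[OF W] smooth_J smooth_J2 \<Gamma>' smooth_pullback[OF \<Gamma>]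
    have "J 1 r * germ_at q (\<Gamma>' 1 i j) + J 2 r * germ_at q (\<Gamma>' 2 i j)
        = germ_at q (\<lambda>x. partial 1 \<sigma> x $ r * \<Gamma>' 1 i j x + partial 2 \<sigma> x $ r * \<Gamma>' 2 i j x)"
      unfolding J_def by (simp add: T'.T_add T'.T_mult sm)
    also have "\<dots> = germ_at q (\<lambda>x. partial i (partial j \<sigma>) x $ r
        + (partial i \<sigma> x $ 1 * partial j \<sigma> x $ 1 * \<Gamma> r 1 1 (\<sigma> x)
        + partial i \<sigma> x $ 1 * partial j \<sigma> x $ 2 * \<Gamma> r 1 2 (\<sigma> x)
        + partial i \<sigma> x $ 2 * partial j \<sigma> x $ 1 * \<Gamma> r 2 1 (\<sigma> x)
        + partial i \<sigma> x $ 2 * partial j \<sigma> x $ 2 * \<Gamma> r 2 2 (\<sigma> x)))"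
      by (rule T'.T_cong) (use law in \<open>auto simp: sm sum_2 add.assoc\<close>)
    also have "\<dots> = germ_partial i (J j r)
      + (J i 1 * J j 1 * T (\<Gamma> r 1 1) + J i 1 * J j 2 * T (\<Gamma> r 1 2) + J i 2 * J j 1 * T (\<Gamma> r 2 1)
        + J i 2 * J j 2 * T (\<Gamma> r 2 2))"
      unfolding germ_partial_J unfolding J_def T_def by (simp add: T'.T_add T'.T_mult sm)
    finally show ?thesis by (simp add: sym')
  qed
  let ?h = "(1 / 3) *\<^sub>R (1::germ)"
  let ?p1 = "?h * (T (\<Gamma> 1 1 1) - 2 * T (\<Gamma> 2 1 2))" and ?p2 = "?h * (2 * T (\<Gamma> 1 1 2) - T (\<Gamma> 2 2 2))"
  let ?q1 = "?h * (germ_at q (\<Gamma>' 1 1 1) - 2 * germ_at q (\<Gamma>' 2 1 2))"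
  let ?q2 = "?h * (2 * germ_at q (\<Gamma>' 1 1 2) - germ_at q (\<Gamma>' 2 2 2))"
  have A: "T (A0 \<Gamma>) = - T (\<Gamma> 2 1 1)" "T (A1 \<Gamma>) = 3 *\<^sub>R ?p1" "T (A2 \<Gamma>) = 3 *\<^sub>R ?p2" "T (A3 \<Gamma>) = T (\<Gamma> 1 2 2)"
    unfolding A0_def[abs_def] A1_def[abs_def] A2_def[abs_def] A3_def[abs_def]
    by (simp_all add: T.T_simps T.smooth_intros \<Gamma> numeral_scaleR_1)
  have A': "germ_at q (A0 \<Gamma>') = - germ_at q (\<Gamma>' 2 1 1)" "germ_at q (A1 \<Gamma>') = 3 *\<^sub>R ?q1"
    "germ_at q (A2 \<Gamma>') = 3 *\<^sub>R ?q2" "germ_at q (A3 \<Gamma>') = germ_at q (\<Gamma>' 1 2 2)"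
    unfolding A0_def[abs_def] A1_def[abs_def] A2_def[abs_def] A3_def[abs_def]
    by (simp_all add: T'.T_simps T'.smooth_intros \<Gamma>' numeral_scaleR_1)
  have "cubic_law (- T (\<Gamma> 2 1 1)) ?p1 ?p2 (T (\<Gamma> 1 2 2))
      (- germ_at q (\<Gamma>' 2 1 1)) ?q1 ?q2 (germ_at q (\<Gamma>' 1 2 2))"
    by (rule cubic_law_of_connection) (simp_all only: law', simp_all add: algebra_simps)
  moreover have "(\<exists>ak. J 1 1 * ak = 1) \<or> (\<exists>ck. J 1 2 * ck = 1)"
  proof (cases "germ_value (J 1 1) = 0")
    case True
    then have "germ_value (J 1 2) \<noteq> 0"
      using jacobian by (auto simp: value_J)
    then show ?thesis using germ_inverse_exists by blast
  next
    case False
    then show ?thesis using germ_inverse_exists by blast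
  qed
  ultimately have "det (cubic.M (germ_partial 1) (germ_partial 2) (- germ_at q (\<Gamma>' 2 1 1)) ?q1 ?q2 (germ_at q (\<Gamma>' 1 2 2)))
      = \<delta> ^ 14 * det (cubic.M E1 E2 (- T (\<Gamma> 2 1 1)) ?p1 ?p2 (T (\<Gamma> 1 2 2)))"
    by (rule det_change)
  from arg_cong[OF this, of germ_value, unfolded germ_value_mult germ_value_power]
  have "16 * det (\<M> \<Gamma>' q) = germ_value \<delta> ^ 14 * (16 * det (\<M> \<Gamma> (\<sigma> q)))"
    unfolding T.germ_value_det_M[OF \<Gamma> A(2,3), unfolded A, symmetric]
      T'.germ_value_det_M[OF \<Gamma>' A'(2,3), unfolded A', symmetric] .
  moreover have "germ_value \<delta> = partial 1 \<sigma> q $ 1 * partial 2 \<sigma> q $ 2 - partial 2 \<sigma> q $ 1 * partial 1 \<sigma> q $ 2"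
    unfolding \<delta>_def by (simp add: germ_value_diff germ_value_mult value_J)
  ultimately show ?thesis by simp
qed

end

text \<open>The determinant over the germs is formed from the germs of the A_i alone.\<close>

lemma det_M_cong:
  assumes "open U" "p \<in> U" "\<And>k i j. smooth_on U (\<Gamma> k i j)" "\<And>k i j. smooth_on U (\<Gamma>' k i j)"
    and A: "\<And>x. x \<in> U \<Longrightarrow> A0 \<Gamma> x = A0 \<Gamma>' x" "\<And>x. x \<in> U \<Longrightarrow> A1 \<Gamma> x = A1 \<Gamma>' x"
      "\<And>x. x \<in> U \<Longrightarrow> A2 \<Gamma> x = A2 \<Gamma>' x" "\<And>x. x \<in> U \<Longrightarrow> A3 \<Gamma> x = A3 \<Gamma>' x"
  shows "det (\<M> \<Gamma> p) = det (\<M> \<Gamma>' p)"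
proof -
  interpret germ_evaluation "germ_at p" "germ_partial 1" "germ_partial 2" U p
    by (rule germ_evaluation_at) fact+
  have 3: "x = 3 *\<^sub>R ((1 / 3) *\<^sub>R x)" for x :: germ
    by simp
  note sm = smooth_A[of \<Gamma>, OF assms(3) 3 3]
  have eq: "germ_at p (A0 \<Gamma>) = germ_at p (A0 \<Gamma>')" "germ_at p (A1 \<Gamma>) = germ_at p (A1 \<Gamma>')"
    "germ_at p (A2 \<Gamma>) = germ_at p (A2 \<Gamma>')" "germ_at p (A3 \<Gamma>) = germ_at p (A3 \<Gamma>')"
    using T_cong[OF sm(1) A(1)] T_cong[OF sm(2) A(2)] T_cong[OF sm(3) A(3)] T_cong[OF sm(4) A(4)]
    by simp_all
  have "16 * det (\<M> \<Gamma> p) = 16 * det (\<M> \<Gamma>' p)"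
    using germ_value_det_M[of \<Gamma>, OF assms(3) 3 3] germ_value_det_M[of \<Gamma>', OF assms(4) 3 3]
    by (simp add: eq)
  then show ?thesis by simp
qed

lemma smooth_det_M:
  assumes "open U" "\<And>k i j. smooth_on U (\<Gamma> k i j)"
  shows "smooth_on U (\<lambda>p. det (\<M> \<Gamma> p))"
\<comment> \<open>A \<open>germ_evaluation\<close> needs a base point, so the empty set is treated
  apart.\<close>
proof (cases "U = {}")
  case True
  then show ?thesis
    using smooth_on_cong[of "{}" "\<lambda>p. 0"] smooth_on_const by auto
next
  case False
  then obtain p where "p \<in> U" by blast
  then interpret germ_evaluation "germ_at p" "germ_partial 1" "germ_partial 2" U p
    using assms(1) by (intro germ_evaluation_at)
  have 3: "x = 3 *\<^sub>R ((1 / 3) *\<^sub>R x)" for x :: germ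
    by simp
  show ?thesis
    unfolding det_def
    by (intro smooth_on_sum smooth_on_mult smooth_on_prod smooth_on_const assms(1)
        T_M(1)[OF assms(2) 3 3])
qed

section \<open>Transition maps and the global section\<close>

section \<open>Charts\<close>

lemma is_chartD:
  assumes "is_chart X c"
  shows "fst c \<subseteq> topspace X" "openin X (fst c)" "open (chart_image c)" "inj_on (snd c) (fst c)"
proof -
  show *: "openin X (fst c)" "open (chart_image c)"
    using assms by (simp_all add: is_chart_def)
  then show "fst c \<subseteq> topspace X"
    by (simp add: openin_subset)
  then have "topspace (subtopology X (fst c)) = fst c"
    by auto
  then show "inj_on (snd c) (fst c)"
    using assms homeomorphic_imp_injective_map unfolding is_chart_def by metis
qed

lemma open_overlap:
  assumes "is_chart X c" "is_chart X d"
  shows "open (snd d ` (fst c \<inter> fst d))"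
proof -
  have "openin (subtopology X (fst d)) (fst c \<inter> fst d)"
    using is_chartD(2)[OF assms(1)] by (auto simp: openin_subtopology)
  then have "openin (top_of_set (chart_image d)) (snd d ` (fst c \<inter> fst d))"
    using assms(2) homeomorphic_imp_open_map unfolding is_chart_def open_map_def by blast
  then show ?thesis
    using is_chartD(3)[OF assms(2)] openin_open_trans by blast
qed

lemma transition_apply:
  assumes "is_chart X d" "u \<in> fst d"
  shows "transition d c (snd d u) = snd c u"
  using is_chartD(4)[OF assms(1)] assms(2) by (simp add: transition_def)

text \<open>The chain rule for the composition of \<tau> and \<sigma>, which is the identity near
  x.\<close>

lemma partial_inverse:
  assumes W: "open W" "x \<in> W" and inv: "\<And>x. x \<in> W \<Longrightarrow> \<tau> (\<sigma> x) = x"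
    and \<sigma>: "\<sigma> differentiable (at x)" and \<tau>: "\<tau> differentiable (at (\<sigma> x))"
  shows "partial i \<sigma> x $ 1 * partial 1 \<tau> (\<sigma> x) $ k + partial i \<sigma> x $ 2 * partial 2 \<tau> (\<sigma> x) $ k
    = of_bool (i = k)"
proof -
  have \<tau>': "(\<lambda>y. \<tau> y $ k) differentiable (at (\<sigma> x))"
    using \<tau> bounded_linear.has_derivative[OF bounded_linear_vec_nth] unfolding differentiable_def by blast
  have "partial i \<sigma> x $ 1 * partial 1 \<tau> (\<sigma> x) $ k + partial i \<sigma> x $ 2 * partial 2 \<tau> (\<sigma> x) $ k
      = partial i (\<lambda>x. \<tau> (\<sigma> x) $ k) x"
    using partial_compose[OF \<tau>' \<sigma>] by (simp add: partial_vec_nth[OF \<tau>])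
  also have "\<dots> = partial i (\<lambda>x. x $ k) x"
    by (rule partial_cong[OF W]) (simp add: inv)
  also have "\<dots> = axis i 1 $ k"
  proof -
    have "((\<lambda>x::real^2. x $ k) has_derivative (\<lambda>v. v $ k)) (at x)"
      by (rule bounded_linear_imp_has_derivative[OF bounded_linear_vec_nth])
    from frechet_derivative_at[OF this, symmetric] show ?thesis
      by (simp add: partial_def)
  qed
  finally show ?thesis by (auto simp: axis_def)
qed

lemma det_M_transition:
  assumes c: "is_chart X c" and d: "is_chart X d" and cd: "compatible_charts c d"
    and \<Gamma>: "\<Gamma> \<in> torsion_free_connections \<A>" and \<A>: "c \<in> \<A>" "d \<in> \<A>"
    and u: "u \<in> fst c \<inter> fst d"
  shows "det (\<M> (\<Gamma> d) (snd d u)) * det (jacobian (transition c d) (at (snd c u))) ^ 14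
    = det (\<M> (\<Gamma> c) (snd c u))"
proof -
  \<comment> \<open>The coordinates of \<open>d\<close> are the new ones (u,v), those of
    \<open>c\<close> the old ones (x,y), so \<sigma> leads from \<open>d\<close> to
    \<open>c\<close>. The Jacobian determinant in the claim is that of the inverse \<tau>.\<close>
  define \<sigma> \<tau> W W' where "\<sigma> = transition d c" and "\<tau> = transition c d"
    and "W = snd d ` (fst c \<inter> fst d)" and "W' = snd c ` (fst c \<inter> fst d)"
  have W: "open W" "open W'"
    using open_overlap[OF c d] open_overlap[OF d c] by (simp_all add: W_def W'_def Int_commute)
  have sm: "smooth_on W \<sigma>" "smooth_on W' \<tau>"
    using cd by (simp_all add: compatible_charts_def \<sigma>_def \<tau>_def W_def W'_def)
  have \<sigma>: "\<sigma> x \<in> W'" "\<tau> (\<sigma> x) = x" if "x \<in> W" for x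
    using that by (auto simp: W_def W'_def \<sigma>_def \<tau>_def transition_apply[OF d] transition_apply[OF c])
  have \<tau>: "\<tau> y \<in> W" "\<sigma> (\<tau> y) = y" if "y \<in> W'" for y
    using that by (auto simp: W_def W'_def \<sigma>_def \<tau>_def transition_apply[OF d] transition_apply[OF c])
  note diff = smooth_on_differentiable[OF sm(1)] smooth_on_differentiable[OF sm(2)]
  have \<sigma>\<tau>: "partial i \<sigma> x $ 1 * partial 1 \<tau> (\<sigma> x) $ k + partial i \<sigma> x $ 2 * partial 2 \<tau> (\<sigma> x) $ k
      = of_bool (i = k)" if "x \<in> W" for x i k
    using that by (intro partial_inverse[OF W(1)] diff \<sigma>)
  have \<tau>\<sigma>: "partial i \<tau> (\<sigma> x) $ 1 * partial 1 \<sigma> x $ k + partial i \<tau> (\<sigma> x) $ 2 * partial 2 \<sigma> x $ k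
      = of_bool (i = k)" if "x \<in> W" for x i k
    using partial_inverse[OF W(2) \<sigma>(1)[OF that] \<tau>(2) diff(2)[OF \<sigma>(1)[OF that]], of i k] diff(1)[OF that]
    by (simp add: \<sigma>(2)[OF that])
  define q where "q = snd d u"
  have q_u: "q \<in> W" "\<sigma> q = snd c u"
    using u by (auto simp: q_def W_def \<sigma>_def transition_apply[OF d])
  define \<Delta> where "\<Delta> = partial 1 \<sigma> q $ 1 * partial 2 \<sigma> q $ 2 - partial 2 \<sigma> q $ 1 * partial 1 \<sigma> q $ 2"
  have J: "det (jacobian \<tau> (at (\<sigma> q))) = partial 1 \<tau> (\<sigma> q) $ 1 * partial 2 \<tau> (\<sigma> q) $ 2
      - partial 2 \<tau> (\<sigma> q) $ 1 * partial 1 \<tau> (\<sigma> q) $ 2"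
    by (simp add: det_2 jacobian_def matrix_def partial_def)
  have one: "\<Delta> * det (jacobian \<tau> (at (\<sigma> q))) = 1"
  proof -
    have "\<Delta> * det (jacobian \<tau> (at (\<sigma> q))) =
        (partial 1 \<sigma> q $ 1 * partial 1 \<tau> (\<sigma> q) $ 1 + partial 1 \<sigma> q $ 2 * partial 2 \<tau> (\<sigma> q) $ 1)
        * (partial 2 \<sigma> q $ 1 * partial 1 \<tau> (\<sigma> q) $ 2 + partial 2 \<sigma> q $ 2 * partial 2 \<tau> (\<sigma> q) $ 2)
        - (partial 1 \<sigma> q $ 1 * partial 1 \<tau> (\<sigma> q) $ 2 + partial 1 \<sigma> q $ 2 * partial 2 \<tau> (\<sigma> q) $ 2)
        * (partial 2 \<sigma> q $ 1 * partial 1 \<tau> (\<sigma> q) $ 1 + partial 2 \<sigma> q $ 2 * partial 2 \<tau> (\<sigma> q) $ 1)"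
      unfolding J \<Delta>_def by (simp add: algebra_simps)
    then show ?thesis by (simp add: \<sigma>\<tau>[OF q_u(1)])
  qed
  have W_sub: "W \<subseteq> chart_image d" "W' \<subseteq> chart_image c"
    by (auto simp: W_def W'_def chart_image_def)
  have \<Gamma>_sm: "smooth_on W' (\<Gamma> c k i j)" "smooth_on W (\<Gamma> d k i j)" for k i j
    using \<Gamma> \<A> W_sub smooth_on_subset unfolding torsion_free_connections_def by blast+
  interpret coordinate_germs \<sigma> W W' q
    by standard (use W q_u(1) sm \<sigma> one in \<open>auto simp: \<Delta>_def\<close>)
  have "det (\<M> (\<Gamma> d) q) = \<Delta> ^ 14 * det (\<M> (\<Gamma> c) (\<sigma> q))"
    unfolding \<Delta>_def
  proof (rule det_M_change)
    show "\<Gamma> c k 2 1 x = \<Gamma> c k 1 2 x" if "x \<in> W'" for x k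
      using \<Gamma> \<A> W_sub that unfolding torsion_free_connections_def by blast
    fix x :: "real^2" and r i j :: 2
    assume x: "x \<in> W"
    \<comment> \<open>The law of the connection applies the Jacobian matrix of \<tau> to Z.
      Multiplying by that of \<sigma> leaves Z, which is the form of the law asked for.\<close>
    define Z where "Z s = partial i (partial j \<sigma>) x $ s
      + (\<Sum>m\<in>UNIV. \<Sum>n\<in>UNIV. partial i \<sigma> x $ m * partial j \<sigma> x $ n * \<Gamma> c s m n (\<sigma> x))" for s
    have law: "\<Gamma> d k i j x = (\<Sum>s\<in>UNIV. partial s \<tau> (\<sigma> x) $ k * Z s)" for k
      using \<Gamma> \<A> x unfolding torsion_free_connections_def Let_def Z_def \<sigma>_def \<tau>_def W_def by blast
    have "(\<Sum>k\<in>UNIV. partial k \<sigma> x $ r * \<Gamma> d k i j x)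
        = (\<Sum>s\<in>UNIV. Z s * (partial s \<tau> (\<sigma> x) $ 1 * partial 1 \<sigma> x $ r + partial s \<tau> (\<sigma> x) $ 2 * partial 2 \<sigma> x $ r))"
      unfolding law sum_2 by (simp add: algebra_simps)
    also have "\<dots> = Z r"
      unfolding \<tau>\<sigma>[OF x] using exhaust_2[of r] by (auto simp: sum_2)
    finally show "(\<Sum>k\<in>UNIV. partial k \<sigma> x $ r * \<Gamma> d k i j x) = partial i (partial j \<sigma>) x $ r
        + (\<Sum>m\<in>UNIV. \<Sum>n\<in>UNIV. partial i \<sigma> x $ m * partial j \<sigma> x $ n * \<Gamma> c r m n (\<sigma> x))"
      unfolding Z_def .
  qed (rule \<Gamma>_sm)+
  then have "det (\<M> (\<Gamma> d) q) * det (jacobian \<tau> (at (\<sigma> q))) ^ 14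
      = (\<Delta> * det (jacobian \<tau> (at (\<sigma> q)))) ^ 14 * det (\<M> (\<Gamma> c) (\<sigma> q))"
    by (simp add: power_mult_distrib)
  then show ?thesis
    unfolding one by (simp add: q_u q_def[symmetric] \<tau>_def)
qed

theorem mainTheorem5:
  fixes X :: "'a topology"
    and \<A> :: "'a chart set"
    and P :: "('a chart \<Rightarrow> christoffel) set"
  assumes "smooth_surface X \<A>"
    and "P \<in> projective_structures \<A>"
  shows "\<exists>s. canonical_power_section \<A> 14 s \<and>
    (\<forall>\<Gamma>\<in>P. \<forall>c\<in>\<A>. \<forall>p\<in>chart_image c. det (\<M> (\<Gamma> c) p) = s c p)"
proof -
  have chart: "is_chart X c" if "c \<in> \<A>" for c
    using assms(1) that by (simp add: smooth_surface_def)
  have compatible: "compatible_charts c d" if "c \<in> \<A>" "d \<in> \<A>" for c d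
    using assms(1) that by (simp add: smooth_surface_def)
  obtain \<Gamma>0 where \<Gamma>0: "\<Gamma>0 \<in> torsion_free_connections \<A>" "P = projective_equivalence \<A> `` {\<Gamma>0}"
    using assms(2) by (auto simp: projective_structures_def quotient_def)
  have smooth: "smooth_on (chart_image c) (\<Gamma> c k i j)"
    if "\<Gamma> \<in> torsion_free_connections \<A>" "c \<in> \<A>" for \<Gamma> c k i j
    using that by (simp add: torsion_free_connections_def)
  \<comment> \<open>Any representative will do; independence of it is the second half of the
    proof.\<close>
  define s where "s c p = det (\<M> (\<Gamma>0 c) p)" for c p
  have "canonical_power_section \<A> 14 s"
    unfolding canonical_power_section_def s_def
  proof (intro conjI ballI)
    show "smooth_on (chart_image c) (\<lambda>p. det (\<M> (\<Gamma>0 c) p))" if "c \<in> \<A>" for c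
      by (rule smooth_det_M[OF is_chartD(3)[OF chart[OF that]] smooth[OF \<Gamma>0(1) that]])
    show "det (\<M> (\<Gamma>0 d) (snd d u)) * det (jacobian (transition c d) (at (snd c u))) ^ 14
        = det (\<M> (\<Gamma>0 c) (snd c u))" if "c \<in> \<A>" "d \<in> \<A>" "u \<in> fst c \<inter> fst d" for c d u
      by (rule det_M_transition[OF chart chart compatible \<Gamma>0(1)]) fact+
  qed
  moreover have "det (\<M> (\<Gamma> c) p) = s c p" if "\<Gamma> \<in> P" and c: "c \<in> \<A>" and p: "p \<in> chart_image c" for \<Gamma> c p
  proof -
    have equiv: "(\<Gamma>0, \<Gamma>) \<in> projective_equivalence \<A>"
      using that(1) \<Gamma>0(2) by simp
    then have \<Gamma>: "\<Gamma> \<in> torsion_free_connections \<A>"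
      by (simp add: projective_equivalence_def)
    obtain \<omega> where \<omega>: "\<And>p k i j. p \<in> chart_image c \<Longrightarrow> \<Gamma> c k i j p =
        \<Gamma>0 c k i j p + of_bool (k = i) * \<omega> c j p + of_bool (k = j) * \<omega> c i p"
      using equiv c unfolding projective_equivalence_def by blast
    show ?thesis
      unfolding s_def
      \<comment> \<open>In A_0 and A_3 the upper index differs from both lower ones, so \<omega>
        does not enter. In A_1 and A_2 the contributions 2 \<omega>_1 and 2 \<omega>_2 of the two
        symbols cancel.\<close>
      by (rule det_M_cong[OF is_chartD(3)[OF chart[OF c]] p smooth[OF \<Gamma> c]
            smooth[OF \<Gamma>0(1) c]])
        (simp_all add: A0_def A1_def A2_def A3_def \<omega>)
  qed
  ultimately show ?thesis by blast
qed

end
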